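(* Let $\Omega_2=\{(\xi_1,\xi_2)\in\mathbb{T}^2:\sin^2(\pi\xi_1)+\sin^2(\pi\xi_2)\le1\}$, which is the diamond $\{|\xi_1|+|\xi_2|\le\frac12\}$, and let $D=[-\frac12,0]\times[-\frac12,\frac12]\subset\mathbb{T}^2$. Let $P$ be the piecewise translation that maps $\Omega_2$ onto $D$ (up to null sets), given (modulo $\mathbb{Z}^2$) by $$P(\xi)=\begin{cases}\xi,&\xi\in D_1=\{-\frac12<\xi_1<0,\ -\xi_1-\frac12<\xi_2<\xi_1+\frac12\},\\ \xi+(-\frac12,-\frac12),&\xi\in D_2=\{0\le\xi_1\le\frac12,\ 0\le\xi_2\le-\xi_1+\frac12\},\\ \xi+(-\frac12,\frac12),&\xi\in D_3=\{0\le\xi_1\le\frac12,\ \xi_1-\frac12\le\xi_2<0\},\end{cases}$$ and let $S:L^2(\Omega_2)\to L^2(D)$, $Sg=g\circ P^{-1}|_D$. Let $s=(s_1,s_2):\mathbb{N}\to\mathbb{Z}^2$ be a bijection and let $$\widetilde\psi_n(\tau)=\sqrt2\,e^{2\pi i(2s_1(n),s_2(n))\cdot\tau}\chi_D(\tau),\qquad n\in\mathbb{N},$$ which is an orthonormal basis of $L^2(D)$. Then the functions $$\psi_n(\xi)=S^{-1}\widetilde\psi_n(\xi)=\sqrt2\,e^{2\pi i(2s_1(n),s_2(n))\cdot\xi}\bigl(\chi_{D_1}(\xi)+(-1)^{s_2(n)}\chi_{D_2\cup D_3}(\xi)\bigr),\qquad n\in\mathbb{N},$$ form an orthonormal basis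 of $L^2(\Omega_2)$. Moreover, let $(\lambda_n)_{n\in\mathbb{N}}$ be a uniformly separated sequence in the open unit disc, $T=\sum_{n=0}^\infty\lambda_n\langle\cdot,\widetilde\psi_n\rangle\widetilde\psi_n$ on $L^2(D)$, $h_0\in L^2(D)$ with $|\langle h_0,\widetilde\psi_n\rangle|^2\sim1-|\lambda_n|^2$, $f_0=\mathcal{F}^{-1}S^{-1}h_0$ and $R=\mathcal{F}^{-1}S^{-1}TS\mathcal{F}$. Then $(R^nf_0)_{n\in\mathbb{N}}$ is a frame for $GPW_1(\mathbb{Z}^2)$, and $$R=\sum_{n=0}^\infty\lambda_n\langle\cdot,\mathcal{F}^{-1}\psi_n\rangle\,\mathcal{F}^{-1}\psi_n\qquad\text{on }GPW_1(\mathbb{Z}^2).$$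
   Context: $\mathbb{N}=\{0,1,2,\dots\}$. $\mathbb{T}^2$ is identified with $[-\frac12,\frac12)^2$ with addition modulo $\mathbb{Z}^2$ and Lebesgue measure. $\mathcal{F}:\ell^2(\mathbb{Z}^2)\to L^2(\mathbb{T}^2)$ is the unitary Fourier transform $\mathcal{F}f(\xi)=\sum_{k\in\mathbb{Z}^2}f(k)e^{2\pi ik\cdot\xi}$. For measurable $E\subset\mathbb{T}^2$, $L^2(E)$ is the space of $g\in L^2(\mathbb{T}^2)$ vanishing a.e. outside $E$ and $\chi_E$ is the characteristic function of $E$. $GPW_1(\mathbb{Z}^2)=\{f\in\ell^2(\mathbb{Z}^2):\mathcal{F}f\in L^2(\Omega_2)\}$; it is the spectral subspace for $[0,1]$ of the normalized Laplacian of the lattice graph $\mathbb{Z}^2$, whose Fourier symbol is $\sin^2(\pi\xi_1)+\sin^2(\pi\xi_2)$. The operator $R$ is considered on $GPW_1(\mathbb{Z}^2)$, where $\mathcal{F}f\in L^2(\Omega_2)$ so that $S\mathcal{F}f$ makes sense. A sequence $(\lambda_j)_{j\in\mathbb{N}}$ in the open unit disc is uniformly separated if $\inf_{j}\prod_{k\ne j}\left|\frac{\lambda_j-\lambda_k}{1-\overline{\lambda_k}\lambda_j}\right|>0$. For nonnegative sequences, $a_j\sim b_j$ means there exist $c,C>0$ with $c\,a_j\le b_j\le C\,a_j$ for all $j$. A sequence $(f_n)$ in a Hilbert space $\mathcal{H}$ is a frame for $\mathcal{H}$ if there are $A,B>0$ with $A\|f\|^2\le\sum_n|\langle f,f_n\rangle|^2\le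 B\|f\|^2$ for all $f\in\mathcal{H}$. *)

theory Defs
  imports "HOL-Analysis.Analysis"
begin

text \<open>
  The space \<open>L\<^sup>2(M)\<close> is rendered by its representatives: honest functions, with equality of
  elements of \<open>L\<^sup>2(M)\<close> meaning equality almost everywhere. Taking for \<open>M\<close> the
  counting measure gives \<open>\<ell>\<^sup>2\<close>, where almost everywhere means everywhere.
\<close>

definition L2 :: "'a measure \<Rightarrow> ('a \<Rightarrow> complex) set" where
  "L2 M = {f \<in> borel_measurable M. integrable M (\<lambda>x. (cmod (f x))\<^sup>2)}"

definition L2_ip :: "'a measure \<Rightarrow> ('a \<Rightarrow> complex) \<Rightarrow> ('a \<Rightarrow> complex) \<Rightarrow> complex" where
  "L2_ip M f g = (LINT x|M. f x * cnj (g x))"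

definition L2_norm :: "'a measure \<Rightarrow> ('a \<Rightarrow> complex) \<Rightarrow> real" where
  "L2_norm M f = sqrt (LINT x|M. (cmod (f x))\<^sup>2)"

definition L2_lim ::
    "'a measure \<Rightarrow> 'i filter \<Rightarrow> ('i \<Rightarrow> 'a \<Rightarrow> complex) \<Rightarrow> ('a \<Rightarrow> complex) \<Rightarrow> bool" where
  "L2_lim M F u g \<longleftrightarrow>
     g \<in> L2 M \<and> (\<forall>\<^sub>F i in F. u i \<in> L2 M) \<and>
     ((\<lambda>i. L2_norm M (\<lambda>x. u i x - g x)) \<longlongrightarrow> 0) F"

definition L2_on :: "'a measure \<Rightarrow> 'a set \<Rightarrow> ('a \<Rightarrow> complex) set" where
  "L2_on M E = {g \<in> L2 M. AE x in M. x \<notin> E \<longrightarrow> g x = 0}"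

text \<open>
  A representative of the preimage, in the space \<open>A\<close>, of the class of \<open>h\<close> under an
  operator \<open>\<Phi>\<close> with values in \<open>L\<^sup>2(N)\<close>.
\<close>

definition L2_inverse ::
    "('a \<Rightarrow> complex) set \<Rightarrow> 'b measure \<Rightarrow> (('a \<Rightarrow> complex) \<Rightarrow> 'b \<Rightarrow> complex)
      \<Rightarrow> ('b \<Rightarrow> complex) \<Rightarrow> 'a \<Rightarrow> complex" where
  "L2_inverse A N \<Phi> h = (SOME g. g \<in> A \<and> (AE x in N. \<Phi> g x = h x))"

text \<open>In the following two definitions \<open>H\<close> is a closed subspace of \<open>L\<^sup>2(M)\<close>.\<close>

definition orthonormal_basis ::
    "'a measure \<Rightarrow> ('a \<Rightarrow> complex) set \<Rightarrow> (nat \<Rightarrow> 'a \<Rightarrow> complex) \<Rightarrow> bool" where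
  "orthonormal_basis M H e \<longleftrightarrow>
     (\<forall>n. e n \<in> H) \<and>
     (\<forall>m n. L2_ip M (e m) (e n) = (if m = n then 1 else 0)) \<and>
     (\<forall>g\<in>H. L2_lim M sequentially (\<lambda>N x. \<Sum>n<N. L2_ip M g (e n) * e n x) g)"

definition is_frame ::
    "'a measure \<Rightarrow> ('a \<Rightarrow> complex) set \<Rightarrow> (nat \<Rightarrow> 'a \<Rightarrow> complex) \<Rightarrow> bool" where
  "is_frame M H f \<longleftrightarrow>
     (\<forall>n. f n \<in> H) \<and>
     (\<exists>A>0. \<exists>B>0. \<forall>g\<in>H.
        summable (\<lambda>n. (cmod (L2_ip M g (f n)))\<^sup>2) \<and>
        A * (L2_norm M g)\<^sup>2 \<le> (\<Sum>n. (cmod (L2_ip M g (f n)))\<^sup>2) \<and>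
        (\<Sum>n. (cmod (L2_ip M g (f n)))\<^sup>2) \<le> B * (L2_norm M g)\<^sup>2)"

text \<open>
  The infinite product is the limit of its (decreasing) partial products; \<open>prodinf\<close> would be
  unspecified for a product that diverges to 0.
\<close>

definition uniformly_separated :: "(nat \<Rightarrow> complex) \<Rightarrow> bool" where
  "uniformly_separated l \<longleftrightarrow>
     (\<forall>j. cmod (l j) < 1) \<and>
     (INF j. lim (\<lambda>N. \<Prod>k\<in>{..<N} - {j}. cmod ((l j - l k) / (1 - cnj (l k) * l j)))) > 0"

definition comparable :: "(nat \<Rightarrow> real) \<Rightarrow> (nat \<Rightarrow> real) \<Rightarrow> bool" where
  "comparable a b \<longleftrightarrow> (\<exists>c>0. \<exists>C>0. \<forall>j. c * a j \<le> b j \<and> b j \<le> C * a j)"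

definition torus :: "(real \<times> real) measure" where
  "torus = lebesgue_on ({-1/2..<1/2} \<times> {-1/2..<1/2})"

text \<open>The representative in \<open>[-1/2, 1/2)\<^sup>2\<close> of a point modulo \<open>\<int>\<^sup>2\<close>.\<close>

definition wrap :: "real \<times> real \<Rightarrow> real \<times> real" where
  "wrap \<xi> = (fst \<xi> - of_int \<lfloor>fst \<xi> + 1/2\<rfloor>, snd \<xi> - of_int \<lfloor>snd \<xi> + 1/2\<rfloor>)"

abbreviation ell2 :: "(int \<times> int) measure" where
  "ell2 \<equiv> count_space UNIV"

definition character :: "int \<times> int \<Rightarrow> real \<times> real \<Rightarrow> complex" where
  "character k \<xi> =
     exp (2 * complex_of_real pi * \<i> *
          complex_of_real (of_int (fst k) * fst \<xi> + of_int (snd k) * snd \<xi>))"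

definition fourier :: "(int \<times> int \<Rightarrow> complex) \<Rightarrow> real \<times> real \<Rightarrow> complex" where
  "fourier f =
     (SOME g. L2_lim torus (finite_subsets_at_top UNIV)
                (\<lambda>K \<xi>. \<Sum>k\<in>K. f k * character k \<xi>) g)"

definition fourier_inv :: "(real \<times> real \<Rightarrow> complex) \<Rightarrow> int \<times> int \<Rightarrow> complex" where
  "fourier_inv = L2_inverse (L2 ell2) torus fourier"

definition Omega2 :: "(real \<times> real) set" where
  "Omega2 = {\<xi> \<in> space torus. (sin (pi * fst \<xi>))\<^sup>2 + (sin (pi * snd \<xi>))\<^sup>2 \<le> 1}"

definition GPW1 :: "(int \<times> int \<Rightarrow> complex) set" where
  "GPW1 = {f \<in> L2 ell2. fourier f \<in> L2_on torus Omega2}"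

definition D :: "(real \<times> real) set" where
  "D = wrap ` ({-1/2..0} \<times> {-1/2..1/2})"

definition D1 :: "(real \<times> real) set" where
  "D1 = wrap ` {(x, y). -1/2 < x \<and> x < 0 \<and> -x - 1/2 < y \<and> y < x + 1/2}"

definition D2 :: "(real \<times> real) set" where
  "D2 = wrap ` {(x, y). 0 \<le> x \<and> x \<le> 1/2 \<and> 0 \<le> y \<and> y \<le> -x + 1/2}"

definition D3 :: "(real \<times> real) set" where
  "D3 = wrap ` {(x, y). 0 \<le> x \<and> x \<le> 1/2 \<and> x - 1/2 \<le> y \<and> y < 0}"

text \<open>
  Only the values on \<open>D1 \<union> D2 \<union> D3\<close> matter. The point \<open>(0, -1/2)\<close>, which lies in both
  \<open>D2\<close> and \<open>D3\<close> modulo \<open>\<int>\<^sup>2\<close>, gets the same value from both branches.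
\<close>

definition P :: "real \<times> real \<Rightarrow> real \<times> real" where
  "P \<xi> = (if \<xi> \<in> D1 then \<xi>
          else if \<xi> \<in> D2 then wrap (\<xi> + (-1/2, -1/2))
          else wrap (\<xi> + (-1/2, 1/2)))"

text \<open>\<open>P\<close> covers \<open>D\<close> only up to a null set, on which the value is set to 0.\<close>

definition S :: "(real \<times> real \<Rightarrow> complex) \<Rightarrow> real \<times> real \<Rightarrow> complex" where
  "S g \<tau> = (if \<tau> \<in> D \<inter> P ` (D1 \<union> D2 \<union> D3) then g (inv_into (D1 \<union> D2 \<union> D3) P \<tau>) else 0)"

definition S_inv :: "(real \<times> real \<Rightarrow> complex) \<Rightarrow> real \<times> real \<Rightarrow> complex" where
  "S_inv = L2_inverse (L2_on torus Omega2) torus S"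

definition psi_tilde :: "(nat \<Rightarrow> int \<times> int) \<Rightarrow> nat \<Rightarrow> real \<times> real \<Rightarrow> complex" where
  "psi_tilde s n \<tau> =
     complex_of_real (sqrt 2) * character (2 * fst (s n), snd (s n)) \<tau> * indicator D \<tau>"

definition psi :: "(nat \<Rightarrow> int \<times> int) \<Rightarrow> nat \<Rightarrow> real \<times> real \<Rightarrow> complex" where
  "psi s n \<xi> =
     complex_of_real (sqrt 2) * character (2 * fst (s n), snd (s n)) \<xi> *
       (indicator D1 \<xi> + (-1) powi snd (s n) * indicator (D2 \<union> D3) \<xi>)"

definition T :: "(nat \<Rightarrow> int \<times> int) \<Rightarrow> (nat \<Rightarrow> complex) \<Rightarrow>
    (real \<times> real \<Rightarrow> complex) \<Rightarrow> real \<times> real \<Rightarrow> complex" where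
  "T s l h =
     (SOME g. L2_lim torus sequentially
        (\<lambda>N \<tau>. \<Sum>n<N. l n * L2_ip torus h (psi_tilde s n) * psi_tilde s n \<tau>) g)"

definition R :: "(nat \<Rightarrow> int \<times> int) \<Rightarrow> (nat \<Rightarrow> complex) \<Rightarrow>
    (int \<times> int \<Rightarrow> complex) \<Rightarrow> int \<times> int \<Rightarrow> complex" where
  "R s l f = fourier_inv (S_inv (T s l (S (fourier f))))"

end

theory Submission
  imports Defs "HOL-Complex_Analysis.Cauchy_Integral_Formula"
begin

text \<open>
  The points (1/2, 1/2), (-1/2, -1/2) and (-1/2, 1/2) agree modulo the lattice, so the map \<open>P\<close>
  is the identity on \<open>D1\<close> and one and the same half translation \<open>\<xi> \<mapsto> \<xi> + (1/2, 1/2)\<close> on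
  \<open>D2 \<union> D3\<close>. A half translation preserves the measure of the torus and is an involution, and up
  to null sets \<open>D1\<close> and the translate of \<open>D2 \<union> D3\<close> tile \<open>D\<close>. Hence \<open>S\<close> is unitary
  (\<open>S_unitary\<close>). It maps \<open>psi s n\<close> to \<open>psi_tilde s n\<close>, because the half translation multiplies
  the character with frequency (2m, k) by \<open>(-1)\<^sup>k\<close>. The functions \<open>psi_tilde s n\<close> form a basis
  because \<open>D\<close> is half of a period in the first coordinate: extending a function on \<open>D\<close> with
  period 1/2 makes its coefficients at the odd first frequencies vanish, so the characters with even
  first frequency suffice (\<open>psi_tilde_basis\<close>).

  The characters of the torus are orthonormal because a translation multiplies the integral of a
  nontrivial character by a number different from 1, and they are total by the Stone-Weierstrass
  theorem and the inner regularity of Lebesgue measure (\<open>character_total\<close>). Together with the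
  completeness of \<open>L\<^sup>2\<close> this makes the Fourier transform unitary (\<open>fourier_unitary\<close>). Conjugation
  by \<open>S\<close> and the Fourier transform therefore turns \<open>T\<close> into \<open>R\<close> and carries the basis along,
  which gives the expansion of \<open>R\<close>.

  In the coordinates \<open>x\<^sub>j = \<langle>g, \<phi>\<^sub>j\<rangle>\<close> of the transported basis the frame coefficients are
  \<open>\<langle>g, R\<^sup>n f\<^sub>0\<rangle> = \<Sum>\<^sub>j x\<^sub>j cnj (\<lambda>\<^sub>j\<^sup>n c\<^sub>j)\<close> with \<open>c\<^sub>j\<close> comparable in modulus to
  \<open>sqrt (1 - |\<lambda>\<^sub>j|\<^sup>2)\<close>. These are the Taylor coefficients of a combination of normalized Szego
  kernels, so the frame property says that the normalized Szego kernels at a uniformly separated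
  sequence are a Riesz sequence in the Hardy space; this is the theorem of Shapiro and Shields. For
  finitely many points it is proved by integrals over the unit circle whose only analytic input is
  the Cauchy integral formula:

    \<^item> The upper bound is dual to the Carleson embedding
      \<open>\<Sum>\<^sub>j (1 - |\<lambda>\<^sub>j|\<^sup>2) |h \<lambda>\<^sub>j|\<^sup>2 \<le> C \<parallel>h\<parallel>\<^sup>2\<close>. Here the Cauchy formula is applied to \<open>h\<^sup>2\<close>
      times an exponential damping factor taken from P. Jones's interpolation formula
      (\<open>carleson_embedding\<close>).
    \<^item> The lower bound follows from the upper bound by interpolation with Blaschke products, which
      have modulus 1 on the circle (\<open>mean_square_kernel_sum_ge\<close>).

  The constants depend only on the separation constant, so both bounds survive the limit to
  infinitely many points (\<open>uniformly_separated_frame_bounds\<close>).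
\<close>

section \<open>Square-integrable functions\<close>

lemma L2_iff: "f \<in> L2 M \<longleftrightarrow> f \<in> borel_measurable M \<and> integrable M (\<lambda>x. (cmod (f x))\<^sup>2)"
  by (auto simp: L2_def)

lemma L2_measurable [measurable_dest]: "f \<in> L2 M \<Longrightarrow> f \<in> borel_measurable M"
  by (simp add: L2_def)

lemma L2_square_integrable: "f \<in> L2 M \<Longrightarrow> integrable M (\<lambda>x. (cmod (f x))\<^sup>2)"
  by (simp add: L2_def)

lemma borel_measurable_cnj [measurable (raw)]:
  "f \<in> borel_measurable M \<Longrightarrow> (\<lambda>x. cnj (f x)) \<in> borel_measurable M"
  by (rule borel_measurable_continuous_on[where f = cnj]) (simp_all add: continuous_on_cnj)

lemma integrable_times_indicator:
  fixes f :: "'a \<Rightarrow> complex"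
  assumes "integrable M f" "A \<in> sets M"
  shows "integrable M (\<lambda>x. f x * indicator A x)"
proof -
  have "f x * indicator A x = indicator A x *\<^sub>R f x" for x by (simp add: indicator_def)
  then show ?thesis using integrable_mult_indicator[OF assms(2,1)] by simp
qed

lemma L2_mult_cnj_integrable:
  assumes "f \<in> L2 M" "g \<in> L2 M"
  shows "integrable M (\<lambda>x. f x * cnj (g x))"
proof (rule Bochner_Integration.integrable_bound)
  show "integrable M (\<lambda>x. (cmod (f x))\<^sup>2 + (cmod (g x))\<^sup>2)"
    using assms by (intro Bochner_Integration.integrable_add L2_square_integrable)
  show "(\<lambda>x. f x * cnj (g x)) \<in> borel_measurable M"
    using assms by (auto intro!: borel_measurable_times borel_measurable_cnj simp: L2_def)
  have "cmod (f x * cnj (g x)) \<le> norm ((cmod (f x))\<^sup>2 + (cmod (g x))\<^sup>2)" for x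
  proof -
    have "0 \<le> cmod (f x) * cmod (g x)" by simp
    then have "cmod (f x) * cmod (g x) \<le> (cmod (f x))\<^sup>2 + (cmod (g x))\<^sup>2"
      using sum_squares_bound[of "cmod (f x)" "cmod (g x)"] unfolding mult.assoc by linarith
    then show ?thesis by (simp add: norm_mult)
  qed
  then show "AE x in M. norm (f x * cnj (g x)) \<le> norm ((cmod (f x))\<^sup>2 + (cmod (g x))\<^sup>2)"
    by simp
qed

lemma L2_add:
  assumes "f \<in> L2 M" "g \<in> L2 M"
  shows "(\<lambda>x. f x + g x) \<in> L2 M"
proof -
  have "integrable M (\<lambda>x. (cmod (f x + g x))\<^sup>2)"
  proof (rule Bochner_Integration.integrable_bound)
    show "integrable M (\<lambda>x. 2 * (cmod (f x))\<^sup>2 + 2 * (cmod (g x))\<^sup>2)"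
      using assms by (intro Bochner_Integration.integrable_add integrable_mult_right L2_square_integrable)
    show "(\<lambda>x. (cmod (f x + g x))\<^sup>2) \<in> borel_measurable M"
      using assms by (auto simp: L2_def)
    have "(cmod (f x + g x))\<^sup>2 \<le> 2 * (cmod (f x))\<^sup>2 + 2 * (cmod (g x))\<^sup>2" for x
    proof -
      have "(cmod (f x + g x))\<^sup>2 \<le> (cmod (f x) + cmod (g x))\<^sup>2"
        by (intro power_mono norm_triangle_ineq) auto
      then show ?thesis
        using sum_squares_bound[of "cmod (f x)" "cmod (g x)"] by (simp add: power2_sum)
    qed
    then show "AE x in M. norm ((cmod (f x + g x))\<^sup>2) \<le> norm (2 * (cmod (f x))\<^sup>2 + 2 * (cmod (g x))\<^sup>2)"
      by simp
  qed
  then show ?thesis using assms by (auto simp: L2_def)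
qed

lemma L2_cmult:
  assumes "f \<in> L2 M"
  shows "(\<lambda>x. c * f x) \<in> L2 M"
  using assms by (auto simp: L2_def norm_mult power_mult_distrib)

lemma L2_zero: "(\<lambda>x. 0) \<in> L2 M"
  by (simp add: L2_def)

lemma L2_diff:
  assumes "f \<in> L2 M" "g \<in> L2 M"
  shows "(\<lambda>x. f x - g x) \<in> L2 M"
  using L2_add[OF assms(1) L2_cmult[OF assms(2), of "-1"]] by simp

lemma L2_sum:
  assumes "\<And>i. i \<in> I \<Longrightarrow> f i \<in> L2 M"
  shows "(\<lambda>x. \<Sum>i\<in>I. f i x) \<in> L2 M"
  using assms by (induction I rule: infinite_finite_induct) (auto intro: L2_add L2_zero)

lemma L2_lincomb:
  assumes "\<And>i. i \<in> I \<Longrightarrow> f i \<in> L2 M"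
  shows "(\<lambda>x. \<Sum>i\<in>I. c i * f i x) \<in> L2 M"
  using assms by (intro L2_sum L2_cmult)

lemma L2_ip_AE_cong:
  assumes "f \<in> L2 M" "f' \<in> L2 M" "g \<in> L2 M" "g' \<in> L2 M"
    and "AE x in M. f x = f' x" "AE x in M. g x = g' x"
  shows "L2_ip M f g = L2_ip M f' g'"
  unfolding L2_ip_def
proof (rule integral_cong_AE)
  have [measurable]: "f \<in> borel_measurable M" "f' \<in> borel_measurable M"
    "g \<in> borel_measurable M" "g' \<in> borel_measurable M"
    using assms by (simp_all add: L2_def)
  show "(\<lambda>x. f x * cnj (g x)) \<in> borel_measurable M" "(\<lambda>x. f' x * cnj (g' x)) \<in> borel_measurable M"
    by measurable
  show "AE x in M. f x * cnj (g x) = f' x * cnj (g' x)"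
    using assms(5,6) by eventually_elim simp
qed

lemma L2_ip_add_left:
  assumes "f \<in> L2 M" "g \<in> L2 M" "h \<in> L2 M"
  shows "L2_ip M (\<lambda>x. f x + g x) h = L2_ip M f h + L2_ip M g h"
  using assms by (simp add: L2_ip_def distrib_right L2_mult_cnj_integrable)

lemma L2_ip_diff_left:
  assumes "f \<in> L2 M" "g \<in> L2 M" "h \<in> L2 M"
  shows "L2_ip M (\<lambda>x. f x - g x) h = L2_ip M f h - L2_ip M g h"
  using assms by (simp add: L2_ip_def left_diff_distrib L2_mult_cnj_integrable)

lemma L2_ip_cmult_left: "L2_ip M (\<lambda>x. c * f x) h = c * L2_ip M f h"
  by (simp add: L2_ip_def mult.assoc)

lemma L2_ip_lincomb_left:
  assumes "\<And>i. i \<in> I \<Longrightarrow> f i \<in> L2 M" "h \<in> L2 M"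
  shows "L2_ip M (\<lambda>x. \<Sum>i\<in>I. c i * f i x) h = (\<Sum>i\<in>I. c i * L2_ip M (f i) h)"
  using assms
proof (induction I rule: infinite_finite_induct)
  case (insert i I)
  then show ?case
    by (simp add: L2_ip_add_left L2_cmult L2_lincomb L2_ip_cmult_left)
qed (simp_all add: L2_ip_def)

lemma L2_ip_commute: "L2_ip M g f = cnj (L2_ip M f g)"
proof -
  have "cnj (L2_ip M f g) = (LINT x|M. cnj (f x * cnj (g x)))"
    unfolding L2_ip_def by (rule Bochner_Integration.integral_cnj[symmetric])
  then show ?thesis by (simp add: L2_ip_def mult.commute)
qed

lemma L2_norm_nonneg: "0 \<le> L2_norm M f"
  by (simp add: L2_norm_def)

lemma L2_norm_square: "(L2_norm M f)\<^sup>2 = (LINT x|M. (cmod (f x))\<^sup>2)"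
  by (simp add: L2_norm_def)

lemma L2_ip_self: "L2_ip M f f = complex_of_real ((L2_norm M f)\<^sup>2)"
proof -
  have "L2_ip M f f = (LINT x|M. complex_of_real ((cmod (f x))\<^sup>2))"
    unfolding L2_ip_def by (intro Bochner_Integration.integral_cong) (simp_all only: complex_norm_square)
  then show ?thesis by (simp only: L2_norm_square integral_complex_of_real)
qed

lemma L2_norm_AE_cong:
  assumes "f \<in> L2 M" "g \<in> L2 M" "AE x in M. f x = g x"
  shows "L2_norm M f = L2_norm M g"
proof -
  have "(LINT x|M. (cmod (f x))\<^sup>2) = (LINT x|M. (cmod (g x))\<^sup>2)"
    using assms by (intro integral_cong_AE) (auto simp: L2_def)
  then show ?thesis by (simp add: L2_norm_def)
qed

lemma L2_norm_eq_0_iff: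
  assumes "f \<in> L2 M"
  shows "L2_norm M f = 0 \<longleftrightarrow> (AE x in M. f x = 0)"
  using assms by (simp add: L2_norm_def integral_nonneg_eq_0_iff_AE L2_square_integrable)

lemma L2_norm_diff_square:
  assumes "f \<in> L2 M" "g \<in> L2 M"
  shows "(L2_norm M (\<lambda>x. f x - g x))\<^sup>2
         = (L2_norm M f)\<^sup>2 - 2 * Re (L2_ip M f g) + (L2_norm M g)\<^sup>2"
proof -
  let ?d = "\<lambda>x. f x - g x"
  have d: "?d \<in> L2 M" using assms by (rule L2_diff)
  have "L2_ip M ?d ?d = L2_ip M f ?d - L2_ip M g ?d"
    using assms d by (simp add: L2_ip_diff_left)
  also have "\<dots> = cnj (L2_ip M ?d f) - cnj (L2_ip M ?d g)"
    by (simp only: L2_ip_commute[of M _ ?d])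
  also have "\<dots> = cnj (L2_ip M f f) - cnj (L2_ip M g f) - cnj (L2_ip M f g) + cnj (L2_ip M g g)"
    using assms by (simp add: L2_ip_diff_left)
  finally have "Re (L2_ip M ?d ?d) = Re (L2_ip M f f) - Re (L2_ip M g f) - Re (L2_ip M f g) + Re (L2_ip M g g)"
    by simp
  moreover have "Re (L2_ip M g f) = Re (L2_ip M f g)"
    using L2_ip_commute[of M g f] by simp
  ultimately show ?thesis by (simp add: L2_ip_self)
qed

text \<open>
  Completing the square in the coefficients: the distance to a combination of orthonormal functions
  is smallest at the coefficients given by the inner products. Bessel's inequality, the
  Cauchy-Schwarz inequality and Parseval's identity below are all readings of this formula.
\<close>

lemma orthonormal_diff_norm_square:
  assumes K: "finite K" and f: "f \<in> L2 M" and e: "\<And>i. i \<in> K \<Longrightarrow> e i \<in> L2 M"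
    and on: "\<And>i j. i \<in> K \<Longrightarrow> j \<in> K \<Longrightarrow> L2_ip M (e i) (e j) = (if i = j then 1 else 0)"
  shows "(L2_norm M (\<lambda>x. f x - (\<Sum>i\<in>K. c i * e i x)))\<^sup>2
         = (L2_norm M f)\<^sup>2 - (\<Sum>i\<in>K. (cmod (L2_ip M f (e i)))\<^sup>2)
             + (\<Sum>i\<in>K. (cmod (L2_ip M f (e i) - c i))\<^sup>2)"
proof -
  let ?u = "\<lambda>x. \<Sum>i\<in>K. c i * e i x"
  have u: "?u \<in> L2 M" using e by (rule L2_lincomb)
  have ue: "L2_ip M ?u (e j) = c j" if "j \<in> K" for j
  proof -
    have "L2_ip M ?u (e j) = (\<Sum>i\<in>K. c i * L2_ip M (e i) (e j))"
      using e that by (intro L2_ip_lincomb_left) auto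
    also have "\<dots> = (\<Sum>i\<in>K. if i = j then c i else 0)"
      using that by (intro sum.cong) (auto simp: on)
    finally show ?thesis using K that by simp
  qed
  have hu: "L2_ip M h ?u = (\<Sum>i\<in>K. cnj (c i) * L2_ip M h (e i))" if "h \<in> L2 M" for h
  proof -
    have "L2_ip M h ?u = cnj (L2_ip M ?u h)" by (rule L2_ip_commute)
    also have "\<dots> = (\<Sum>i\<in>K. cnj (c i) * cnj (L2_ip M (e i) h))"
      using e that by (subst L2_ip_lincomb_left) auto
    finally show ?thesis by (simp only: L2_ip_commute[of M h])
  qed
  have "(L2_norm M ?u)\<^sup>2 = Re (L2_ip M ?u ?u)" by (simp add: L2_ip_self)
  also have "\<dots> = (\<Sum>i\<in>K. (cmod (c i))\<^sup>2)"
    unfolding hu[OF u] by (simp add: ue cmod_power2 power2_eq_square[symmetric])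
  finally have nu: "(L2_norm M ?u)\<^sup>2 = (\<Sum>i\<in>K. (cmod (c i))\<^sup>2)" .
  have *: "(cmod (a - b))\<^sup>2 = (cmod a)\<^sup>2 - 2 * Re (cnj b * a) + (cmod b)\<^sup>2" for a b :: complex
    by (simp add: cmod_power2) (simp add: power2_eq_square algebra_simps)
  have "(\<Sum>i\<in>K. (cmod (L2_ip M f (e i) - c i))\<^sup>2)
        = (\<Sum>i\<in>K. (cmod (L2_ip M f (e i)))\<^sup>2) - 2 * Re (L2_ip M f ?u) + (L2_norm M ?u)\<^sup>2"
    unfolding * hu[OF f] nu by (simp add: sum.distrib sum_subtractf sum_distrib_left)
  then show ?thesis
    by (simp add: L2_norm_diff_square[OF f u])
qed

lemma bessel_inequality:
  assumes K: "finite K" and f: "f \<in> L2 M" and e: "\<And>i. i \<in> K \<Longrightarrow> e i \<in> L2 M"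
    and on: "\<And>i j. i \<in> K \<Longrightarrow> j \<in> K \<Longrightarrow> L2_ip M (e i) (e j) = (if i = j then 1 else 0)"
  shows "(\<Sum>i\<in>K. (cmod (L2_ip M f (e i)))\<^sup>2) \<le> (L2_norm M f)\<^sup>2"
proof -
  have "0 \<le> (L2_norm M (\<lambda>x. f x - (\<Sum>i\<in>K. L2_ip M f (e i) * e i x)))\<^sup>2" by simp
  also have "\<dots> = (L2_norm M f)\<^sup>2 - (\<Sum>i\<in>K. (cmod (L2_ip M f (e i)))\<^sup>2)"
    by (subst orthonormal_diff_norm_square[OF assms]) auto
  finally show ?thesis by simp
qed

lemma L2_Cauchy_Schwarz:
  assumes f: "f \<in> L2 M" and g: "g \<in> L2 M"
  shows "cmod (L2_ip M f g) \<le> L2_norm M f * L2_norm M g"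
proof (cases "L2_norm M g = 0")
  case True
  then have "AE x in M. g x = 0" using g by (simp add: L2_norm_eq_0_iff)
  then have "L2_ip M f g = L2_ip M f (\<lambda>x. 0)"
    using f g by (intro L2_ip_AE_cong) (auto simp: L2_zero)
  then show ?thesis by (simp add: L2_ip_def True)
next
  case False
  then have pos: "0 < L2_norm M g" using L2_norm_nonneg[of M g] by simp
  define e where "e = (\<lambda>x. complex_of_real (1 / L2_norm M g) * g x)"
  have e: "e \<in> L2 M" unfolding e_def using g by (rule L2_cmult)
  have ip: "L2_ip M h e = complex_of_real (1 / L2_norm M g) * L2_ip M h g" for h
    unfolding e_def L2_ip_commute[of M h] by (subst L2_ip_cmult_left) simp
  have "L2_ip M e g = complex_of_real (1 / L2_norm M g) * complex_of_real ((L2_norm M g)\<^sup>2)"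
    unfolding e_def by (simp only: L2_ip_cmult_left L2_ip_self)
  then have "L2_ip M e e = 1"
    unfolding ip using pos by (simp add: power2_eq_square)
  then have "(cmod (L2_ip M f e))\<^sup>2 \<le> (L2_norm M f)\<^sup>2"
    using bessel_inequality[of "{0::nat}" f M "\<lambda>_. e"] f e by simp
  then have "cmod (L2_ip M f e) \<le> L2_norm M f"
    using L2_norm_nonneg by (rule power2_le_imp_le)
  then show ?thesis
    using pos by (simp add: ip norm_mult norm_divide divide_simps)
qed

lemma L2_norm_triangle:
  assumes f: "f \<in> L2 M" and g: "g \<in> L2 M"
  shows "L2_norm M (\<lambda>x. f x - g x) \<le> L2_norm M f + L2_norm M g"
proof (rule power2_le_imp_le)
  have "- Re (L2_ip M f g) \<le> L2_norm M f * L2_norm M g"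
    using L2_Cauchy_Schwarz[OF assms] abs_Re_le_cmod[of "L2_ip M f g"] by linarith
  then show "(L2_norm M (\<lambda>x. f x - g x))\<^sup>2 \<le> (L2_norm M f + L2_norm M g)\<^sup>2"
    by (simp add: L2_norm_diff_square[OF assms] power2_sum)
qed (simp add: L2_norm_nonneg)

lemma L2_ip_tendsto_left:
  assumes "((\<lambda>i. L2_norm M (\<lambda>x. u i x - g x)) \<longlongrightarrow> 0) F"
    and "\<forall>\<^sub>F i in F. u i \<in> L2 M" "g \<in> L2 M" "h \<in> L2 M"
  shows "((\<lambda>i. L2_ip M (u i) h) \<longlongrightarrow> L2_ip M g h) F"
proof -
  have "\<forall>\<^sub>F i in F. norm (L2_ip M (u i) h - L2_ip M g h) \<le> L2_norm M (\<lambda>x. u i x - g x) * L2_norm M h"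
    using assms(2)
  proof eventually_elim
    case (elim i)
    then show ?case
      using L2_Cauchy_Schwarz[OF L2_diff[OF elim assms(3)] assms(4)] assms
      by (simp add: L2_ip_diff_left)
  qed
  moreover have "((\<lambda>i. L2_norm M (\<lambda>x. u i x - g x) * L2_norm M h) \<longlongrightarrow> 0) F"
    using tendsto_mult_right[OF assms(1), of "L2_norm M h"] by simp
  ultimately have "((\<lambda>i. L2_ip M (u i) h - L2_ip M g h) \<longlongrightarrow> 0) F"
    by (rule Lim_null_comparison)
  then show ?thesis by (simp add: Lim_null[symmetric])
qed

section \<open>Completeness and orthonormal sequences\<close>

lemma AE_summable_of_summable_integral:
  fixes f :: "nat \<Rightarrow> 'a \<Rightarrow> real"
  assumes int: "\<And>k. integrable M (f k)" and nonneg: "\<And>k x. 0 \<le> f k x"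
    and sum: "summable (\<lambda>k. LINT x|M. f k x)"
  shows "AE x in M. summable (\<lambda>k. f k x)"
proof -
  have [measurable]: "f k \<in> borel_measurable M" for k
    using int by (rule borel_measurable_integrable)
  have "(\<integral>\<^sup>+x. (\<Sum>k. ennreal (f k x)) \<partial>M) = (\<Sum>k. \<integral>\<^sup>+x. ennreal (f k x) \<partial>M)"
    by (intro nn_integral_suminf) measurable
  also have "\<dots> = (\<Sum>k. ennreal (LINT x|M. f k x))"
    using int nonneg by (simp add: nn_integral_eq_integral)
  also have "\<dots> = ennreal (\<Sum>k. LINT x|M. f k x)"
    using sum nonneg by (intro suminf_ennreal2) (auto intro: Bochner_Integration.integral_nonneg)
  finally have "(\<integral>\<^sup>+x. (\<Sum>k. ennreal (f k x)) \<partial>M) \<noteq> \<infinity>" by simp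
  then have "AE x in M. (\<Sum>k. ennreal (f k x)) \<noteq> \<infinity>"
    by (intro nn_integral_PInf_AE) measurable
  then show ?thesis
    by eventually_elim (auto intro: summable_suminf_not_top nonneg)
qed

text \<open>
  The weights \<open>4\<^sup>k\<close> turn summability of squares into summability: the series of
  \<open>4\<^sup>k |v\<^sub>k\<^sub>+\<^sub>1 - v\<^sub>k|\<^sup>2\<close> has a finite integral, so it converges almost everywhere, and then
  \<open>|v\<^sub>k\<^sub>+\<^sub>1 - v\<^sub>k| \<le> 2\<^sup>-\<^sup>k\<close> eventually.
\<close>

lemma AE_convergent_of_fast_L2_Cauchy:
  assumes v: "\<And>k. v k \<in> L2 M"
    and fast: "\<And>k. (L2_norm M (\<lambda>x. v (Suc k) x - v k x))\<^sup>2 \<le> (1/8) ^ k"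
  shows "AE x in M. convergent (\<lambda>k. v k x)"
proof -
  define d where "d k x = v (Suc k) x - v k x" for k x
  have d: "d k \<in> L2 M" for k unfolding d_def using v by (intro L2_diff)
  have int: "integrable M (\<lambda>x. 4 ^ k * (cmod (d k x))\<^sup>2)" for k
    using d by (intro integrable_mult_right L2_square_integrable)
  have bound: "(LINT x|M. 4 ^ k * (cmod (d k x))\<^sup>2) \<le> (1/2) ^ k" for k
  proof -
    have "(LINT x|M. 4 ^ k * (cmod (d k x))\<^sup>2) = 4 ^ k * (L2_norm M (d k))\<^sup>2"
      by (simp add: L2_norm_square)
    also have "\<dots> \<le> 4 ^ k * (1/8) ^ k"
      using fast[of k] by (intro mult_left_mono) (auto simp: d_def[abs_def])
    also have "\<dots> = (1/2) ^ k" by (simp flip: power_mult_distrib)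
    finally show ?thesis .
  qed
  have "summable (\<lambda>k. LINT x|M. 4 ^ k * (cmod (d k x))\<^sup>2)"
  proof (rule summable_comparison_test')
    show "summable (\<lambda>k. (1/2::real) ^ k)" by (simp add: summable_geometric)
    show "norm (LINT x|M. 4 ^ k * (cmod (d k x))\<^sup>2) \<le> (1/2) ^ k" if "0 \<le> k" for k
      using bound[of k] by (simp add: Bochner_Integration.integral_nonneg)
  qed
  then have "AE x in M. summable (\<lambda>k. 4 ^ k * (cmod (d k x))\<^sup>2)"
    using int by (intro AE_summable_of_summable_integral) auto
  then show ?thesis
  proof eventually_elim
    case (elim x)
    have "\<forall>\<^sub>F k in sequentially. 4 ^ k * (cmod (d k x))\<^sup>2 < 1"
      using order_tendstoD(2)[OF summable_LIMSEQ_zero[OF elim], of 1] by simp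
    then have "\<forall>\<^sub>F k in sequentially. norm (d k x) \<le> (1/2) ^ k"
    proof eventually_elim
      case (elim k)
      have "(2 ^ k * cmod (d k x))\<^sup>2 = 4 ^ k * (cmod (d k x))\<^sup>2"
        by (simp add: power_mult_distrib power2_eq_square flip: power_mult_distrib)
      then have "(2 ^ k * cmod (d k x))\<^sup>2 \<le> 1\<^sup>2" using elim by simp
      then have "2 ^ k * cmod (d k x) \<le> 1" by (rule power2_le_imp_le) simp
      then show ?case by (simp add: power_one_over field_simps)
    qed
    then have "summable (\<lambda>k. d k x)"
      by (rule summable_comparison_test_ev) (simp add: summable_geometric)
    then have "convergent (\<lambda>k. v 0 x + (\<Sum>i<k. d i x))"
      by (intro convergent_add convergent_const) (simp add: summable_iff_convergent)
    then show ?case 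
      unfolding d_def sum_lessThan_telescope[of "\<lambda>i. v i x"] by simp
  qed
qed

text \<open>
  The limit is the pointwise limit of a fast subsequence; Fatou's lemma shows that the whole sequence
  converges to it in norm.
\<close>

theorem L2_complete:
  assumes u: "\<And>n. u n \<in> L2 M"
    and Cauchy: "\<And>\<epsilon>. 0 < \<epsilon> \<Longrightarrow> \<exists>N. \<forall>m\<ge>N. \<forall>n\<ge>N. (L2_norm M (\<lambda>x. u m x - u n x))\<^sup>2 \<le> \<epsilon>"
  obtains g where "L2_lim M sequentially u g"
proof -
  have "\<exists>N. \<forall>m\<ge>N. \<forall>n\<ge>N. (L2_norm M (\<lambda>x. u m x - u n x))\<^sup>2 \<le> (1/8) ^ k" for k :: nat
    by (intro Cauchy) simp
  then obtain N where N: "\<And>k m n. N k \<le> m \<Longrightarrow> N k \<le> n \<Longrightarrow>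
      (L2_norm M (\<lambda>x. u m x - u n x))\<^sup>2 \<le> (1/8) ^ k" for k :: nat
    by metis
  \<comment> \<open>The summand \<open>k\<close> makes the indices tend to infinity.\<close>
  define r where "r k = k + (\<Sum>i\<le>k. N i)" for k
  have r: "N k \<le> r k" "N k \<le> r (Suc k)" "k \<le> r k" for k
  proof -
    have "N k \<le> (\<Sum>i\<le>k. N i)" by (rule member_le_sum) auto
    then show "N k \<le> r k" "N k \<le> r (Suc k)" "k \<le> r k" by (auto simp: r_def)
  qed
  define v where "v k = u (r k)" for k
  have v: "v k \<in> L2 M" for k by (simp add: v_def u)
  have conv: "AE x in M. convergent (\<lambda>k. v k x)"
    using v by (rule AE_convergent_of_fast_L2_Cauchy) (simp add: v_def N r)
  define g where "g x = lim (\<lambda>k. v k x)" for x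
  have vm [measurable]: "v k \<in> borel_measurable M" for k using v by (rule L2_measurable)
  have um [measurable]: "u k \<in> borel_measurable M" for k using u by (rule L2_measurable)
  have gm [measurable]: "g \<in> borel_measurable M"
    unfolding g_def by (rule borel_measurable_lim_metric) simp
  have fatou: "(\<integral>\<^sup>+x. ennreal ((cmod (u n x - g x))\<^sup>2) \<partial>M) \<le> ennreal \<epsilon>"
    if \<epsilon>: "\<And>m. M0 \<le> m \<Longrightarrow> (L2_norm M (\<lambda>x. u n x - u m x))\<^sup>2 \<le> \<epsilon>" for n \<epsilon> M0
  proof -
    have "AE x in M. ennreal ((cmod (u n x - g x))\<^sup>2)
            = liminf (\<lambda>k. ennreal ((cmod (u n x - v k x))\<^sup>2))"
      using conv
    proof eventually_elim
      case (elim x)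
      then have "(\<lambda>k. v k x) \<longlonglongrightarrow> g x" unfolding g_def by (simp add: convergent_LIMSEQ_iff)
      then have "(\<lambda>k. ennreal ((cmod (u n x - v k x))\<^sup>2)) \<longlonglongrightarrow> ennreal ((cmod (u n x - g x))\<^sup>2)"
        by (intro tendsto_intros)
      then show ?case
        using lim_imp_Liminf[OF sequentially_bot] by metis
    qed
    then have "(\<integral>\<^sup>+x. ennreal ((cmod (u n x - g x))\<^sup>2) \<partial>M)
            = (\<integral>\<^sup>+x. liminf (\<lambda>k. ennreal ((cmod (u n x - v k x))\<^sup>2)) \<partial>M)"
      by (rule nn_integral_cong_AE)
    also have "\<dots> \<le> liminf (\<lambda>k. \<integral>\<^sup>+x. ennreal ((cmod (u n x - v k x))\<^sup>2) \<partial>M)"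
      by (intro nn_integral_liminf) measurable
    also have "\<dots> \<le> liminf (\<lambda>k. ennreal \<epsilon>)"
    proof (rule Liminf_mono)
      show "\<forall>\<^sub>F k in sequentially. (\<integral>\<^sup>+x. ennreal ((cmod (u n x - v k x))\<^sup>2) \<partial>M) \<le> ennreal \<epsilon>"
        using eventually_ge_at_top[of M0]
      proof eventually_elim
        case (elim k)
        have "(\<integral>\<^sup>+x. ennreal ((cmod (u n x - v k x))\<^sup>2) \<partial>M) = ennreal ((L2_norm M (\<lambda>x. u n x - v k x))\<^sup>2)"
          unfolding L2_norm_square
          by (intro nn_integral_eq_integral L2_square_integrable L2_diff u v) auto
        also have "\<dots> \<le> ennreal \<epsilon>"
          unfolding v_def using elim r(3)[of k] by (intro ennreal_leI \<epsilon>) linarith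
        finally show ?case .
      qed
    qed
    finally show ?thesis by (simp add: Liminf_const)
  qed
  have ug: "(\<lambda>x. u n x - g x) \<in> L2 M \<and> (L2_norm M (\<lambda>x. u n x - g x))\<^sup>2 \<le> \<epsilon>"
    if "0 \<le> \<epsilon>" and "\<And>m. M0 \<le> m \<Longrightarrow> (L2_norm M (\<lambda>x. u n x - u m x))\<^sup>2 \<le> \<epsilon>" for n \<epsilon> M0
  proof -
    have le: "(\<integral>\<^sup>+x. ennreal ((cmod (u n x - g x))\<^sup>2) \<partial>M) \<le> ennreal \<epsilon>"
      using that(2) by (rule fatou)
    then have "(\<integral>\<^sup>+x. ennreal ((cmod (u n x - g x))\<^sup>2) \<partial>M) < \<infinity>"
      using ennreal_less_top le_less_trans unfolding infinity_ennreal_def by blast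
    then have int: "integrable M (\<lambda>x. (cmod (u n x - g x))\<^sup>2)"
      by (intro integrableI_nonneg) auto
    then have "ennreal ((L2_norm M (\<lambda>x. u n x - g x))\<^sup>2) \<le> ennreal \<epsilon>"
      using le by (simp add: L2_norm_square nn_integral_eq_integral)
    moreover have "(\<lambda>x. u n x - g x) \<in> L2 M" using int by (simp add: L2_iff)
    ultimately show ?thesis using that(1) by simp
  qed
  have g: "g \<in> L2 M"
  proof -
    obtain N1 where "\<forall>m\<ge>N1. \<forall>n\<ge>N1. (L2_norm M (\<lambda>x. u m x - u n x))\<^sup>2 \<le> 1"
      using Cauchy[of 1] by auto
    then have "(\<lambda>x. u N1 x - g x) \<in> L2 M" using ug[of 1 N1 N1] by auto
    from L2_diff[OF u[of N1] this] show ?thesis by simp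
  qed
  have "(\<lambda>n. (L2_norm M (\<lambda>x. u n x - g x))\<^sup>2) \<longlonglongrightarrow> 0"
  proof (rule LIMSEQ_I)
    fix e :: real assume "0 < e"
    then obtain N1 where N1: "\<forall>m\<ge>N1. \<forall>n\<ge>N1. (L2_norm M (\<lambda>x. u m x - u n x))\<^sup>2 \<le> e / 2"
      using Cauchy[of "e / 2"] by auto
    have "norm ((L2_norm M (\<lambda>x. u n x - g x))\<^sup>2 - 0) < e" if "N1 \<le> n" for n
    proof -
      have "(L2_norm M (\<lambda>x. u n x - g x))\<^sup>2 \<le> e / 2"
        using ug[of "e/2" N1 n] N1 that \<open>0 < e\<close> by auto
      then show ?thesis using \<open>0 < e\<close> by simp
    qed
    then show "\<exists>no. \<forall>n\<ge>no. norm ((L2_norm M (\<lambda>x. u n x - g x))\<^sup>2 - 0) < e" by blast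
  qed
  then have "(\<lambda>n. sqrt ((L2_norm M (\<lambda>x. u n x - g x))\<^sup>2)) \<longlonglongrightarrow> sqrt 0"
    by (intro tendsto_real_sqrt)
  then have "(\<lambda>n. L2_norm M (\<lambda>x. u n x - g x)) \<longlonglongrightarrow> 0"
    by (simp add: L2_norm_nonneg)
  then have "L2_lim M sequentially u g"
    using g u by (simp add: L2_lim_def)
  then show ?thesis by (rule that)
qed

definition orthonormal :: "'a measure \<Rightarrow> ('i \<Rightarrow> 'a \<Rightarrow> complex) \<Rightarrow> bool" where
  "orthonormal M e \<longleftrightarrow>
     (\<forall>i. e i \<in> L2 M) \<and> (\<forall>i j. L2_ip M (e i) (e j) = (if i = j then 1 else 0))"

lemma orthonormal_bessel:
  assumes "orthonormal M e" "f \<in> L2 M" "finite K"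
  shows "(\<Sum>i\<in>K. (cmod (L2_ip M f (e i)))\<^sup>2) \<le> (L2_norm M f)\<^sup>2"
  using assms by (intro bessel_inequality) (auto simp: orthonormal_def)

lemma orthonormal_bessel_summable:
  assumes "orthonormal M e" "f \<in> L2 M"
  shows "summable (\<lambda>n::nat. (cmod (L2_ip M f (e n)))\<^sup>2)"
  by (rule bounded_imp_summable[where B = "(L2_norm M f)\<^sup>2"])
     (auto intro: orthonormal_bessel[OF assms])

lemma orthonormal_expansion_dist:
  assumes "orthonormal M e" "f \<in> L2 M" "finite K"
  shows "(L2_norm M (\<lambda>x. (\<Sum>i\<in>K. L2_ip M f (e i) * e i x) - f x))\<^sup>2
           = (L2_norm M f)\<^sup>2 - (\<Sum>i\<in>K. (cmod (L2_ip M f (e i)))\<^sup>2)"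
proof -
  have "L2_norm M (\<lambda>x. (\<Sum>i\<in>K. L2_ip M f (e i) * e i x) - f x)
        = L2_norm M (\<lambda>x. f x - (\<Sum>i\<in>K. L2_ip M f (e i) * e i x))"
    by (simp add: L2_norm_def norm_minus_commute)
  then show ?thesis
    using assms by (simp add: orthonormal_diff_norm_square orthonormal_def)
qed


theorem riesz_fischer:
  assumes on: "orthonormal M e" and c: "summable (\<lambda>n::nat. (cmod (c n))\<^sup>2)"
  obtains g where "L2_lim M sequentially (\<lambda>N x. \<Sum>n<N. c n * e n x) g"
    and "\<And>n. L2_ip M g (e n) = c n"
proof -
  let ?u = "\<lambda>N x. \<Sum>n<N. c n * e n x"
  have e: "e n \<in> L2 M" for n using on by (simp add: orthonormal_def)
  have u: "?u N \<in> L2 M" for N by (rule L2_lincomb) (rule e)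
  have ue: "L2_ip M (?u N) (e j) = (if j < N then c j else 0)" for N j
  proof -
    have "L2_ip M (?u N) (e j) = (\<Sum>n<N. c n * L2_ip M (e n) (e j))"
      by (intro L2_ip_lincomb_left e)
    also have "\<dots> = (\<Sum>n<N. if n = j then c n else 0)"
      using on by (intro sum.cong) (auto simp: orthonormal_def)
    finally show ?thesis by simp
  qed
  have nu: "(L2_norm M (\<lambda>x. ?u m x - ?u n x))\<^sup>2 = (\<Sum>i\<in>{n..<m}. (cmod (c i))\<^sup>2)" if "n \<le> m" for m n
  proof -
    have dx: "(\<lambda>x. ?u m x - ?u n x) = (\<lambda>x. \<Sum>i\<in>{n..<m}. c i * e i x)"
      using that by (simp add: sum_diff_nat_ivl lessThan_atLeast0)
    have d: "(\<lambda>x. ?u m x - ?u n x) \<in> L2 M" using u by (intro L2_diff)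
    have "0 = (L2_norm M (\<lambda>x. (\<lambda>x. ?u m x - ?u n x) x - (\<Sum>i\<in>{n..<m}. c i * e i x)))\<^sup>2"
      using fun_cong[OF dx] by (simp add: L2_norm_def)
    also have "\<dots> = (L2_norm M (\<lambda>x. ?u m x - ?u n x))\<^sup>2
          - (\<Sum>i\<in>{n..<m}. (cmod (L2_ip M (\<lambda>x. ?u m x - ?u n x) (e i)))\<^sup>2)
          + (\<Sum>i\<in>{n..<m}. (cmod (L2_ip M (\<lambda>x. ?u m x - ?u n x) (e i) - c i))\<^sup>2)"
      using on by (intro orthonormal_diff_norm_square d) (auto simp: orthonormal_def)
    also have "\<dots> = (L2_norm M (\<lambda>x. ?u m x - ?u n x))\<^sup>2 - (\<Sum>i\<in>{n..<m}. (cmod (c i))\<^sup>2)"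
      by (simp add: L2_ip_diff_left u e ue)
    finally show ?thesis by simp
  qed
  obtain g where g: "L2_lim M sequentially ?u g"
  proof (rule L2_complete[of ?u M])
    show "?u n \<in> L2 M" for n by (rule u)
    fix \<epsilon> :: real assume "0 < \<epsilon>"
    then obtain N where N: "\<And>m n. N \<le> m \<Longrightarrow> norm (\<Sum>i\<in>{m..<n}. (cmod (c i))\<^sup>2) < \<epsilon>"
      using c unfolding summable_Cauchy by meson
    have *: "(L2_norm M (\<lambda>x. ?u m x - ?u n x))\<^sup>2 \<le> \<epsilon>" if "N \<le> n" "n \<le> m" for m n
      unfolding nu[OF that(2)] using N[OF that(1), of m] by simp
    have "(L2_norm M (\<lambda>x. ?u m x - ?u n x))\<^sup>2 \<le> \<epsilon>" if "N \<le> m" "N \<le> n" for m n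
    proof (cases "n \<le> m")
      case True
      then show ?thesis using * that by blast
    next
      case False
      have "L2_norm M (\<lambda>x. ?u m x - ?u n x) = L2_norm M (\<lambda>x. ?u n x - ?u m x)"
        by (simp add: L2_norm_def norm_minus_commute)
      then show ?thesis using *[of m n] that False by simp
    qed
    then show "\<exists>N. \<forall>m\<ge>N. \<forall>n\<ge>N. (L2_norm M (\<lambda>x. ?u m x - ?u n x))\<^sup>2 \<le> \<epsilon>"
      by blast
  qed
  moreover have "L2_ip M g (e j) = c j" for j
  proof (rule LIMSEQ_unique)
    show "(\<lambda>N. L2_ip M (?u N) (e j)) \<longlonglongrightarrow> L2_ip M g (e j)"
      using g e u by (intro L2_ip_tendsto_left) (auto simp: L2_lim_def)
    have "\<forall>\<^sub>F N in sequentially. L2_ip M (?u N) (e j) = c j"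
      using eventually_gt_at_top[of j] by eventually_elim (simp add: ue)
    then show "(\<lambda>N. L2_ip M (?u N) (e j)) \<longlonglongrightarrow> c j" by (rule tendsto_eventually)
  qed
  ultimately show ?thesis by (rule that)
qed

lemma L2_lim_unique:
  assumes "L2_lim M F u g" "L2_lim M F u g'" "F \<noteq> bot"
  shows "AE x in M. g x = g' x"
proof -
  have gg: "g \<in> L2 M" "g' \<in> L2 M" using assms by (auto simp: L2_lim_def)
  have "\<forall>\<^sub>F i in F. L2_norm M (\<lambda>x. g x - g' x)
          \<le> L2_norm M (\<lambda>x. u i x - g' x) + L2_norm M (\<lambda>x. u i x - g x)"
  proof -
    have "\<forall>\<^sub>F i in F. u i \<in> L2 M" using assms by (simp add: L2_lim_def)
    then show ?thesis
    proof eventually_elim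
      case (elim i)
      then show ?case
        using L2_norm_triangle[OF L2_diff[OF elim gg(2)] L2_diff[OF elim gg(1)]] by simp
    qed
  qed
  moreover have "((\<lambda>i. L2_norm M (\<lambda>x. u i x - g' x) + L2_norm M (\<lambda>x. u i x - g x)) \<longlongrightarrow> 0 + 0) F"
    using assms by (intro tendsto_add) (auto simp: L2_lim_def)
  ultimately have "L2_norm M (\<lambda>x. g x - g' x) \<le> 0 + 0"
    by (intro tendsto_lowerbound[OF _ _ assms(3)])
  then have "L2_norm M (\<lambda>x. g x - g' x) = 0" using L2_norm_nonneg[of M "\<lambda>x. g x - g' x"] by simp
  then show ?thesis using L2_diff[OF gg] by (simp add: L2_norm_eq_0_iff)
qed

section \<open>Orthonormal bases and unitary maps\<close>

lemma L2_on_subset_L2: "L2_on M E \<subseteq> L2 M"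
  by (auto simp: L2_on_def)

lemma L2_on_L2: "f \<in> L2_on M E \<Longrightarrow> f \<in> L2 M"
  by (simp add: L2_on_def)

lemma L2_on_lincomb:
  assumes "finite I" "\<And>i. i \<in> I \<Longrightarrow> f i \<in> L2_on M E"
  shows "(\<lambda>x. \<Sum>i\<in>I. c i * f i x) \<in> L2_on M E"
proof -
  have "AE x in M. \<forall>i\<in>I. x \<notin> E \<longrightarrow> f i x = 0"
    using assms by (intro AE_finite_allI) (auto simp: L2_on_def)
  then have "AE x in M. x \<notin> E \<longrightarrow> (\<Sum>i\<in>I. c i * f i x) = 0"
    by eventually_elim (auto intro: sum.neutral)
  then show ?thesis
    using assms by (auto simp: L2_on_def intro: L2_lincomb)
qed

lemma L2_on_diff:
  assumes "f \<in> L2_on M E" "g \<in> L2_on M E"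
  shows "(\<lambda>x. f x - g x) \<in> L2_on M E"
proof -
  have "AE x in M. x \<notin> E \<longrightarrow> f x = 0" "AE x in M. x \<notin> E \<longrightarrow> g x = 0"
    using assms by (auto simp: L2_on_def)
  then have "AE x in M. x \<notin> E \<longrightarrow> f x - g x = 0" by eventually_elim auto
  then show ?thesis using assms by (auto simp: L2_on_def intro: L2_diff)
qed

lemma L2_on_closed:
  assumes lim: "L2_lim M F u g" and u: "\<forall>\<^sub>F i in F. u i \<in> L2_on M E" and F: "F \<noteq> bot"
    and E: "E \<inter> space M \<in> sets M"
  shows "g \<in> L2_on M E"
proof -
  let ?h = "\<lambda>x. g x * indicator (- E) x"
  have g: "g \<in> L2 M" using lim by (simp add: L2_lim_def)
  have "space M - (E \<inter> space M) \<in> sets M" using E by auto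
  moreover have "space M - (E \<inter> space M) = - E \<inter> space M" by auto
  ultimately have E': "- E \<inter> space M \<in> sets M" by simp
  have ind: "(\<lambda>x. indicator (- E) x :: complex) \<in> borel_measurable M"
    using E' by (simp add: borel_measurable_indicator_iff)
  have hint: "integrable M (\<lambda>x. (cmod (f x * indicator (- E) x))\<^sup>2)" if "f \<in> L2 M" for f
  proof (rule Bochner_Integration.integrable_bound[OF L2_square_integrable[OF that]])
    show "(\<lambda>x. (cmod (f x * indicator (- E) x))\<^sup>2) \<in> borel_measurable M"
      using L2_measurable[OF that] ind by measurable
    show "AE x in M. norm ((cmod (f x * indicator (- E) x))\<^sup>2) \<le> norm ((cmod (f x))\<^sup>2)"
      by (auto simp: indicator_def)
  qed
  have h: "?h \<in> L2 M"
    using hint[OF g] L2_measurable[OF g] ind by (auto simp: L2_iff)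
  have le: "\<forall>\<^sub>F i in F. L2_norm M ?h \<le> L2_norm M (\<lambda>x. u i x - g x)"
    using u
  proof eventually_elim
    case (elim i)
    have ui: "u i \<in> L2 M" using elim by (rule L2_on_L2)
    have "(LINT x|M. (cmod (?h x))\<^sup>2) \<le> (LINT x|M. (cmod (u i x - g x))\<^sup>2)"
    proof (rule integral_mono_AE)
      show "integrable M (\<lambda>x. (cmod (?h x))\<^sup>2)" using g by (rule hint)
      show "integrable M (\<lambda>x. (cmod (u i x - g x))\<^sup>2)"
        by (intro L2_square_integrable L2_diff ui g)
      have "AE x in M. x \<notin> E \<longrightarrow> u i x = 0" using elim by (simp add: L2_on_def)
      then show "AE x in M. (cmod (?h x))\<^sup>2 \<le> (cmod (u i x - g x))\<^sup>2"
        by eventually_elim (auto simp: indicator_def)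
    qed
    then show ?case by (simp add: L2_norm_def)
  qed
  have "L2_norm M ?h \<le> 0"
    using lim le by (intro tendsto_lowerbound[OF _ _ F]) (auto simp: L2_lim_def)
  then have "L2_norm M ?h = 0" using L2_norm_nonneg[of M ?h] by simp
  then have "AE x in M. ?h x = 0" using h by (simp add: L2_norm_eq_0_iff)
  then have "AE x in M. x \<notin> E \<longrightarrow> g x = 0"
    by eventually_elim (auto simp: indicator_def)
  then show ?thesis using g by (simp add: L2_on_def)
qed

text \<open>
  Parseval's identity mentions inner products and norms only. In this form a basis can be carried
  through any map that preserves inner products.
\<close>

lemma orthonormal_basis_iff_parseval:
  assumes H: "H \<subseteq> L2 M"
  shows "orthonormal_basis M H e \<longleftrightarrow>
     (\<forall>n. e n \<in> H) \<and> orthonormal M e \<and>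
     (\<forall>g\<in>H. (\<lambda>n. (cmod (L2_ip M g (e n)))\<^sup>2) sums (L2_norm M g)\<^sup>2)"
proof (cases "(\<forall>n. e n \<in> H) \<and> orthonormal M e")
  case True
  then have e: "\<And>n. e n \<in> L2 M" and on: "orthonormal M e" using H by auto
  have "L2_lim M sequentially (\<lambda>N x. \<Sum>n<N. L2_ip M g (e n) * e n x) g
        \<longleftrightarrow> (\<lambda>n. (cmod (L2_ip M g (e n)))\<^sup>2) sums (L2_norm M g)\<^sup>2" (is "?lim \<longleftrightarrow> ?sums")
    if g: "g \<in> L2 M" for g
  proof -
    let ?u = "\<lambda>N x. \<Sum>n<N. L2_ip M g (e n) * e n x"
    have "?lim \<longleftrightarrow> (\<lambda>N. L2_norm M (\<lambda>x. ?u N x - g x)) \<longlonglongrightarrow> 0"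
      by (simp add: L2_lim_def g L2_lincomb e)
    also have "\<dots> \<longleftrightarrow> (\<lambda>N. (L2_norm M (\<lambda>x. ?u N x - g x))\<^sup>2) \<longlonglongrightarrow> 0"
      by simp
    also have "\<dots> \<longleftrightarrow> (\<lambda>N. (L2_norm M g)\<^sup>2 - (\<Sum>n<N. (cmod (L2_ip M g (e n)))\<^sup>2)) \<longlonglongrightarrow> 0"
      by (simp add: orthonormal_expansion_dist[OF on g])
    also have "\<dots> \<longleftrightarrow> ?sums"
    proof
      assume "(\<lambda>N. (L2_norm M g)\<^sup>2 - (\<Sum>n<N. (cmod (L2_ip M g (e n)))\<^sup>2)) \<longlonglongrightarrow> 0"
      from tendsto_diff[OF tendsto_const this, of "(L2_norm M g)\<^sup>2"] show ?sums
        by (simp add: sums_def)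
    next
      assume ?sums
      then show "(\<lambda>N. (L2_norm M g)\<^sup>2 - (\<Sum>n<N. (cmod (L2_ip M g (e n)))\<^sup>2)) \<longlonglongrightarrow> 0"
        using tendsto_diff[OF tendsto_const, of _ "(L2_norm M g)\<^sup>2" sequentially "(L2_norm M g)\<^sup>2"]
        by (fastforce simp: sums_def)
    qed
    finally show ?thesis .
  qed
  then have *: "L2_lim M sequentially (\<lambda>N x. \<Sum>n<N. L2_ip M g (e n) * e n x) g
        \<longleftrightarrow> (\<lambda>n. (cmod (L2_ip M g (e n)))\<^sup>2) sums (L2_norm M g)\<^sup>2" if "g \<in> H" for g
    using that H by blast
  then have "(\<forall>g\<in>H. L2_lim M sequentially (\<lambda>N x. \<Sum>n<N. L2_ip M g (e n) * e n x) g)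
      \<longleftrightarrow> (\<forall>g\<in>H. (\<lambda>n. (cmod (L2_ip M g (e n)))\<^sup>2) sums (L2_norm M g)\<^sup>2)"
    by blast
  then show ?thesis using True unfolding orthonormal_basis_def orthonormal_def by blast
next
  case False
  then show ?thesis using H unfolding orthonormal_basis_def orthonormal_def by blast
qed

lemma orthonormal_basis_sums_ip:
  assumes H: "H \<subseteq> L2 M" and onb: "orthonormal_basis M H e" and g: "g \<in> H" and h: "h \<in> L2 M"
  shows "(\<lambda>n. L2_ip M g (e n) * cnj (L2_ip M h (e n))) sums L2_ip M g h"
proof -
  have e: "e n \<in> L2 M" for n using onb H by (auto simp: orthonormal_basis_def)
  let ?u = "\<lambda>N x. \<Sum>n<N. L2_ip M g (e n) * e n x"
  have "(\<lambda>N. L2_ip M (?u N) h) \<longlonglongrightarrow> L2_ip M g h"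
  proof (rule L2_ip_tendsto_left)
    have "L2_lim M sequentially ?u g" using onb g by (simp add: orthonormal_basis_def)
    then show "(\<lambda>N. L2_norm M (\<lambda>x. ?u N x - g x)) \<longlonglongrightarrow> 0" "\<forall>\<^sub>F N in sequentially. ?u N \<in> L2 M" "g \<in> L2 M"
      by (auto simp: L2_lim_def)
  qed (rule h)
  moreover have "L2_ip M (?u N) h = (\<Sum>n<N. L2_ip M g (e n) * cnj (L2_ip M h (e n)))" for N
    using e h by (simp add: L2_ip_lincomb_left L2_ip_commute[of M "e _" h])
  ultimately show ?thesis by (simp add: sums_def)
qed

text \<open>
  The expansion of a function converges by Riesz-Fischer, and the difference between the function and
  the sum of its expansion is orthogonal to every basis function.
\<close>

lemma orthonormal_basis_if_total:
  assumes E: "E \<inter> space M \<in> sets M" and e: "\<And>n. e n \<in> L2_on M E" and on: "orthonormal M e"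
    and total: "\<And>g. g \<in> L2_on M E \<Longrightarrow> (\<And>n. L2_ip M g (e n) = 0) \<Longrightarrow> AE x in M. g x = 0"
  shows "orthonormal_basis M (L2_on M E) e"
  unfolding orthonormal_basis_def
proof (intro conjI ballI allI)
  show "e n \<in> L2_on M E" for n by (rule e)
  show "L2_ip M (e m) (e n) = (if m = n then 1 else 0)" for m n
    using on by (simp add: orthonormal_def)
  fix g assume gE: "g \<in> L2_on M E"
  then have g: "g \<in> L2 M" by (rule L2_on_L2)
  have eL: "e n \<in> L2 M" for n using e by (rule L2_on_L2)
  let ?u = "\<lambda>N x. \<Sum>n<N. L2_ip M g (e n) * e n x"
  obtain g' where g': "L2_lim M sequentially ?u g'" "\<And>n. L2_ip M g' (e n) = L2_ip M g (e n)"
    using riesz_fischer[OF on orthonormal_bessel_summable[OF on g]] by blast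
  have "g' \<in> L2_on M E"
    by (rule L2_on_closed[OF g'(1) _ _ E]) (auto intro!: always_eventually L2_on_lincomb e)
  moreover have "g' \<in> L2 M" using calculation by (rule L2_on_L2)
  ultimately have "AE x in M. g x - g' x = 0"
    using gE g g'(2) eL by (intro total L2_on_diff) (auto simp: L2_ip_diff_left)
  then have ae: "AE x in M. g x = g' x" by eventually_elim simp
  have "L2_norm M (\<lambda>x. ?u N x - g x) = L2_norm M (\<lambda>x. ?u N x - g' x)" for N
  proof (rule L2_norm_AE_cong)
    have "?u N \<in> L2 M" by (rule L2_lincomb) (rule eL)
    then show "(\<lambda>x. ?u N x - g x) \<in> L2 M" "(\<lambda>x. ?u N x - g' x) \<in> L2 M"
      using g \<open>g' \<in> L2 M\<close> by (auto intro: L2_diff)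
    show "AE x in M. ?u N x - g x = ?u N x - g' x" using ae by eventually_elim simp
  qed
  then show "L2_lim M sequentially ?u g"
    using g'(1) g by (simp add: L2_lim_def)
qed

text \<open>
  Surjectivity is meant for classes modulo null sets. Distances are expressible by inner products, so
  such a map determines its arguments almost everywhere.
\<close>

definition L2_unitary ::
    "'a measure \<Rightarrow> ('a \<Rightarrow> complex) set \<Rightarrow> 'b measure \<Rightarrow> ('b \<Rightarrow> complex) set
      \<Rightarrow> (('a \<Rightarrow> complex) \<Rightarrow> 'b \<Rightarrow> complex) \<Rightarrow> bool" where
  "L2_unitary M A N B \<Phi> \<longleftrightarrow>
     A \<subseteq> L2 M \<and> B \<subseteq> L2 N \<and> (\<forall>f\<in>A. \<Phi> f \<in> B) \<and>
     (\<forall>h\<in>B. \<exists>f\<in>A. AE x in N. \<Phi> f x = h x) \<and>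
     (\<forall>f\<in>A. \<forall>g\<in>A. L2_ip N (\<Phi> f) (\<Phi> g) = L2_ip M f g)"

lemma L2_unitary_norm:
  assumes "L2_unitary M A N B \<Phi>" "f \<in> A"
  shows "(L2_norm N (\<Phi> f))\<^sup>2 = (L2_norm M f)\<^sup>2"
proof -
  have "L2_ip N (\<Phi> f) (\<Phi> f) = L2_ip M f f" using assms by (simp add: L2_unitary_def)
  then show ?thesis by (simp only: L2_ip_self of_real_eq_iff)
qed

lemma L2_unitary_inj:
  assumes U: "L2_unitary M A N B \<Phi>" and f: "f \<in> A" "g \<in> A" and eq: "AE x in N. \<Phi> f x = \<Phi> g x"
  shows "AE x in M. f x = g x"
proof -
  have L: "f \<in> L2 M" "g \<in> L2 M" "\<Phi> f \<in> L2 N" "\<Phi> g \<in> L2 N"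
    using U f by (auto simp: L2_unitary_def)
  have "(L2_norm M (\<lambda>x. f x - g x))\<^sup>2 = (L2_norm N (\<lambda>x. \<Phi> f x - \<Phi> g x))\<^sup>2"
    using U f by (simp add: L2_norm_diff_square L L2_unitary_norm[OF U])
      (simp add: L2_unitary_def)
  also have "\<dots> = 0"
    using eq L by (auto simp: L2_norm_eq_0_iff L2_diff)
  finally show ?thesis using L by (simp add: L2_norm_eq_0_iff L2_diff)
qed

lemma L2_inverse_unitary:
  assumes "L2_unitary M A N B \<Phi>" "h \<in> B"
  shows "L2_inverse A N \<Phi> h \<in> A" "AE x in N. \<Phi> (L2_inverse A N \<Phi> h) x = h x"
proof -
  have "\<exists>g. g \<in> A \<and> (AE x in N. \<Phi> g x = h x)" using assms by (auto simp: L2_unitary_def)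
  from someI_ex[OF this] show "L2_inverse A N \<Phi> h \<in> A" "AE x in N. \<Phi> (L2_inverse A N \<Phi> h) x = h x"
    by (auto simp: L2_inverse_def)
qed

lemma L2_ip_inverse_unitary:
  assumes U: "L2_unitary M A N B \<Phi>" and f: "f \<in> A" and h: "h \<in> B"
  shows "L2_ip M f (L2_inverse A N \<Phi> h) = L2_ip N (\<Phi> f) h"
    and "L2_ip M (L2_inverse A N \<Phi> h) f = L2_ip N h (\<Phi> f)"
proof -
  let ?g = "L2_inverse A N \<Phi> h"
  note g = L2_inverse_unitary[OF U h]
  have "L2_ip M f ?g = L2_ip N (\<Phi> f) (\<Phi> ?g)"
    using U f g(1) by (simp add: L2_unitary_def)
  also have "\<dots> = L2_ip N (\<Phi> f) h"
    using U f h g by (intro L2_ip_AE_cong) (auto simp: L2_unitary_def)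
  finally show *: "L2_ip M f ?g = L2_ip N (\<Phi> f) h" .
  show "L2_ip M ?g f = L2_ip N h (\<Phi> f)"
    using arg_cong[OF *, of cnj] by (simp only: L2_ip_commute[symmetric])
qed

lemma L2_ip_inverse_inverse_unitary:
  assumes U: "L2_unitary M A N B \<Phi>" and h: "h \<in> B" and h': "h' \<in> B"
  shows "L2_ip M (L2_inverse A N \<Phi> h) (L2_inverse A N \<Phi> h') = L2_ip N h h'"
proof -
  note g = L2_inverse_unitary[OF U h]
  have "L2_ip M (L2_inverse A N \<Phi> h) (L2_inverse A N \<Phi> h') = L2_ip N (\<Phi> (L2_inverse A N \<Phi> h)) h'"
    by (rule L2_ip_inverse_unitary(1)[OF U g(1) h'])
  also have "\<dots> = L2_ip N h h'"
    using U h h' g by (intro L2_ip_AE_cong) (auto simp: L2_unitary_def)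
  finally show ?thesis .
qed

lemma orthonormal_basis_inverse_unitary:
  assumes U: "L2_unitary M A N B \<Phi>" and onb: "orthonormal_basis N B e"
  shows "orthonormal_basis M A (\<lambda>n. L2_inverse A N \<Phi> (e n))"
proof -
  have B: "B \<subseteq> L2 N" and A: "A \<subseteq> L2 M" using U by (auto simp: L2_unitary_def)
  have e: "e n \<in> B" for n using onb by (simp add: orthonormal_basis_def)
  have A': "L2_inverse A N \<Phi> (e n) \<in> A" for n by (rule L2_inverse_unitary[OF U e])
  have "orthonormal M (\<lambda>n. L2_inverse A N \<Phi> (e n))"
    unfolding orthonormal_def L2_ip_inverse_inverse_unitary[OF U e e]
    using A A' onb by (auto simp: orthonormal_basis_def)
  moreover have "(\<lambda>n. (cmod (L2_ip M g (L2_inverse A N \<Phi> (e n))))\<^sup>2) sums (L2_norm M g)\<^sup>2"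
    if g: "g \<in> A" for g
  proof -
    have "\<Phi> g \<in> B" using U g by (simp add: L2_unitary_def)
    then show ?thesis
      using onb unfolding orthonormal_basis_iff_parseval[OF B]
      by (auto simp: L2_ip_inverse_unitary(1)[OF U g e] simp flip: L2_unitary_norm[OF U g])
  qed
  ultimately show ?thesis
    unfolding orthonormal_basis_iff_parseval[OF A] using A' by blast
qed

lemma orthonormal_basis_AE_cong:
  assumes H: "H \<subseteq> L2 M" and onb: "orthonormal_basis M H e"
    and e': "\<And>n. e' n \<in> H" and ae: "\<And>n. AE x in M. e n x = e' n x"
  shows "orthonormal_basis M H e'"
proof -
  have L: "e n \<in> L2 M" "e' n \<in> L2 M" for n using e' onb H by (auto simp: orthonormal_basis_def)
  have ip: "L2_ip M g (e n) = L2_ip M g (e' n)" if "g \<in> L2 M" for g n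
    using that L ae by (intro L2_ip_AE_cong) auto
  have ip2: "L2_ip M (e m) (e n) = L2_ip M (e' m) (e' n)" for m n
    using L ae by (intro L2_ip_AE_cong) auto
  show ?thesis
    using onb e' H L unfolding orthonormal_basis_iff_parseval[OF H]
    by (auto simp: orthonormal_def ip2 ip subset_iff)
qed

section \<open>Translations and characters of the torus\<close>

definition unit_cell :: "(real \<times> real) set" where
  "unit_cell = {-1/2..<1/2} \<times> {-1/2..<1/2}"

definition lattice :: "int \<times> int \<Rightarrow> real \<times> real" where
  "lattice n = (of_int (fst n), of_int (snd n))"

lemma unit_cell_borel: "unit_cell \<in> sets borel"
  unfolding unit_cell_def by (intro borel_Times) auto

lemma unit_cell_lebesgue: "unit_cell \<in> sets lebesgue"
  using unit_cell_borel by auto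

lemma space_torus: "space torus = unit_cell"
  by (simp add: torus_def unit_cell_def)

lemma sets_torus_iff: "A \<in> sets torus \<longleftrightarrow> A \<subseteq> unit_cell \<and> A \<in> sets lebesgue"
  unfolding torus_def unit_cell_def[symmetric] using unit_cell_lebesgue
  by (simp add: sets_restrict_space_iff conj_commute)

lemma emeasure_torus: "A \<in> sets torus \<Longrightarrow> emeasure torus A = emeasure lebesgue A"
  using sets_torus_iff[of A] unfolding torus_def unit_cell_def[symmetric]
  by (intro emeasure_restrict_space) (auto simp: unit_cell_lebesgue)

lemma emeasure_unit_cell: "emeasure lebesgue unit_cell = 1"
proof -
  have "emeasure lebesgue unit_cell = emeasure lborel unit_cell"
    using unit_cell_borel by simp
  also have "\<dots> = emeasure (lborel \<Otimes>\<^sub>M lborel) unit_cell"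
    by (simp only: lborel_prod)
  also have "\<dots> = emeasure lborel {-1/2..<1/2::real} * emeasure lborel {-1/2..<1/2::real}"
    unfolding unit_cell_def by (intro lborel.emeasure_pair_measure_Times) auto
  also have "\<dots> = 1" by simp
  finally show ?thesis .
qed

lemma prob_torus: "emeasure torus (space torus) = 1"
  unfolding space_torus using emeasure_torus[of unit_cell] unit_cell_lebesgue emeasure_unit_cell
  by (simp add: sets_torus_iff)

lemma finite_measure_torus: "finite_measure torus"
  by (rule finite_measureI) (simp add: prob_torus)

lemma wrap_eq_iff: "wrap x = y \<longleftrightarrow> y \<in> unit_cell \<and> (\<exists>n. x = y + lattice n)"
proof
  assume "wrap x = y"
  then have y: "y = (fst x - of_int \<lfloor>fst x + 1/2\<rfloor>, snd x - of_int \<lfloor>snd x + 1/2\<rfloor>)"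
    by (simp add: wrap_def)
  have "y \<in> unit_cell"
    unfolding y using floor_correct[of "fst x + 1/2"] floor_correct[of "snd x + 1/2"]
    by (auto simp: unit_cell_def field_simps)
  moreover have "x = y + lattice (\<lfloor>fst x + 1/2\<rfloor>, \<lfloor>snd x + 1/2\<rfloor>)"
    by (simp add: y lattice_def prod_eq_iff)
  ultimately show "y \<in> unit_cell \<and> (\<exists>n. x = y + lattice n)" by blast
next
  assume "y \<in> unit_cell \<and> (\<exists>n. x = y + lattice n)"
  then obtain n where y: "y \<in> unit_cell" "x = y + lattice n" by blast
  have "\<lfloor>fst x + 1/2\<rfloor> = fst n" "\<lfloor>snd x + 1/2\<rfloor> = snd n"
    using y by (auto simp: lattice_def floor_eq_iff mem_Times_iff unit_cell_def)
  then show "wrap x = y" using y by (simp add: wrap_def lattice_def prod_eq_iff)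
qed

lemma wrap_in_unit_cell: "wrap x \<in> unit_cell"
  using wrap_eq_iff[of x "wrap x"] by blast

lemma lattice_add: "lattice (m + n) = lattice m + lattice n"
  by (simp add: lattice_def)

lemma wrap_ident: "x \<in> unit_cell \<Longrightarrow> wrap x = x"
  unfolding wrap_eq_iff by (intro conjI exI[of _ 0]) (auto simp: lattice_def zero_prod_def)

lemma wrap_congruent: obtains n where "x = wrap x + lattice n"
  using wrap_eq_iff[of x "wrap x"] by blast

lemma wrap_add_lattice: "wrap (x + lattice n) = wrap x"
proof -
  obtain m where "x = wrap x + lattice m" by (rule wrap_congruent)
  then have "x + lattice n = wrap x + lattice (m + n)" by (simp add: lattice_add)
  then show ?thesis unfolding wrap_eq_iff using wrap_in_unit_cell by blast
qed

lemma wrap_wrap_add: "wrap (wrap x + a) = wrap (x + a)"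
proof -
  obtain n where "x = wrap x + lattice n" by (rule wrap_congruent)
  then have "x + a = (wrap x + a) + lattice n" by simp
  then show ?thesis using wrap_add_lattice[of "wrap x + a" n] by metis
qed

lemma emeasure_lebesgue_translation: "emeasure lebesgue ((\<lambda>x. x + v) ` A) = emeasure lebesgue A"
  for v :: "'a::euclidean_space"
  using emeasure_lebesgue_affine[of 1 v A] by simp

lemma sets_lebesgue_translation: "A \<in> sets lebesgue \<Longrightarrow> (\<lambda>x. x + v) ` A \<in> sets lebesgue"
  for v :: "'a::euclidean_space"
  using lebesgue_sets_translation[of A v] by (simp add: add.commute)

text \<open>
  The preimage is cut into the countably many pieces on which the reduction subtracts a fixed lattice
  vector. Translating the pieces back gives a partition of the original set, because the translates of
  the unit cell by lattice vectors partition the plane.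
\<close>

lemma
  assumes A: "A \<in> sets torus"
  shows wrap_vimage_sets: "{x \<in> unit_cell. wrap (x + a) \<in> A} \<in> sets torus"
    and emeasure_wrap_vimage: "emeasure torus {x \<in> unit_cell. wrap (x + a) \<in> A} = emeasure torus A"
proof -
  have AQ: "A \<subseteq> unit_cell" and Al: "A \<in> sets lebesgue" using A by (auto simp: sets_torus_iff)
  define B where "B n = unit_cell \<inter> (\<lambda>x. x + (lattice n - a)) ` A" for n
  define C where "C n = A \<inter> (\<lambda>x. x + (a - lattice n)) ` unit_cell" for n
  have B: "B n \<in> sets lebesgue" and C: "C n \<in> sets lebesgue" for n
    unfolding B_def C_def using Al unit_cell_lebesgue by (intro sets.Int sets_lebesgue_translation; simp)+
  have CB: "C n = (\<lambda>x. x + (a - lattice n)) ` B n" for n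
  proof (intro set_eqI iffI)
    fix y assume "y \<in> C n"
    then obtain x where x: "y \<in> A" "x \<in> unit_cell" "y = x + (a - lattice n)" by (auto simp only: C_def Int_iff image_iff Bex_def)
    then have "x = y + (lattice n - a)" by simp
    then have "x \<in> B n" using x unfolding B_def by blast
    then show "y \<in> (\<lambda>x. x + (a - lattice n)) ` B n" using x by blast
  next
    fix y assume "y \<in> (\<lambda>x. x + (a - lattice n)) ` B n"
    then obtain x z where x: "x \<in> unit_cell" "z \<in> A" "x = z + (lattice n - a)" "y = x + (a - lattice n)"
      unfolding B_def by blast
    then have "y = z" by simp
    then show "y \<in> C n" using x unfolding C_def by blast
  qed
  have wB: "x \<in> B n \<longleftrightarrow> x \<in> unit_cell \<and> wrap (x + a) \<in> A \<and> x + a = wrap (x + a) + lattice n" for x n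
  proof
    assume "x \<in> B n"
    then obtain z where z: "x \<in> unit_cell" "z \<in> A" "x = z + (lattice n - a)" unfolding B_def by blast
    have "wrap (x + a) = z"
      unfolding wrap_eq_iff by (intro conjI exI[of _ n]) (use z AQ in auto)
    then show "x \<in> unit_cell \<and> wrap (x + a) \<in> A \<and> x + a = wrap (x + a) + lattice n" using z by simp
  next
    assume x: "x \<in> unit_cell \<and> wrap (x + a) \<in> A \<and> x + a = wrap (x + a) + lattice n"
    then have "x = wrap (x + a) + (lattice n - a)"
      by (metis add_diff_cancel_right' add_diff_eq)
    then show "x \<in> B n" using x unfolding B_def by blast
  qed
  have lattice_inj: "m = n" if "lattice m = lattice n" for m n
    using that by (simp add: lattice_def prod_eq_iff)
  have vim: "{x \<in> unit_cell. wrap (x + a) \<in> A} = (\<Union>n. B n)"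
  proof (intro set_eqI iffI)
    fix x assume x: "x \<in> {x \<in> unit_cell. wrap (x + a) \<in> A}"
    obtain n where "x + a = wrap (x + a) + lattice n" by (rule wrap_congruent)
    then have "x \<in> B n" using x unfolding wB by simp
    then show "x \<in> (\<Union>n. B n)" by blast
  qed (use wB in blast)
  have UC: "(\<Union>n. C n) = A"
  proof (intro set_eqI iffI)
    fix y assume y: "y \<in> A"
    obtain n where n: "y - a = wrap (y - a) + lattice n" by (rule wrap_congruent)
    then have "y = wrap (y - a) + (a - lattice (- n))"
      by (simp add: lattice_def prod_eq_iff algebra_simps)
    then have "y \<in> C (- n)" using y wrap_in_unit_cell unfolding C_def by blast
    then show "y \<in> (\<Union>n. C n)" by blast
  qed (auto simp: C_def)
  have disjB: "disjoint_family B"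
      unfolding disjoint_family_on_def
  proof (intro ballI impI)
    fix m n :: "int \<times> int" assume "m \<noteq> n"
    then show "B m \<inter> B n = {}" using lattice_inj[of m n] wB[of _ m] wB[of _ n]
      by (metis add_left_cancel disjoint_iff)
  qed
  have disjC: "disjoint_family C"
      unfolding disjoint_family_on_def
  proof (intro ballI impI)
    fix m n :: "int \<times> int" assume mn: "m \<noteq> n"
    have False if y: "y \<in> C m" "y \<in> C n" for y
    proof -
      obtain x z where xz: "x \<in> unit_cell" "z \<in> unit_cell" "y = x + (a - lattice m)" "y = z + (a - lattice n)"
        using y unfolding C_def by blast
      have "wrap (y - a + lattice m) = x" unfolding xz(3) using xz(1) by (simp add: wrap_ident)
      moreover have "wrap (y - a + lattice n) = z" unfolding xz(4) using xz(2) by (simp add: wrap_ident)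
      ultimately have "x = z" by (simp add: wrap_add_lattice)
      then have "lattice m = lattice n" using xz by simp
      then show False using lattice_inj mn by blast
    qed
    then show "C m \<inter> C n = {}" by blast
  qed
  have "(\<Union>n. B n) \<in> sets lebesgue"
    by (rule sets.countable_UN') (use B in auto)
  then show S: "{x \<in> unit_cell. wrap (x + a) \<in> A} \<in> sets torus"
    unfolding sets_torus_iff vim[symmetric] by auto
  have "emeasure torus {x \<in> unit_cell. wrap (x + a) \<in> A} = emeasure lebesgue (\<Union>n. B n)"
    using emeasure_torus[OF S] vim by simp
  also have "\<dots> = (\<integral>\<^sup>+n. emeasure lebesgue (B n) \<partial>count_space UNIV)"
    using B disjB by (intro emeasure_UN_countable) auto
  also have "\<dots> = (\<integral>\<^sup>+n. emeasure lebesgue (C n) \<partial>count_space UNIV)"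
    by (simp only: CB emeasure_lebesgue_translation)
  also have "\<dots> = emeasure lebesgue (\<Union>n. C n)"
    using C disjC by (intro emeasure_UN_countable[symmetric]) auto
  also have "\<dots> = emeasure torus A" using A UC by (simp add: emeasure_torus)
  finally show "emeasure torus {x \<in> unit_cell. wrap (x + a) \<in> A} = emeasure torus A" .
qed

lemma wrap_measurable: "(\<lambda>x. wrap (x + a)) \<in> measurable torus torus"
proof (rule measurableI)
  show "wrap (x + a) \<in> space torus" for x
    unfolding space_torus by (rule wrap_in_unit_cell)
  show "(\<lambda>x. wrap (x + a)) -` A \<inter> space torus \<in> sets torus" if "A \<in> sets torus" for A
  proof -
    have "(\<lambda>x. wrap (x + a)) -` A \<inter> space torus = {x \<in> unit_cell. wrap (x + a) \<in> A}"
      unfolding space_torus by blast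
    then show ?thesis using wrap_vimage_sets[OF that] by simp
  qed
qed

theorem distr_wrap: "distr torus torus (\<lambda>x. wrap (x + a)) = torus"
proof (rule measure_eqI)
  fix A assume "A \<in> sets (distr torus torus (\<lambda>x. wrap (x + a)))"
  then have A: "A \<in> sets torus" by simp
  have "(\<lambda>x. wrap (x + a)) -` A \<inter> space torus = {x \<in> unit_cell. wrap (x + a) \<in> A}"
    unfolding space_torus by blast
  then show "emeasure (distr torus torus (\<lambda>x. wrap (x + a))) A = emeasure torus A"
    using A by (simp add: emeasure_distr wrap_measurable emeasure_wrap_vimage)
qed simp

lemma integral_wrap:
  fixes f :: "real \<times> real \<Rightarrow> 'b::{banach, second_countable_topology}"
  assumes "f \<in> borel_measurable torus"
  shows "(LINT x|torus. f (wrap (x + a))) = (LINT x|torus. f x)"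
  using integral_distr[OF wrap_measurable assms, of a] by (simp add: distr_wrap)

lemma AE_wrap: "AE x in torus. Q x \<Longrightarrow> AE x in torus. Q (wrap (x + a))"
  using AE_distrD[OF wrap_measurable[of a], of Q] unfolding distr_wrap .

lemma L2_wrap:
  assumes "f \<in> L2 torus"
  shows "(\<lambda>x. f (wrap (x + a))) \<in> L2 torus"
proof -
  have "integrable (distr torus torus (\<lambda>x. wrap (x + a))) (\<lambda>x. (cmod (f x))\<^sup>2)"
    using assms by (simp add: distr_wrap L2_iff)
  then have "integrable torus (\<lambda>x. (cmod (f (wrap (x + a))))\<^sup>2)"
    by (rule integrable_distr[OF wrap_measurable])
  moreover have "(\<lambda>x. f (wrap (x + a))) \<in> borel_measurable torus"
    using measurable_compose[OF wrap_measurable L2_measurable[OF assms]] .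
  ultimately show ?thesis by (simp add: L2_iff)
qed

lemma borel_measurable_torus_continuous:
  fixes f :: "real \<times> real \<Rightarrow> 'b::euclidean_space"
  assumes "continuous_on UNIV f" shows "f \<in> borel_measurable torus"
  unfolding torus_def unit_cell_def[symmetric]
  by (rule continuous_imp_measurable_on_sets_lebesgue[OF continuous_on_subset[OF assms] unit_cell_lebesgue]) simp

lemma L2_torus_bounded:
  assumes "f \<in> borel_measurable torus" and le: "\<And>x. cmod (f x) \<le> B"
  shows "f \<in> L2 torus"
proof -
  have "(cmod (f x))\<^sup>2 \<le> B\<^sup>2" for x using le by (rule power_mono) simp
  interpret finite_measure torus by (rule finite_measure_torus)
  have "integrable torus (\<lambda>x. (cmod (f x))\<^sup>2)"
    using \<open>\<And>x. (cmod (f x))\<^sup>2 \<le> B\<^sup>2\<close> assms(1)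
    by (intro integrable_const_bound[where B = "B\<^sup>2"]) simp_all
  then show ?thesis using assms by (simp add: L2_iff)
qed

lemma L2_torus_integrable: "f \<in> L2 torus \<Longrightarrow> integrable torus f"
  using L2_mult_cnj_integrable[OF _ L2_torus_bounded[of "\<lambda>_. 1" 1], of f] by simp

lemma character_continuous: "continuous_on UNIV (character k)"
  unfolding character_def by (intro continuous_intros)

lemma character_measurable: "character k \<in> borel_measurable torus"
  by (intro borel_measurable_torus_continuous character_continuous)

lemma cmod_character [simp]: "cmod (character k x) = 1"
  by (simp add: character_def norm_exp_eq_Re)

lemma character_L2: "character k \<in> L2 torus"
  by (rule L2_torus_bounded[OF character_measurable, where B = 1]) simp

lemma character_mult: "character k x * character m x = character (k + m) x"
  by (simp add: character_def exp_add[symmetric] algebra_simps)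

lemma cnj_character: "cnj (character k x) = character (- k) x"
  by (simp add: character_def exp_cnj algebra_simps)

lemma character_0 [simp]: "character 0 x = 1"
  by (simp add: character_def)

lemma character_add: "character k (x + y) = character k x * character k y"
  by (simp add: character_def exp_add[symmetric] algebra_simps)

lemma character_lattice: "character k (lattice n) = 1"
proof -
  have "character k (lattice n) = exp ((2 * of_int (fst k * fst n + snd k * snd n) * pi) * \<i>)"
    by (simp add: character_def lattice_def algebra_simps)
  also have "\<dots> = 1" by (rule exp_integer_2pi) (rule Ints_of_int)
  finally show ?thesis .
qed

lemma character_wrap: "character k (wrap x) = character k x"
proof -
  obtain n where "x = wrap x + lattice n" by (rule wrap_congruent)
  then have "character k x = character k (wrap x + lattice n)" by simp
  then show ?thesis by (simp add: character_add character_lattice)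
qed

text \<open>
  Translation by a vector at which the character has the value -1 changes the sign of the integral,
  but the integral is translation invariant.
\<close>

lemma integral_character: "(LINT x|torus. character k x) = (if k = 0 then 1 else 0)"
proof (cases "k = 0")
  case True
  then show ?thesis using prob_torus by (simp add: measure_def)
next
  case False
  define a where "a = (if fst k \<noteq> 0 then (1 / (2 * of_int (fst k)), 0) else (0, 1 / (2 * of_int (snd k))) :: real \<times> real)"
  have "character k a = exp (complex_of_real pi * \<i>)"
    using False by (auto simp: character_def a_def prod_eq_iff)
  then have a: "character k a = -1" by (simp add: mult.commute)
  have "(LINT x|torus. character k x) = (LINT x|torus. character k (wrap (x + a)))"
    by (rule integral_wrap[symmetric, OF character_measurable])
  also have "\<dots> = (LINT x|torus. character k x * (-1))"
    by (simp add: character_wrap character_add a)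
  also have "\<dots> = - (LINT x|torus. character k x)" by simp
  finally show ?thesis using False by simp
qed

lemma orthonormal_character: "orthonormal torus character"
proof -
  have "L2_ip torus (character k) (character m) = (if k = m then 1 else 0)" for k m
  proof -
    have "L2_ip torus (character k) (character m) = (LINT x|torus. character (k - m) x)"
      unfolding L2_ip_def cnj_character character_mult by simp
    then show ?thesis by (simp add: integral_character)
  qed
  then show ?thesis by (simp add: orthonormal_def character_L2)
qed

section \<open>Completeness of the characters\<close>

text \<open>
  The finite linear combinations of characters, in a form in which closure under products is an
  induction.
\<close>

inductive trigpoly :: "(real \<times> real \<Rightarrow> complex) \<Rightarrow> bool" where
  monomial: "trigpoly (\<lambda>x. c * character k x)"
| add: "trigpoly f \<Longrightarrow> trigpoly g \<Longrightarrow> trigpoly (\<lambda>x. f x + g x)"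

lemma trigpoly_mult_monomial:
  assumes "trigpoly f" shows "trigpoly (\<lambda>x. (c * character k x) * f x)"
  using assms
proof induction
  case (monomial d m)
  have "(\<lambda>x. (c * character k x) * (d * character m x)) = (\<lambda>x. (c * d) * character (k + m) x)"
    by (simp add: character_mult[symmetric] mult_ac)
  then show ?case by (simp only: trigpoly.monomial)
next
  case (add f g)
  from add.IH show ?case unfolding distrib_left by (rule trigpoly.add)
qed

lemma trigpoly_mult:
  assumes f: "trigpoly f" and g: "trigpoly g" shows "trigpoly (\<lambda>x. f x * g x)"
  using f
proof induction
  case (monomial c k)
  show ?case using g by (rule trigpoly_mult_monomial)
next
  case (add f1 f2)
  from add.IH show ?case unfolding distrib_right by (rule trigpoly.add)
qed

text \<open>
  The identification of the torus with a product of two circles in \<open>\<complex>\<^sup>2\<close>. It makes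
  trigonometric polynomials out of polynomials in two complex variables, to which the
  Stone-Weierstrass theorem for compact sets applies.
\<close>

definition torus_embedding :: "real \<times> real \<Rightarrow> complex \<times> complex" where
  "torus_embedding x = (character (1, 0) x, character (0, 1) x)"

lemma torus_embedding_continuous: "continuous_on A torus_embedding"
  unfolding torus_embedding_def
  by (intro continuous_on_Pair continuous_on_subset[OF character_continuous]) auto

lemma torus_embedding_range: "torus_embedding x \<in> sphere 0 1 \<times> sphere 0 1"
  by (simp add: torus_embedding_def)

lemma torus_embedding_inj: "inj_on torus_embedding unit_cell"
proof (rule inj_onI)
  fix x y assume xy: "x \<in> unit_cell" "y \<in> unit_cell" and eq: "torus_embedding x = torus_embedding y"
  have *: "\<exists>m::int. s = t + of_int m"
    if "exp (2 * complex_of_real pi * \<i> * complex_of_real s) = exp (2 * complex_of_real pi * \<i> * complex_of_real t)"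
    for s t :: real
  proof -
    obtain m :: int where
      "2 * complex_of_real pi * \<i> * complex_of_real s = 2 * complex_of_real pi * \<i> * complex_of_real t + (of_int (2 * m) * pi) * \<i>"
      using \<open>exp _ = exp _\<close> unfolding exp_eq by blast
    then have "(2 * complex_of_real pi * \<i>) * complex_of_real s = (2 * complex_of_real pi * \<i>) * complex_of_real (t + of_int m)"
      by (simp add: algebra_simps)
    then have "complex_of_real s = complex_of_real (t + of_int m)" by simp
    then have "s = t + of_int m" by (simp only: of_real_eq_iff)
    then show ?thesis by blast
  qed
  obtain m n :: int where "fst x = fst y + of_int m" "snd x = snd y + of_int n"
    using eq *[of "fst x" "fst y"] *[of "snd x" "snd y"] by (auto simp: torus_embedding_def character_def)
  then have "x = y + lattice (m, n)" by (simp add: lattice_def prod_eq_iff)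
  then have "wrap x = y" using xy unfolding wrap_eq_iff by blast
  then show "x = y" using xy by (simp add: wrap_ident)
qed

lemma trigpoly_real_polynomial:
  assumes "real_polynomial_function p"
  shows "trigpoly (\<lambda>x. complex_of_real (p (torus_embedding x)))"
  using assms
proof induction
  case (linear f)
  interpret bounded_linear f by fact
  define a b c d where "a = complex_of_real (f (1, 0))" and "b = complex_of_real (f (\<i>, 0))"
    and "c = complex_of_real (f (0, 1))" and "d = complex_of_real (f (0, \<i>))"
  have half: "complex_of_real (Re z) = z / 2 + cnj z / 2" "complex_of_real (Im z) = (z - cnj z) / (2 * \<i>)" for z
    by (simp_all add: complex_eq_iff)
  have "complex_of_real (f (torus_embedding x)) = (a - \<i> * b) / 2 * character (1, 0) x
      + (a + \<i> * b) / 2 * character (-1, 0) x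
      + ((c - \<i> * d) / 2 * character (0, 1) x + (c + \<i> * d) / 2 * character (0, -1) x)" for x
  proof -
    let ?z = "character (1, 0) x" and ?w = "character (0, 1) x"
    have "torus_embedding x = Re ?z *\<^sub>R (1, 0) + Im ?z *\<^sub>R (\<i>, 0) + (Re ?w *\<^sub>R (0, 1) + Im ?w *\<^sub>R (0, \<i>))"
      by (simp add: torus_embedding_def complex_eq_iff)
    then have "f (torus_embedding x) = Re ?z * f (1, 0) + Im ?z * f (\<i>, 0) + (Re ?w * f (0, 1) + Im ?w * f (0, \<i>))"
      by (simp only: add scale real_scaleR_def)
    then have "complex_of_real (f (torus_embedding x)) = complex_of_real (Re ?z) * a + complex_of_real (Im ?z) * b
       + (complex_of_real (Re ?w) * c + complex_of_real (Im ?w) * d)"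
      by (simp add: a_def b_def c_def d_def)
    also have "\<dots> = (?z / 2 + cnj ?z / 2) * a + (?z - cnj ?z) / (2 * \<i>) * b
       + ((?w / 2 + cnj ?w / 2) * c + (?w - cnj ?w) / (2 * \<i>) * d)"
      by (simp only: half)
    also have "\<dots> = (a - \<i> * b) / 2 * ?z + (a + \<i> * b) / 2 * cnj ?z
       + ((c - \<i> * d) / 2 * ?w + (c + \<i> * d) / 2 * cnj ?w)"
      by (simp add: field_simps)
    finally show ?thesis by (simp add: cnj_character)
  qed
  then show ?case by (simp only:) (rule trigpoly.add; rule trigpoly.add; rule trigpoly.monomial)
next
  case (const c)
  show ?case using trigpoly.monomial[of "complex_of_real c" 0] by simp
next
  case (add f g)
  from add.IH show ?case unfolding of_real_add by (rule trigpoly.add)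
next
  case (mult f g)
  from mult.IH show ?case unfolding of_real_mult by (rule trigpoly_mult)
qed

context
  fixes f :: "real \<times> real \<Rightarrow> complex"
  assumes f: "f \<in> L2 torus" and orth: "\<And>k. L2_ip torus f (character k) = 0"
begin

lemma integral_mult_trigpoly_eq_0:
  assumes "trigpoly p"
  shows "integrable torus (\<lambda>x. f x * p x) \<and> (LINT x|torus. f x * p x) = 0"
  using assms
proof induction
  case (monomial c k)
  have *: "f x * (c * character k x) = c * (f x * cnj (character (- k) x))" for x
    by (simp add: cnj_character)
  show ?case
    unfolding * using orth[of "- k"] L2_mult_cnj_integrable[OF f character_L2, of "- k"]
    by (simp add: L2_ip_def)
next
  case (add p q)
  then show ?case by (simp add: distrib_left)
qed

lemma integral_mult_continuous_eq_0:
  fixes \<phi> :: "complex \<times> complex \<Rightarrow> real"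
  assumes \<phi>: "continuous_on UNIV \<phi>"
  shows "(LINT x|torus. f x * complex_of_real (\<phi> (torus_embedding x))) = 0"
proof -
  let ?C = "sphere 0 1 \<times> sphere (0::complex) 1 :: (complex \<times> complex) set"
  let ?\<phi> = "\<lambda>x. complex_of_real (\<phi> (torus_embedding x))"
  define J where "J = (LINT x|torus. cmod (f x))"
  have fi: "integrable torus f" using f by (rule L2_torus_integrable)
  have J: "0 \<le> J" unfolding J_def by (rule Bochner_Integration.integral_nonneg) simp
  have C: "compact ?C" by (intro compact_Times compact_sphere)
  have le: "cmod (LINT x|torus. f x * ?\<phi> x) \<le> e * J" if e: "0 < e" for e
  proof -
    obtain p where p: "real_polynomial_function p" "\<And>z. z \<in> ?C \<Longrightarrow> \<bar>\<phi> z - p z\<bar> < e"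
      using Stone_Weierstrass_real_polynomial_function[OF C continuous_on_subset[OF \<phi>] e] by auto
    let ?p = "\<lambda>x. complex_of_real (p (torus_embedding x))"
    have fp: "integrable torus (\<lambda>x. f x * ?p x)" "(LINT x|torus. f x * ?p x) = 0"
      using integral_mult_trigpoly_eq_0[OF trigpoly_real_polynomial[OF p(1)]] by auto
    have cp: "continuous_on UNIV p" using p(1)
      by (simp add: continuous_on_polymonial_function real_polynomial_function_eq)
    have b: "cmod (f x * (?\<phi> x - ?p x)) \<le> e * cmod (f x)" for x
      using p(2)[OF torus_embedding_range[of x]]
      by (simp add: norm_mult mult.commute[of e] flip: of_real_diff) (intro mult_left_mono, auto)
    have cont: "continuous_on UNIV (\<lambda>x. ?\<phi> x - ?p x)"
      by (intro continuous_intros continuous_on_compose2[OF \<phi>] continuous_on_compose2[OF cp]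
            torus_embedding_continuous) auto
    have d: "integrable torus (\<lambda>x. f x * (?\<phi> x - ?p x))"
    proof (rule Bochner_Integration.integrable_bound)
      show "integrable torus (\<lambda>x. e * cmod (f x))" using fi by simp
      show "(\<lambda>x. f x * (?\<phi> x - ?p x)) \<in> borel_measurable torus"
        by (intro borel_measurable_times borel_measurable_torus_continuous cont L2_measurable f)
      show "AE x in torus. norm (f x * (?\<phi> x - ?p x)) \<le> norm (e * cmod (f x))"
        using b e by (intro AE_I2) (simp add: abs_mult)
    qed
    have "(LINT x|torus. f x * ?\<phi> x) = (LINT x|torus. f x * (?\<phi> x - ?p x) + f x * ?p x)"
      by (simp add: algebra_simps)
    also have "\<dots> = (LINT x|torus. f x * (?\<phi> x - ?p x))"
      using d fp by simp
    also have "cmod \<dots> \<le> (LINT x|torus. cmod (f x * (?\<phi> x - ?p x)))" by simp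
    also have "\<dots> \<le> (LINT x|torus. e * cmod (f x))"
      using d fi b by (intro integral_mono) auto
    finally show ?thesis by (simp add: J_def)
  qed
  have "cmod (LINT x|torus. f x * ?\<phi> x) \<le> 0"
  proof (rule field_le_epsilon)
    fix d :: real assume d: "0 < d"
    have "cmod (LINT x|torus. f x * ?\<phi> x) \<le> d / (J + 1) * J" using d J by (intro le) simp
    also have "\<dots> \<le> d" using d J by (simp add: field_simps)
    finally show "cmod (LINT x|torus. f x * ?\<phi> x) \<le> 0 + d" by simp
  qed
  then show ?thesis by simp
qed

text \<open>
  The indicator function of a compact subset of the unit cell is a pointwise limit of continuous
  functions on the product of circles: the image of the set is compact, and the distance to the image
  vanishes exactly on the set because the embedding is injective.
\<close>

lemma integral_compact_eq_0:
  assumes K: "compact K" "K \<subseteq> unit_cell"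
  shows "(LINT x|torus. f x * indicator K x) = 0"
proof (cases "K = {}")
  case False
  let ?K = "torus_embedding ` K"
  have cK: "closed ?K"
    using K by (intro compact_imp_closed compact_continuous_image torus_embedding_continuous)
  define \<phi> where "\<phi> m z = max 0 (1 - real m * infdist z ?K)" for m :: nat and z
  have \<phi>c: "continuous_on UNIV (\<phi> m)" for m
    unfolding \<phi>_def by (intro continuous_intros)
  let ?\<phi> = "\<lambda>m x. complex_of_real (\<phi> m (torus_embedding x))"
  have lim: "(\<lambda>m. ?\<phi> m x) \<longlonglongrightarrow> indicator K x" if x: "x \<in> unit_cell" for x
  proof (cases "x \<in> K")
    case True
    then have "?\<phi> m x = 1" for m by (simp add: \<phi>_def)
    then show ?thesis using True by simp
  next
    case nK: False
    have "torus_embedding x \<notin> ?K"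
      using nK inj_on_image_mem_iff[OF torus_embedding_inj x K(2)] by simp
    then have pos: "0 < infdist (torus_embedding x) ?K"
      using cK False in_closed_iff_infdist_zero[OF cK] infdist_nonneg[of "torus_embedding x" ?K]
      by (metis image_is_empty less_eq_real_def)
    have "\<forall>\<^sub>F m in sequentially. ?\<phi> m x = 0"
    proof -
      obtain m0 :: nat where "1 / infdist (torus_embedding x) ?K < real m0"
        using reals_Archimedean2 by blast
      then have m0: "1 < real m0 * infdist (torus_embedding x) ?K" using pos by (simp add: field_simps)
      show ?thesis
        using eventually_ge_at_top[of m0]
      proof eventually_elim
        case (elim m)
        then have "real m0 * infdist (torus_embedding x) ?K \<le> real m * infdist (torus_embedding x) ?K"
          using pos by (intro mult_right_mono) auto
        then show ?case using m0 by (simp add: \<phi>_def)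
      qed
    qed
    then show ?thesis using nK by (simp add: tendsto_eventually)
  qed
  have "K \<in> sets lebesgue" using compact_imp_closed[OF K(1)] by auto
  then have "K \<in> sets torus" using K(2) by (simp add: sets_torus_iff)
  then have ind: "(indicator K :: _ \<Rightarrow> complex) \<in> borel_measurable torus"
    by (rule borel_measurable_indicator)
  have "(\<lambda>m. LINT x|torus. f x * ?\<phi> m x) \<longlonglongrightarrow> (LINT x|torus. f x * indicator K x)"
  proof (rule integral_dominated_convergence)
    show "(\<lambda>x. f x * indicator K x) \<in> borel_measurable torus"
      using ind L2_measurable[OF f] by measurable
    show "(\<lambda>x. f x * ?\<phi> m x) \<in> borel_measurable torus" for m
      by (intro borel_measurable_times borel_measurable_torus_continuous L2_measurable f
            continuous_intros continuous_on_compose2[OF \<phi>c] torus_embedding_continuous) auto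
    show "integrable torus (\<lambda>x. cmod (f x))" using L2_torus_integrable[OF f] by simp
    show "AE x in torus. (\<lambda>m. f x * ?\<phi> m x) \<longlonglongrightarrow> f x * indicator K x"
      by (intro AE_I2 tendsto_mult_left lim) (simp add: space_torus)
    have "cmod (?\<phi> m x) \<le> 1" for m x by (simp add: \<phi>_def infdist_nonneg)
    then show "AE x in torus. norm (f x * ?\<phi> m x) \<le> cmod (f x)" for m
      by (intro AE_I2) (simp add: norm_mult mult_left_le)
  qed
  then show ?thesis
    by (simp add: integral_mult_continuous_eq_0[OF \<phi>c] LIMSEQ_const_iff)
qed simp

end

text \<open>
  If the function were positive on a set of positive measure, then by inner regularity it would be
  positive on a compact set of positive measure, and its integral over that set could not vanish.
\<close>

lemma AE_torus_nonpos:
  fixes g :: "real \<times> real \<Rightarrow> real"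
  assumes g: "integrable torus g"
    and K: "\<And>K. compact K \<Longrightarrow> K \<subseteq> unit_cell \<Longrightarrow> (LINT x|torus. g x * indicator K x) = 0"
  shows "AE x in torus. g x \<le> 0"
proof -
  define A where "A = {x \<in> space torus. 0 < g x}"
  have [measurable]: "g \<in> borel_measurable torus" using g by (rule borel_measurable_integrable)
  have At: "A \<in> sets torus" unfolding A_def by measurable
  then have AQ: "A \<subseteq> unit_cell" and A: "A \<in> sets lebesgue" by (auto simp: sets_torus_iff)
  have "emeasure torus A = 0"
  proof (rule ccontr)
    assume nz: "emeasure torus A \<noteq> 0"
    define e where "e = measure torus A"
    have e: "emeasure torus A = ennreal e"
      unfolding e_def by (rule finite_measure.emeasure_eq_measure[OF finite_measure_torus])
    have "e \<noteq> 0" using nz e by auto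
    then have e0: "0 < e" by (simp add: e_def zero_less_measure_iff)
    obtain K' where K': "closed K'" "K' \<subseteq> A" "emeasure lebesgue (A - K') < ennreal e"
      by (rule sets_lebesgue_inner_closed[OF A e0])
    have "bounded ({-1/2..1/2::real} \<times> {-1/2..1/2::real})"
      by (intro bounded_Times) simp_all
    moreover have "K' \<subseteq> {-1/2..1/2} \<times> {-1/2..1/2}"
      using K'(2) AQ by (fastforce simp: unit_cell_def)
    ultimately have cK: "compact K'"
      using K'(1) by (auto simp: compact_eq_bounded_closed intro: bounded_subset)
    have Kt: "K' \<in> sets torus" using K' AQ by (auto simp: sets_torus_iff)
    have "(LINT x|torus. g x * indicator K' x) = 0" using cK K' AQ by (intro K) auto
    moreover have "integrable torus (\<lambda>x. g x * indicator K' x)"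
      using integrable_real_mult_indicator[OF Kt g] .
    moreover have "AE x in torus. 0 \<le> g x * indicator K' x"
      using K'(2) by (intro AE_I2) (auto simp: A_def indicator_def less_imp_le)
    ultimately have "AE x in torus. g x * indicator K' x = 0"
      by (simp add: integral_nonneg_eq_0_iff_AE)
    then have "AE x in torus. x \<notin> K'"
      by eventually_elim (use K'(2) in \<open>auto simp: A_def indicator_def split: if_splits\<close>)
    then have "K' \<in> null_sets torus" by (simp only: AE_iff_null_sets[OF Kt])
    then have "emeasure torus K' = 0" by (rule null_setsD1)
    moreover have "emeasure torus A \<le> emeasure torus (A - K') + emeasure torus K'"
      using emeasure_subadditive[of "A - K'" torus K'] At Kt K'(2) by (simp add: Un_absorb2)
    moreover have "emeasure torus (A - K') < ennreal e"
      using K'(3) At Kt by (simp add: emeasure_torus)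
    ultimately show False using e by simp
  qed
  then have "A \<in> null_sets torus" using At by (simp add: null_sets_def)
  then have "AE x in torus. x \<notin> A" by (rule AE_not_in)
  moreover have "AE x in torus. x \<in> space torus" by (rule AE_space)
  ultimately show ?thesis by eventually_elim (auto simp: A_def)
qed

theorem character_total:
  assumes f: "f \<in> L2 torus" and orth: "\<And>k. L2_ip torus f (character k) = 0"
  shows "AE x in torus. f x = 0"
proof -
  have fi: "integrable torus f" using f by (rule L2_torus_integrable)
  have K0: "(LINT x|torus. f x * indicator K x) = 0" if "compact K" "K \<subseteq> unit_cell" for K
    by (rule integral_compact_eq_0[OF f orth that])
  have int: "integrable torus (\<lambda>x. f x * indicator K x)" if "compact K" "K \<subseteq> unit_cell" for K
  proof -
    have "K \<in> sets lebesgue" using compact_imp_closed[OF that(1)] by auto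
    then have "K \<in> sets torus" using that(2) by (simp add: sets_torus_iff)
    with fi show ?thesis by (rule integrable_times_indicator)
  qed
  have zero: "(LINT x|torus. L (f x) * indicator K x) = 0"
    if K: "compact K" "K \<subseteq> unit_cell" and L: "bounded_linear L" for K and L :: "complex \<Rightarrow> real"
  proof -
    interpret L: bounded_linear L by fact
    have "L (f x) * indicator K x = L (f x * indicator K x)" for x
      by (simp add: indicator_def L.zero)
    then show ?thesis
      using integral_bounded_linear[OF L int[OF K]] K0[OF K] by (simp add: L.zero)
  qed
  have nonpos: "AE x in torus. L (f x) \<le> 0" if L: "bounded_linear L" for L :: "complex \<Rightarrow> real"
    using integrable_bounded_linear[OF L fi] zero[OF _ _ L] by (rule AE_torus_nonpos)
  have "AE x in torus. Re (f x) \<le> 0" "AE x in torus. - Re (f x) \<le> 0"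
    "AE x in torus. Im (f x) \<le> 0" "AE x in torus. - Im (f x) \<le> 0"
    by (intro nonpos bounded_linear_Re bounded_linear_Im bounded_linear_minus)+
  then show ?thesis by eventually_elim (simp add: complex_eq_iff)
qed

section \<open>The Fourier transform\<close>

lemma L2_on_UNIV: "L2_on M UNIV = L2 M"
  by (auto simp: L2_on_def)

lemma bij_nat_int_times_int: obtains e :: "nat \<Rightarrow> int \<times> int" where "bij e"
proof -
  have "infinite (UNIV :: (int \<times> int) set)" by (simp add: finite_prod infinite_UNIV_int)
  then have "bij (from_nat_into (UNIV :: (int \<times> int) set))"
    by (intro bij_betw_from_nat_into) auto
  then show ?thesis by (rule that)
qed

lemma orthonormal_reindex:
  assumes "orthonormal M e" "inj h" shows "orthonormal M (\<lambda>n. e (h n))"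
  using assms unfolding orthonormal_def by (metis injD)

lemma orthonormal_basis_character:
  assumes e: "bij e"
  shows "orthonormal_basis torus (L2 torus) (\<lambda>n. character (e n))"
proof -
  have "orthonormal_basis torus (L2_on torus UNIV) (\<lambda>n. character (e n))"
  proof (rule orthonormal_basis_if_total)
    show "orthonormal torus (\<lambda>n. character (e n))"
      by (rule orthonormal_reindex[OF orthonormal_character bij_is_inj[OF e]])
    fix g assume g: "g \<in> L2_on torus UNIV" and orth: "\<And>n. L2_ip torus g (character (e n)) = 0"
    have "L2_ip torus g (character k) = 0" for k
      using orth[of "inv e k"] surj_f_inv_f[OF bij_is_surj[OF e]] by simp
    then show "AE x in torus. g x = 0" using g by (intro character_total) (simp_all add: L2_on_UNIV)
  qed (simp_all add: L2_on_UNIV character_L2)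
  then show ?thesis by (simp add: L2_on_UNIV)
qed

text \<open>
  All terms are nonnegative, so Parseval's identity for one enumeration of the frequencies is a
  statement about unordered sums, as the definition of the Fourier transform requires.
\<close>

lemma has_sum_character_coeffs:
  assumes g: "g \<in> L2 torus"
  shows "((\<lambda>k. (cmod (L2_ip torus g (character k)))\<^sup>2) has_sum (L2_norm torus g)\<^sup>2) UNIV"
proof -
  obtain e :: "nat \<Rightarrow> int \<times> int" where e: "bij e" by (rule bij_nat_int_times_int)
  have "(\<lambda>n. (cmod (L2_ip torus g (character (e n))))\<^sup>2) sums (L2_norm torus g)\<^sup>2"
    using orthonormal_basis_character[OF e] g unfolding orthonormal_basis_iff_parseval[OF subset_refl]
    by blast
  then have "((\<lambda>n. (cmod (L2_ip torus g (character (e n))))\<^sup>2) has_sum (L2_norm torus g)\<^sup>2) UNIV"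
    by (rule sums_nonneg_imp_has_sum) simp
  then show ?thesis
    using has_sum_reindex_bij_betw[OF e, of "\<lambda>k. (cmod (L2_ip torus g (character k)))\<^sup>2"] by simp
qed

lemma fourier_series_lim:
  assumes g: "g \<in> L2 torus"
  shows "L2_lim torus (finite_subsets_at_top UNIV)
           (\<lambda>K \<xi>. \<Sum>k\<in>K. L2_ip torus g (character k) * character k \<xi>) g"
proof -
  let ?u = "\<lambda>K \<xi>. \<Sum>k\<in>K. L2_ip torus g (character k) * character k \<xi>"
  have "((\<lambda>K. (L2_norm torus g)\<^sup>2 - (\<Sum>k\<in>K. (cmod (L2_ip torus g (character k)))\<^sup>2)) \<longlongrightarrow>
          (L2_norm torus g)\<^sup>2 - (L2_norm torus g)\<^sup>2) (finite_subsets_at_top UNIV)"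
    using has_sum_character_coeffs[OF g] unfolding has_sum_def by (intro tendsto_intros)
  moreover have "\<forall>\<^sub>F K in finite_subsets_at_top UNIV.
      (L2_norm torus g)\<^sup>2 - (\<Sum>k\<in>K. (cmod (L2_ip torus g (character k)))\<^sup>2)
      = (L2_norm torus (\<lambda>\<xi>. ?u K \<xi> - g \<xi>))\<^sup>2"
    using eventually_finite_subsets_at_top_weakI[of UNIV]
    by (rule eventually_mono) (auto simp: orthonormal_expansion_dist[OF orthonormal_character g])
  ultimately have "((\<lambda>K. (L2_norm torus (\<lambda>\<xi>. ?u K \<xi> - g \<xi>))\<^sup>2) \<longlongrightarrow> 0) (finite_subsets_at_top UNIV)"
    unfolding diff_self by (rule Lim_transform_eventually)
  then have "((\<lambda>K. L2_norm torus (\<lambda>\<xi>. ?u K \<xi> - g \<xi>)) \<longlongrightarrow> 0) (finite_subsets_at_top UNIV)"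
    by simp
  then show ?thesis
    using g by (simp add: L2_lim_def L2_lincomb character_L2)
qed

lemma
  assumes e: "bij (e :: nat \<Rightarrow> int \<times> int)" and f: "f \<in> L2 ell2"
  shows ell2_summable: "summable (\<lambda>n. (cmod (f (e n)))\<^sup>2)"
    and ell2_ip_sums: "g \<in> L2 ell2 \<Longrightarrow> (\<lambda>n. f (e n) * cnj (g (e n))) sums L2_ip ell2 f g"
proof -
  have e': "bij_betw e UNIV UNIV" by (rule e)
  have "integrable ell2 (\<lambda>k. (cmod (f k))\<^sup>2)" using f by (rule L2_square_integrable)
  then have "integrable (count_space UNIV) (\<lambda>n. (cmod (f (e n)))\<^sup>2)"
    using integrable_bij_count_space[OF e', of "\<lambda>k. (cmod (f k))\<^sup>2"] by simp
  then show "summable (\<lambda>n. (cmod (f (e n)))\<^sup>2)" by (simp add: integrable_count_space_nat_iff)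
  assume "g \<in> L2 ell2"
  then have "integrable ell2 (\<lambda>k. f k * cnj (g k))" using f by (intro L2_mult_cnj_integrable)
  then have "integrable (count_space UNIV) (\<lambda>n. f (e n) * cnj (g (e n)))"
    using integrable_bij_count_space[OF e', of "\<lambda>k. f k * cnj (g k)"] by simp
  then show "(\<lambda>n. f (e n) * cnj (g (e n))) sums L2_ip ell2 f g"
    using sums_integral_count_space_nat integral_bij_count_space[OF e', of "\<lambda>k. f k * cnj (g k)"]
    unfolding L2_ip_def by metis
qed

lemma
  assumes f: "f \<in> L2 ell2"
  shows fourier_L2: "fourier f \<in> L2 torus"
    and fourier_coeff: "L2_ip torus (fourier f) (character k) = f k"
proof -
  let ?u = "\<lambda>K \<xi>. \<Sum>k\<in>K. f k * character k \<xi>"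
  obtain e :: "nat \<Rightarrow> int \<times> int" where e: "bij e" by (rule bij_nat_int_times_int)
  have on: "orthonormal torus (\<lambda>n. character (e n))"
    by (rule orthonormal_reindex[OF orthonormal_character bij_is_inj[OF e]])
  obtain g where g: "L2_lim torus sequentially (\<lambda>N x. \<Sum>n<N. f (e n) * character (e n) x) g"
    "\<And>n. L2_ip torus g (character (e n)) = f (e n)"
    using riesz_fischer[OF on ell2_summable[OF e f]] by blast
  have gL: "g \<in> L2 torus" using g(1) by (simp add: L2_lim_def)
  have gk: "L2_ip torus g (character k) = f k" for k
    using g(2)[of "inv e k"] surj_f_inv_f[OF bij_is_surj[OF e]] by simp
  have lim: "L2_lim torus (finite_subsets_at_top UNIV) ?u g"
    using fourier_series_lim[OF gL] by (simp add: gk)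
  then have lim': "L2_lim torus (finite_subsets_at_top UNIV) ?u (fourier f)"
    unfolding fourier_def by (rule someI[of "L2_lim torus (finite_subsets_at_top UNIV) ?u"])
  then show L: "fourier f \<in> L2 torus" by (simp add: L2_lim_def)
  have "AE x in torus. fourier f x = g x"
    using L2_lim_unique[OF lim' lim] by simp
  then have "L2_ip torus (fourier f) (character k) = L2_ip torus g (character k)"
    using L gL character_L2 by (intro L2_ip_AE_cong) auto
  then show "L2_ip torus (fourier f) (character k) = f k" by (simp add: gk)
qed

theorem fourier_unitary: "L2_unitary ell2 (L2 ell2) torus (L2 torus) fourier"
  unfolding L2_unitary_def
proof (intro conjI ballI subset_refl)
  obtain e :: "nat \<Rightarrow> int \<times> int" where e: "bij e" by (rule bij_nat_int_times_int)
  show "fourier f \<in> L2 torus" if "f \<in> L2 ell2" for f using that by (rule fourier_L2)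
  show "L2_ip torus (fourier f) (fourier g) = L2_ip ell2 f g" if "f \<in> L2 ell2" "g \<in> L2 ell2" for f g
    using orthonormal_basis_sums_ip[OF subset_refl orthonormal_basis_character[OF e] fourier_L2[OF that(1)] fourier_L2[OF that(2)]]
      ell2_ip_sums[OF e that]
    unfolding fourier_coeff[OF that(1)] fourier_coeff[OF that(2)] by (rule sums_unique2)
  fix h assume h: "h \<in> L2 torus"
  let ?f = "\<lambda>k. L2_ip torus h (character k)"
  have "summable (\<lambda>n. (cmod (?f (e n)))\<^sup>2)"
    using orthonormal_basis_character[OF e] h
    unfolding orthonormal_basis_iff_parseval[OF subset_refl] by (auto simp: sums_iff)
  then have "integrable (count_space UNIV) (\<lambda>n. (cmod (?f (e n)))\<^sup>2)"
    by (simp add: integrable_count_space_nat_iff)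
  then have "integrable ell2 (\<lambda>k. (cmod (?f k))\<^sup>2)"
    using integrable_bij_count_space[of e UNIV UNIV "\<lambda>k. (cmod (?f k))\<^sup>2"] e by simp
  then have f: "?f \<in> L2 ell2" by (simp add: L2_iff)
  have "AE x in torus. fourier ?f x - h x = 0"
  proof (rule character_total)
    show "(\<lambda>x. fourier ?f x - h x) \<in> L2 torus" by (intro L2_diff fourier_L2 f h)
    show "L2_ip torus (\<lambda>x. fourier ?f x - h x) (character k) = 0" for k
      by (simp add: L2_ip_diff_left fourier_L2 f h character_L2 fourier_coeff)
  qed
  then have "AE x in torus. fourier ?f x = h x" by eventually_elim simp
  then show "\<exists>f\<in>L2 ell2. AE x in torus. fourier f x = h x" using f by blast
qed

section \<open>The piecewise translation\<close>

text \<open>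
  Modulo the lattice, both translations in the definition of \<open>P\<close> are this one.
\<close>

definition half_shift :: "real \<times> real \<Rightarrow> real \<times> real" where
  "half_shift x = wrap (x + (1/2, 1/2))"

definition E23 :: "(real \<times> real) set" where
  "E23 = D2 \<union> D3"

text \<open>
  The complement of the lines that contain, on the torus, the boundaries of the regions and of their
  translates. On it, membership in each region is decided by strict inequalities.
\<close>

definition generic :: "real \<times> real \<Rightarrow> bool" where
  "generic x \<longleftrightarrow> fst x \<noteq> 0 \<and> fst x \<noteq> -1/2 \<and> \<bar>fst x\<bar> + \<bar>snd x\<bar> \<noteq> 1/2"

lemma AE_torus_not_line:
  assumes "a \<noteq> 0 \<or> b \<noteq> 0"
  shows "AE x in torus. a * fst x + b * snd x \<noteq> c"
proof -
  have "negligible {x :: real \<times> real. (a, b) \<bullet> x = c}"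
    using assms by (intro negligible_hyperplane) (auto simp: zero_prod_def)
  then have N: "{x :: real \<times> real. (a, b) \<bullet> x = c} \<in> null_sets lebesgue"
    by (simp only: negligible_iff_null_sets)
  then have "AE x in lebesgue. x \<notin> {x :: real \<times> real. (a, b) \<bullet> x = c}" by (rule AE_not_in)
  then have "AE x in lebesgue. x \<in> unit_cell \<longrightarrow> a * fst x + b * snd x \<noteq> c"
    by eventually_elim (auto simp: inner_prod_def)
  then show ?thesis
    unfolding torus_def unit_cell_def[symmetric]
    by (subst AE_restrict_space_iff) (simp_all add: unit_cell_lebesgue)
qed

lemma AE_generic: "AE x in torus. x \<in> unit_cell \<and> generic x"
proof -
  have "AE x in torus. 1 * fst x + 0 * snd x \<noteq> 0" "AE x in torus. 1 * fst x + 0 * snd x \<noteq> -1/2"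
    "AE x in torus. 1 * fst x + 1 * snd x \<noteq> 1/2" "AE x in torus. 1 * fst x + 1 * snd x \<noteq> -1/2"
    "AE x in torus. 1 * fst x + (-1) * snd x \<noteq> 1/2" "AE x in torus. 1 * fst x + (-1) * snd x \<noteq> -1/2"
    by (rule AE_torus_not_line; simp)+
  moreover have "AE x in torus. x \<in> unit_cell" using AE_space[of torus] by (simp add: space_torus)
  ultimately show ?thesis by eventually_elim (auto simp: generic_def abs_if)
qed

lemma mem_unit_cell: "(x, y) \<in> unit_cell \<longleftrightarrow> -1/2 \<le> x \<and> x < 1/2 \<and> -1/2 \<le> y \<and> y < 1/2"
  by (auto simp: unit_cell_def)

lemma half_shift_eq:
  assumes "(x, y) \<in> unit_cell"
  shows "half_shift (x, y) = (if x < 0 then x + 1/2 else x - 1/2, if y < 0 then y + 1/2 else y - 1/2)"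
  unfolding half_shift_def wrap_eq_iff
proof (intro conjI exI)
  show "(x, y) + (1/2, 1/2) = (if x < 0 then x + 1/2 else x - 1/2, if y < 0 then y + 1/2 else y - 1/2)
      + lattice (if x < 0 then 0 else 1, if y < 0 then 0 else 1)"
    by (simp add: lattice_def)
qed (use assms in \<open>auto simp: mem_unit_cell\<close>)

lemma half_shift_in_unit_cell: "half_shift x \<in> unit_cell"
  unfolding half_shift_def by (rule wrap_in_unit_cell)

lemma half_shift_half_shift: "x \<in> unit_cell \<Longrightarrow> half_shift (half_shift x) = x"
proof -
  assume x: "x \<in> unit_cell"
  have "half_shift (half_shift x) = wrap (x + lattice (1, 1))"
    by (simp add: half_shift_def wrap_wrap_add lattice_def add.assoc)
  then show ?thesis using x by (simp only: wrap_add_lattice wrap_ident)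
qed

lemma wrap_image_eq:
  assumes "\<And>z. z \<in> A \<Longrightarrow> wrap z \<in> B" "\<And>w. w \<in> B \<Longrightarrow> \<exists>z\<in>A. wrap z = w"
  shows "wrap ` A = B"
proof (intro equalityI subsetI)
  show "w \<in> wrap ` A" if "w \<in> B" for w using assms(2)[OF that] by blast
qed (use assms(1) in blast)

lemma wrap_pair_ident: "-1/2 \<le> x \<Longrightarrow> x < 1/2 \<Longrightarrow> -1/2 \<le> y \<Longrightarrow> y < 1/2 \<Longrightarrow> wrap (x, y) = (x, y)"
  by (intro wrap_ident) (simp add: mem_unit_cell)

lemma wrap_fst_half: "-1/2 \<le> y \<Longrightarrow> y < 1/2 \<Longrightarrow> wrap (1/2, y) = (-1/2, y)"
  unfolding wrap_eq_iff by (intro conjI exI[of _ "(1, 0)"]) (auto simp: mem_unit_cell lattice_def)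

lemma wrap_snd_half: "-1/2 \<le> x \<Longrightarrow> x < 1/2 \<Longrightarrow> wrap (x, 1/2) = (x, -1/2)"
  unfolding wrap_eq_iff by (intro conjI exI[of _ "(0, 1)"]) (auto simp: mem_unit_cell lattice_def)

lemma D_eq: "D = {-1/2..0} \<times> {-1/2..<1/2}"
  unfolding D_def
proof (rule wrap_image_eq)
  fix z :: "real \<times> real" assume "z \<in> {-1/2..0} \<times> {-1/2..1/2}"
  then obtain x y where "z = (x, y)" "-1/2 \<le> x" "x \<le> 0" "-1/2 \<le> y" "y \<le> 1/2" by auto
  then show "wrap z \<in> {-1/2..0} \<times> {-1/2..<1/2}"
    by (cases "y = 1/2") (simp_all add: wrap_snd_half wrap_pair_ident)
next
  fix w :: "real \<times> real" assume "w \<in> {-1/2..0} \<times> {-1/2..<1/2}"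
  then show "\<exists>z\<in>{-1/2..0} \<times> {-1/2..1/2}. wrap z = w"
    by (intro bexI[of _ w]) (auto simp: wrap_pair_ident)
qed

lemma D1_eq: "D1 = {(x, y). -1/2 < x \<and> x < 0 \<and> \<bar>y\<bar> < x + 1/2}"
  unfolding D1_def
proof (rule wrap_image_eq)
  fix z :: "real \<times> real" assume "z \<in> {(x, y). -1/2 < x \<and> x < 0 \<and> -x - 1/2 < y \<and> y < x + 1/2}"
  then show "wrap z \<in> {(x, y). -1/2 < x \<and> x < 0 \<and> \<bar>y\<bar> < x + 1/2}"
    by (auto simp: wrap_pair_ident)
next
  fix w :: "real \<times> real" assume "w \<in> {(x, y). -1/2 < x \<and> x < 0 \<and> \<bar>y\<bar> < x + 1/2}"
  then show "\<exists>z\<in>{(x, y). -1/2 < x \<and> x < 0 \<and> -x - 1/2 < y \<and> y < x + 1/2}. wrap z = w"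
    by (intro bexI[of _ w]) (auto simp: wrap_pair_ident)
qed

lemma D2_eq: "D2 = {(x, y). 0 \<le> x \<and> x < 1/2 \<and> 0 \<le> y \<and> y < 1/2 \<and> x + y \<le> 1/2} \<union> {(-1/2, 0), (0, -1/2)}"
  unfolding D2_def
proof (rule wrap_image_eq)
  fix z :: "real \<times> real" assume "z \<in> {(x, y). 0 \<le> x \<and> x \<le> 1/2 \<and> 0 \<le> y \<and> y \<le> -x + 1/2}"
  then obtain x y where z: "z = (x, y)" "0 \<le> x" "x \<le> 1/2" "0 \<le> y" "y \<le> -x + 1/2" by auto
  consider "x = 1/2" "y = 0" | "y = 1/2" "x = 0" | "x < 1/2" "y < 1/2" using z by linarith
  then show "wrap z \<in> {(x, y). 0 \<le> x \<and> x < 1/2 \<and> 0 \<le> y \<and> y < 1/2 \<and> x + y \<le> 1/2} \<union> {(-1/2, 0), (0, -1/2)}"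
  proof cases
    case 1
    then have "wrap z = (-1/2, 0)" unfolding z(1) by (simp only:) (rule wrap_fst_half; simp)
    then show ?thesis by simp
  next
    case 2
    then have "wrap z = (0, -1/2)" unfolding z(1) by (simp only:) (rule wrap_snd_half; simp)
    then show ?thesis by simp
  next
    case 3
    then have "wrap z = z" using z by (simp add: wrap_pair_ident)
    then show ?thesis using 3 z by auto
  qed
next
  fix w :: "real \<times> real" assume w: "w \<in> {(x, y). 0 \<le> x \<and> x < 1/2 \<and> 0 \<le> y \<and> y < 1/2 \<and> x + y \<le> 1/2} \<union> {(-1/2, 0), (0, -1/2)}"
  then consider "w = (-1/2, 0)" | "w = (0, -1/2)" | "w \<in> {(x, y). 0 \<le> x \<and> x < 1/2 \<and> 0 \<le> y \<and> y < 1/2 \<and> x + y \<le> 1/2}"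
    by auto
  then show "\<exists>z\<in>{(x, y). 0 \<le> x \<and> x \<le> 1/2 \<and> 0 \<le> y \<and> y \<le> -x + 1/2}. wrap z = w"
  proof cases
    case 1
    then show ?thesis by (intro bexI[of _ "(1/2, 0)"]) (auto simp: wrap_fst_half)
  next
    case 2
    then show ?thesis by (intro bexI[of _ "(0, 1/2)"]) (auto simp: wrap_snd_half)
  next
    case 3
    then show ?thesis by (intro bexI[of _ w]) (auto simp: wrap_pair_ident)
  qed
qed

lemma D3_eq: "D3 = {(x, y). 0 \<le> x \<and> x < 1/2 \<and> x - 1/2 \<le> y \<and> y < 0}"
  unfolding D3_def
proof (rule wrap_image_eq)
  fix z :: "real \<times> real" assume "z \<in> {(x, y). 0 \<le> x \<and> x \<le> 1/2 \<and> x - 1/2 \<le> y \<and> y < 0}"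
  then show "wrap z \<in> {(x, y). 0 \<le> x \<and> x < 1/2 \<and> x - 1/2 \<le> y \<and> y < 0}"
    by (auto simp: wrap_pair_ident)
next
  fix w :: "real \<times> real" assume "w \<in> {(x, y). 0 \<le> x \<and> x < 1/2 \<and> x - 1/2 \<le> y \<and> y < 0}"
  then show "\<exists>z\<in>{(x, y). 0 \<le> x \<and> x \<le> 1/2 \<and> x - 1/2 \<le> y \<and> y < 0}. wrap z = w"
    by (intro bexI[of _ w]) (auto simp: wrap_pair_ident)
qed

lemma E23_eq: "E23 = {(x, y). 0 \<le> x \<and> x + \<bar>y\<bar> \<le> 1/2} \<inter> unit_cell \<union> {(-1/2, 0)}"
  unfolding E23_def D2_eq D3_eq by (auto simp: mem_unit_cell)

lemma Omega2_eq: "Omega2 = {\<xi> \<in> space torus. \<bar>fst \<xi>\<bar> + \<bar>snd \<xi>\<bar> \<le> 1/2}"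
proof -
  have "(sin (pi * x))\<^sup>2 + (sin (pi * y))\<^sup>2 \<le> 1 \<longleftrightarrow> \<bar>x\<bar> + \<bar>y\<bar> \<le> 1/2"
    if x: "-1/2 \<le> x" "x < 1/2" and y: "-1/2 \<le> y" "y < 1/2" for x y :: real
  proof -
    have ax: "0 \<le> pi * \<bar>x\<bar>" "pi * \<bar>x\<bar> \<le> pi / 2" and ay: "0 \<le> pi * \<bar>y\<bar>" "pi * \<bar>y\<bar> \<le> pi / 2"
      using x y by (auto simp: abs_if)
    have sx: "(sin (pi * x))\<^sup>2 = (sin (pi * \<bar>x\<bar>))\<^sup>2" and sy: "(sin (pi * y))\<^sup>2 = (sin (pi * \<bar>y\<bar>))\<^sup>2"
      by (simp_all add: abs_if)
    have "(sin (pi * \<bar>x\<bar>))\<^sup>2 + (sin (pi * \<bar>y\<bar>))\<^sup>2 \<le> 1 \<longleftrightarrow> (sin (pi * \<bar>x\<bar>))\<^sup>2 \<le> (cos (pi * \<bar>y\<bar>))\<^sup>2"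
      using sin_cos_squared_add[of "pi * \<bar>y\<bar>"] by linarith
    also have "\<dots> \<longleftrightarrow> sin (pi * \<bar>x\<bar>) \<le> cos (pi * \<bar>y\<bar>)"
    proof (rule power_mono_iff)
      show "0 \<le> sin (pi * \<bar>x\<bar>)" using ax pi_gt_zero by (intro sin_ge_zero) linarith+
      show "0 \<le> cos (pi * \<bar>y\<bar>)" using ay pi_gt_zero by (intro cos_ge_zero) linarith+
    qed simp
    also have "\<dots> \<longleftrightarrow> sin (pi * \<bar>x\<bar>) \<le> sin (pi / 2 - pi * \<bar>y\<bar>)"
      by (simp add: cos_sin_eq)
    also have "\<dots> \<longleftrightarrow> pi * \<bar>x\<bar> \<le> pi / 2 - pi * \<bar>y\<bar>"
      using ax ay pi_gt_zero by (intro sin_mono_le_eq) linarith+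
    also have "\<dots> \<longleftrightarrow> pi * (\<bar>x\<bar> + \<bar>y\<bar>) \<le> pi * (1/2)" by (simp add: algebra_simps)
    also have "\<dots> \<longleftrightarrow> \<bar>x\<bar> + \<bar>y\<bar> \<le> 1/2" using pi_gt_zero by (simp only: mult_le_cancel_left_pos)
    finally show ?thesis by (simp only: sx sy)
  qed
  then show ?thesis by (auto simp: Omega2_def space_torus mem_unit_cell)
qed

lemma P_D1: "x \<in> D1 \<Longrightarrow> P x = x"
  by (simp add: P_def)

lemma D1_E23_disjoint: "D1 \<inter> E23 = {}"
  unfolding D1_eq E23_eq by auto

lemma E23_subset: "E23 \<subseteq> unit_cell" and D1_subset: "D1 \<subseteq> unit_cell"
  unfolding D1_eq E23_eq by (auto simp: mem_unit_cell)

lemma P_E23: "x \<in> E23 \<Longrightarrow> P x = half_shift x"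
proof -
  assume x: "x \<in> E23"
  have "x + (-1/2, -1/2) + lattice (1, 1) = x + (1/2, 1/2)" "x + (-1/2, 1/2) + lattice (1, 0) = x + (1/2, 1/2)"
    by (simp_all add: lattice_def prod_eq_iff)
  then have "wrap (x + (-1/2, -1/2)) = half_shift x" "wrap (x + (-1/2, 1/2)) = half_shift x"
    unfolding half_shift_def using wrap_add_lattice by metis+
  moreover have "x \<notin> D1" using x D1_E23_disjoint by blast
  ultimately show ?thesis by (simp add: P_def)
qed

lemma P_image: "P ` (D1 \<union> D2 \<union> D3) = D1 \<union> half_shift ` E23"
proof -
  have "P ` D1 = D1" using P_D1 by simp
  moreover have "P ` E23 = half_shift ` E23" using P_E23 by simp
  moreover have "D1 \<union> D2 \<union> D3 = D1 \<union> E23" by (auto simp: E23_def)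
  ultimately show ?thesis by (simp add: image_Un)
qed

lemma half_shift_image_E23: "half_shift ` E23 = {x \<in> unit_cell. half_shift x \<in> E23}"
proof (intro set_eqI iffI)
  fix y assume "y \<in> half_shift ` E23"
  then obtain x where "x \<in> E23" "y = half_shift x" by blast
  then show "y \<in> {x \<in> unit_cell. half_shift x \<in> E23}"
    using E23_subset half_shift_half_shift[of x] half_shift_in_unit_cell by auto
next
  fix y assume "y \<in> {x \<in> unit_cell. half_shift x \<in> E23}"
  then show "y \<in> half_shift ` E23" using half_shift_half_shift[of y] by force
qed

lemma half_shift_E23_D1_disjoint: "D1 \<inter> half_shift ` E23 = {}"
proof -
  have False if "(x, y) \<in> D1" "half_shift (x, y) \<in> E23" for x y
  proof -
    have "(x, y) \<in> unit_cell" using that(1) D1_subset by blast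
    then show False
      using that half_shift_eq[of x y] unfolding D1_eq E23_eq by (auto split: if_splits)
  qed
  then show ?thesis unfolding half_shift_image_E23 by auto
qed

lemma P_inj: "inj_on P (D1 \<union> D2 \<union> D3)"
proof -
  have 1: "inj_on P D1" by (rule inj_onI) (simp add: P_D1)
  have 2: "inj_on P E23"
  proof (rule inj_onI)
    fix x y assume xy: "x \<in> E23" "y \<in> E23" "P x = P y"
    then have "half_shift (half_shift x) = half_shift (half_shift y)" by (simp add: P_E23)
    moreover have "half_shift (half_shift x) = x" "half_shift (half_shift y) = y"
      using xy E23_subset by (intro half_shift_half_shift; blast)+
    ultimately show "x = y" by simp
  qed
  have "P ` D1 \<inter> P ` E23 = {}" using half_shift_E23_D1_disjoint by (simp add: P_D1 P_E23 cong: image_cong)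
  then have "inj_on P (D1 \<union> E23)" using 1 2 by (auto simp: inj_on_Un)
  moreover have "D1 \<union> D2 \<union> D3 = D1 \<union> E23" by (auto simp: E23_def)
  ultimately show ?thesis by simp
qed

lemma half_shift_E23_subset_D: "half_shift ` E23 \<subseteq> D"
proof
  fix z assume "z \<in> half_shift ` E23"
  then obtain x y where z: "(x, y) \<in> E23" "z = half_shift (x, y)" by auto
  then have "(x, y) \<in> unit_cell" using E23_subset by blast
  then show "z \<in> D"
    using z half_shift_eq[of x y] unfolding D_eq E23_eq by (auto simp: mem_unit_cell)
qed

lemma D1_subset_D: "D1 \<subseteq> D"
  unfolding D1_eq D_eq by (auto simp: abs_if split: if_splits)

lemma S_eq:
  assumes "x \<in> unit_cell"
  shows "S g x = (if x \<in> D1 then g x else if half_shift x \<in> E23 then g (half_shift x) else 0)"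
proof -
  let ?E = "D1 \<union> D2 \<union> D3"
  have E: "?E = D1 \<union> E23" by (auto simp: E23_def)
  consider "x \<in> D1" | "x \<notin> D1" "half_shift x \<in> E23" | "x \<notin> D1" "half_shift x \<notin> E23" by blast
  then show ?thesis
  proof cases
    case 1
    then have "inv_into ?E P x = x"
      using inv_into_f_f[OF P_inj, of x] by (simp add: P_D1)
    then show ?thesis using 1 D1_subset_D by (auto simp: S_def P_image)
  next
    case 2
    then have "P (half_shift x) = x" using assms by (simp add: P_E23 half_shift_half_shift)
    moreover have "half_shift x \<in> ?E" using 2 E by blast
    ultimately have "inv_into ?E P x = half_shift x"
      using inv_into_f_f[OF P_inj, of "half_shift x"] by simp
    moreover have "x \<in> half_shift ` E23" using 2 assms by (simp add: half_shift_image_E23)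
    ultimately show ?thesis using 2 half_shift_E23_subset_D by (auto simp: S_def P_image)
  next
    case 3
    then show ?thesis by (simp add: S_def P_image half_shift_image_E23)
  qed
qed

lemma borel_sets_torus: "A \<in> sets borel \<Longrightarrow> A \<subseteq> unit_cell \<Longrightarrow> A \<in> sets torus"
  by (auto simp: sets_torus_iff)

lemma D_sets: "D \<in> sets torus"
  unfolding D_eq by (intro borel_sets_torus borel_Times) (auto simp: mem_unit_cell)

lemma D1_sets: "D1 \<in> sets torus"
proof (rule borel_sets_torus[OF _ D1_subset])
  have "D1 = {z. -1/2 < fst z} \<inter> {z. fst z < 0} \<inter> {z. \<bar>snd z\<bar> < fst z + 1/2}"
    unfolding D1_eq by auto
  moreover have "open ({z. -1/2 < fst z} \<inter> {z. fst z < 0} \<inter> {z. \<bar>snd z\<bar> < fst z + 1/2} :: (real \<times> real) set)"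
    by (intro open_Int open_Collect_less continuous_intros)
  ultimately show "D1 \<in> sets borel" by simp
qed

lemma E23_sets: "E23 \<in> sets torus"
proof (rule borel_sets_torus[OF _ E23_subset])
  have "E23 = ({z. 0 \<le> fst z} \<inter> {z. fst z + \<bar>snd z\<bar> \<le> 1/2}) \<inter> unit_cell \<union> {(-1/2, 0)}"
    unfolding E23_eq by auto
  moreover have "closed ({z. 0 \<le> fst z} \<inter> {z. fst z + \<bar>snd z\<bar> \<le> 1/2} :: (real \<times> real) set)"
    by (intro closed_Int closed_Collect_le continuous_intros)
  from sets.Int[OF borel_closed[OF this] unit_cell_borel]
  have "({z. 0 \<le> fst z} \<inter> {z. fst z + \<bar>snd z\<bar> \<le> 1/2}) \<inter> unit_cell \<union> {(-1/2, 0)} \<in> sets borel"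
    by (rule sets.Un) simp
  ultimately show "E23 \<in> sets borel" by (simp only:)
qed

lemma Omega2_sets: "Omega2 \<in> sets torus"
proof (rule borel_sets_torus)
  have "Omega2 = {z. \<bar>fst z\<bar> + \<bar>snd z\<bar> \<le> 1/2} \<inter> unit_cell"
    unfolding Omega2_eq space_torus by auto
  moreover have "closed {z :: real \<times> real. \<bar>fst z\<bar> + \<bar>snd z\<bar> \<le> 1/2}"
    by (intro closed_Collect_le continuous_intros)
  from sets.Int[OF borel_closed[OF this] unit_cell_borel]
  have "{z. \<bar>fst z\<bar> + \<bar>snd z\<bar> \<le> 1/2} \<inter> unit_cell \<in> sets borel" .
  ultimately show "Omega2 \<in> sets borel" by (simp only:)
qed (auto simp: Omega2_def space_torus)

lemma half_shift_E23_sets: "half_shift ` E23 \<in> sets torus"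
  unfolding half_shift_image_E23 half_shift_def by (rule wrap_vimage_sets[OF E23_sets])

lemma null_sets_sym_diff_torus:
  assumes "A \<in> sets torus" "B \<in> sets torus" "AE x in torus. x \<in> A \<longleftrightarrow> x \<in> B"
  shows "sym_diff A B \<in> null_sets torus"
proof -
  have S: "sym_diff A B \<in> sets torus" using assms by auto
  have "AE x in torus. x \<notin> sym_diff A B" using assms(3) by eventually_elim auto
  then show ?thesis by (simp only: AE_iff_null_sets[OF S])
qed

lemma generic_membership:
  assumes "(x, y) \<in> unit_cell" "generic (x, y)"
  shows "(x, y) \<in> D1 \<longleftrightarrow> x < 0 \<and> \<bar>x\<bar> + \<bar>y\<bar> < 1/2"
    and "(x, y) \<in> E23 \<longleftrightarrow> 0 < x \<and> \<bar>x\<bar> + \<bar>y\<bar> < 1/2"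
    and "half_shift (x, y) \<in> E23 \<longleftrightarrow> x < 0 \<and> 1/2 < \<bar>x\<bar> + \<bar>y\<bar>"
    and "(x, y) \<in> Omega2 \<longleftrightarrow> \<bar>x\<bar> + \<bar>y\<bar> < 1/2"
    and "(x, y) \<in> D \<longleftrightarrow> x < 0"
  using assms half_shift_eq[OF assms(1)]
  unfolding D1_eq E23_eq Omega2_eq D_eq space_torus
  by (auto simp: mem_unit_cell generic_def)

lemma AE_Omega2_iff: "AE x in torus. x \<in> Omega2 \<longleftrightarrow> x \<in> D1 \<union> D2 \<union> D3"
  using AE_generic
proof eventually_elim
  case (elim z)
  obtain x y where z: "z = (x, y)" by (cases z)
  have "z \<in> D1 \<union> D2 \<union> D3 \<longleftrightarrow> z \<in> D1 \<or> z \<in> E23" by (auto simp: E23_def)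
  then show ?case using elim generic_membership[of x y] unfolding z by (auto simp: generic_def)
qed

lemma AE_D_iff: "AE x in torus. x \<in> P ` (D1 \<union> D2 \<union> D3) \<longleftrightarrow> x \<in> D"
  using AE_generic
proof eventually_elim
  case (elim z)
  obtain x y where z: "z = (x, y)" by (cases z)
  show ?case
    using elim generic_membership[of x y] unfolding z P_image half_shift_image_E23
    by (auto simp: generic_def)
qed

lemma sym_diff_Omega2: "sym_diff Omega2 (D1 \<union> D2 \<union> D3) \<in> null_sets torus"
proof (rule null_sets_sym_diff_torus[OF Omega2_sets _ AE_Omega2_iff])
  have "D1 \<union> D2 \<union> D3 = D1 \<union> E23" by (auto simp: E23_def)
  then show "D1 \<union> D2 \<union> D3 \<in> sets torus" using D1_sets E23_sets by simp
qed

lemma sym_diff_D: "sym_diff (P ` (D1 \<union> D2 \<union> D3)) D \<in> null_sets torus"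
proof (rule null_sets_sym_diff_torus[OF _ D_sets AE_D_iff])
  show "P ` (D1 \<union> D2 \<union> D3) \<in> sets torus"
    unfolding P_image by (rule sets.Un[OF D1_sets half_shift_E23_sets])
qed

section \<open>The bases of the two function spaces on the torus\<close>

lemma L2_indicator:
  assumes f: "f \<in> L2 M" and A: "A \<in> sets M"
  shows "(\<lambda>x. f x * indicator A x) \<in> L2 M"
proof -
  have "integrable M (\<lambda>x. indicator A x *\<^sub>R (cmod (f x))\<^sup>2)"
    using A L2_square_integrable[OF f] by (rule integrable_mult_indicator)
  moreover have "indicator A x *\<^sub>R (cmod (f x))\<^sup>2 = (cmod (f x * indicator A x))\<^sup>2" for x
    by (simp add: indicator_def)
  ultimately have "integrable M (\<lambda>x. (cmod (f x * indicator A x))\<^sup>2)" by simp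
  moreover have "(\<lambda>x. f x * indicator A x) \<in> borel_measurable M"
    using A L2_measurable[OF f] by measurable
  ultimately show ?thesis by (simp add: L2_iff)
qed

lemma L2_half_shift: "f \<in> L2 torus \<Longrightarrow> (\<lambda>x. f (half_shift x)) \<in> L2 torus"
  unfolding half_shift_def by (rule L2_wrap)

lemma L2_cong_on_space:
  assumes "f \<in> L2 M" "\<And>x. x \<in> space M \<Longrightarrow> f x = g x"
  shows "g \<in> L2 M"
proof -
  have "f \<in> borel_measurable M \<longleftrightarrow> g \<in> borel_measurable M"
    using assms(2) by (rule measurable_cong)
  moreover have "integrable M (\<lambda>x. (cmod (f x))\<^sup>2) \<longleftrightarrow> integrable M (\<lambda>x. (cmod (g x))\<^sup>2)"
    using assms(2) by (intro Bochner_Integration.integrable_cong) auto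
  ultimately show ?thesis using assms(1) by (simp add: L2_iff)
qed

text \<open>
  Since \<open>half_shift\<close> is an involution, composition with the inverse of \<open>P\<close> is again composition
  with \<open>half_shift\<close>.
\<close>

lemma S_eq_indicator:
  assumes "x \<in> unit_cell"
  shows "S g x = g x * indicator D1 x + g (half_shift x) * indicator E23 (half_shift x)"
proof -
  have "half_shift x \<notin> E23" if "x \<in> D1"
    using that half_shift_E23_D1_disjoint assms unfolding half_shift_image_E23 by blast
  then show ?thesis using S_eq[OF assms, of g] by (auto simp: indicator_def)
qed

lemma S_L2: "g \<in> L2 torus \<Longrightarrow> S g \<in> L2 torus"
proof (rule L2_cong_on_space)
  assume g: "g \<in> L2 torus"
  show "(\<lambda>x. g x * indicator D1 x + g (half_shift x) * indicator E23 (half_shift x)) \<in> L2 torus"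
    by (intro L2_add L2_half_shift[where f = "\<lambda>x. g x * indicator E23 x"] L2_indicator g D1_sets E23_sets)
qed (simp add: S_eq_indicator space_torus)

lemma S_in_L2_on_D: "g \<in> L2 torus \<Longrightarrow> S g \<in> L2_on torus D"
  by (simp add: L2_on_def S_L2) (simp add: S_def)

lemma S_inner:
  assumes g: "g \<in> L2_on torus Omega2" and h: "h \<in> L2_on torus Omega2"
  shows "L2_ip torus (S g) (S h) = L2_ip torus g h"
proof -
  have gL: "g \<in> L2 torus" and hL: "h \<in> L2 torus" using g h by (simp_all add: L2_on_L2)
  let ?F = "\<lambda>x. g x * cnj (h x)"
  have F: "integrable torus ?F" using gL hL by (rule L2_mult_cnj_integrable)
  have int: "integrable torus (\<lambda>x. ?F x * indicator A x)" if "A \<in> sets torus" for A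
    using F that by (rule integrable_times_indicator)
  have intE: "integrable torus (\<lambda>x. ?F (half_shift x) * indicator E23 (half_shift x))"
  proof -
    have "integrable (distr torus torus half_shift) (\<lambda>x. ?F x * indicator E23 x)"
      unfolding half_shift_def[abs_def] distr_wrap using int[OF E23_sets] .
    then show ?thesis
      by (rule integrable_distr[rotated]) (simp add: half_shift_def[abs_def] wrap_measurable)
  qed
  have "L2_ip torus (S g) (S h) = (LINT x|torus. ?F x * indicator D1 x + ?F (half_shift x) * indicator E23 (half_shift x))"
    unfolding L2_ip_def
  proof (rule Bochner_Integration.integral_cong)
    fix x assume "x \<in> space torus"
    then have x: "x \<in> unit_cell" by (simp add: space_torus)
    have "half_shift x \<notin> E23" if "x \<in> D1"
      using that half_shift_E23_D1_disjoint x unfolding half_shift_image_E23 by blast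
    then show "S g x * cnj (S h x) = ?F x * indicator D1 x + ?F (half_shift x) * indicator E23 (half_shift x)"
      by (auto simp: S_eq[OF x] indicator_def)
  qed simp
  also have "\<dots> = (LINT x|torus. ?F x * indicator D1 x)
      + (LINT x|torus. ?F (half_shift x) * indicator E23 (half_shift x))"
    using int[OF D1_sets] intE by simp
  also have "(LINT x|torus. ?F (half_shift x) * indicator E23 (half_shift x)) = (LINT x|torus. ?F x * indicator E23 x)"
    unfolding half_shift_def
    by (rule integral_wrap[where f = "\<lambda>x. ?F x * indicator E23 x"])
       (rule borel_measurable_integrable[OF int[OF E23_sets]])
  also have "(LINT x|torus. ?F x * indicator D1 x) + (LINT x|torus. ?F x * indicator E23 x)
      = (LINT x|torus. ?F x * indicator D1 x + ?F x * indicator E23 x)"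
    using int[OF D1_sets] int[OF E23_sets] by simp
  also have "\<dots> = L2_ip torus g h"
    unfolding L2_ip_def
  proof (rule integral_cong_AE)
    have "AE x in torus. x \<notin> Omega2 \<longrightarrow> g x = 0" using g by (simp add: L2_on_def)
    then show "AE x in torus. ?F x * indicator D1 x + ?F x * indicator E23 x = ?F x"
      using AE_Omega2_iff
    proof eventually_elim
      case (elim x)
      then show ?case using D1_E23_disjoint by (auto simp: indicator_def E23_def)
    qed
    show "(\<lambda>x. ?F x * indicator D1 x + ?F x * indicator E23 x) \<in> borel_measurable torus"
      using int[OF D1_sets] int[OF E23_sets] by (intro borel_measurable_add borel_measurable_integrable)
    show "?F \<in> borel_measurable torus" using F by (rule borel_measurable_integrable)
  qed
  finally show ?thesis .
qed

theorem S_unitary: "L2_unitary torus (L2_on torus Omega2) torus (L2_on torus D) S"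
  unfolding L2_unitary_def
proof (intro conjI ballI L2_on_subset_L2)
  show "S g \<in> L2_on torus D" if "g \<in> L2_on torus Omega2" for g
    using that by (intro S_in_L2_on_D L2_on_L2)
  show "L2_ip torus (S g) (S h) = L2_ip torus g h" if "g \<in> L2_on torus Omega2" "h \<in> L2_on torus Omega2" for g h
    using that by (rule S_inner)
  fix h assume h: "h \<in> L2_on torus D"
  \<comment> \<open>The candidate for the preimage is \<open>h \<circ> P\<close>.\<close>
  define g where "g x = h x * indicator D1 x + h (half_shift x) * indicator E23 x" for x
  have "g \<in> L2 torus"
    unfolding g_def using L2_on_L2[OF h] by (intro L2_add L2_half_shift L2_indicator D1_sets E23_sets)
  moreover have "AE x in torus. x \<notin> Omega2 \<longrightarrow> g x = 0"
    using AE_Omega2_iff by eventually_elim (auto simp: g_def indicator_def E23_def)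
  ultimately have "g \<in> L2_on torus Omega2" by (simp add: L2_on_def)
  moreover have "AE x in torus. S g x = h x"
  proof -
    have "AE x in torus. x \<notin> D \<longrightarrow> h x = 0" using h by (simp add: L2_on_def)
    then show ?thesis using AE_generic AE_D_iff
    proof eventually_elim
      case (elim x)
      then have x: "x \<in> unit_cell" by simp
      show ?case
        using elim half_shift_half_shift[OF x] D1_E23_disjoint
        unfolding S_eq[OF x] P_image half_shift_image_E23 g_def by (auto simp: indicator_def)
    qed
  qed
  ultimately show "\<exists>f\<in>L2_on torus Omega2. AE x in torus. S f x = h x" by blast
qed

lemma half_translate_D:
  assumes "(x, y) \<in> unit_cell" "generic (x, y)"
  shows "(x, y) \<in> D \<longleftrightarrow> wrap ((x, y) + (1/2, 0)) \<notin> D"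
proof -
  have "wrap ((x, y) + (1/2, 0)) = (if x < 0 then x + 1/2 else x - 1/2, y)"
    unfolding wrap_eq_iff
  proof (intro conjI exI)
    show "(x, y) + (1/2, 0) = (if x < 0 then x + 1/2 else x - 1/2, y) + lattice (if x < 0 then 0 else 1, 0)"
      by (simp add: lattice_def)
  qed (use assms in \<open>auto simp: mem_unit_cell\<close>)
  then show ?thesis using assms by (auto simp: D_eq mem_unit_cell generic_def)
qed

text \<open>
  Translation by (1/2, 0) exchanges \<open>D\<close> with its complement up to a null set.
\<close>

lemma D_half:
  fixes F :: "real \<times> real \<Rightarrow> complex"
  assumes F: "integrable torus F" and per: "\<And>x. x \<in> unit_cell \<Longrightarrow> F (wrap (x + (1/2, 0))) = F x"
  shows "2 * (LINT x|torus. F x * indicator D x) = (LINT x|torus. F x)"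
proof -
  let ?h = "\<lambda>x. wrap (x + (1/2, 0))"
  have int: "integrable torus (\<lambda>x. F x * indicator A x)" if "A \<in> sets torus" for A
    using F that by (rule integrable_times_indicator)
  have D': "{x \<in> unit_cell. ?h x \<in> D} \<in> sets torus" by (rule wrap_vimage_sets[OF D_sets])
  have "(LINT x|torus. F x * indicator D x) = (LINT x|torus. F (?h x) * indicator D (?h x))"
    by (rule integral_wrap[symmetric, OF borel_measurable_integrable[OF int[OF D_sets]]])
  also have "\<dots> = (LINT x|torus. F x * indicator {x \<in> unit_cell. ?h x \<in> D} x)"
    by (intro Bochner_Integration.integral_cong) (auto simp: space_torus per indicator_def)
  finally have "2 * (LINT x|torus. F x * indicator D x)
      = (LINT x|torus. F x * indicator D x) + (LINT x|torus. F x * indicator {x \<in> unit_cell. ?h x \<in> D} x)"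
    by simp
  also have "\<dots> = (LINT x|torus. F x * indicator D x + F x * indicator {x \<in> unit_cell. ?h x \<in> D} x)"
    using int[OF D_sets] int[OF D'] by simp
  also have "\<dots> = (LINT x|torus. F x)"
  proof (rule integral_cong_AE)
    show "AE x in torus. F x * indicator D x + F x * indicator {x \<in> unit_cell. ?h x \<in> D} x = F x"
      using AE_generic
    proof eventually_elim
      case (elim z)
      obtain x y where z: "z = (x, y)" by (cases z)
      have "z \<in> D \<longleftrightarrow> ?h z \<notin> D" using elim unfolding z by (intro half_translate_D) auto
      then show ?case using elim by (auto simp: indicator_def)
    qed
    show "(\<lambda>x. F x * indicator D x + F x * indicator {x \<in> unit_cell. ?h x \<in> D} x) \<in> borel_measurable torus"
      using int[OF D_sets] int[OF D'] by (intro borel_measurable_add borel_measurable_integrable)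
    show "F \<in> borel_measurable torus" using F by (rule borel_measurable_integrable)
  qed
  finally show ?thesis .
qed

lemma character_half: "character (2 * m, k) (1/2, 0) = 1" "character (2 * m, k) (1/2, 1/2) = (-1) powi k"
proof -
  have "character (2 * m, k) (1/2, 0) = exp ((2 * of_int m * pi) * \<i>)"
    by (simp add: character_def algebra_simps)
  also have "\<dots> = 1" by (rule exp_integer_2pi) (rule Ints_of_int)
  finally show *: "character (2 * m, k) (1/2, 0) = 1" .
  have "character (0, k) (0, 1/2) = exp (of_int k * (complex_of_real pi * \<i>))"
    by (simp add: character_def mult_ac)
  also have "\<dots> = exp (complex_of_real pi * \<i>) powi k" by (rule exp_power_int[symmetric])
  also have "\<dots> = (-1) powi k" by simp
  finally have "character (0, k) (0, 1/2) = (-1) powi k" .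
  moreover have "character (2 * m, k) (1/2, 1/2) = character (2 * m, k) (1/2, 0) * character (0, k) (0, 1/2)"
    by (simp add: character_def exp_add[symmetric] algebra_simps add_divide_distrib)
  ultimately show "character (2 * m, k) (1/2, 1/2) = (-1) powi k" using * by simp
qed

lemma psi_tilde_L2_on: "psi_tilde s n \<in> L2_on torus D"
proof -
  have "(\<lambda>x. complex_of_real (sqrt 2) * (character (2 * fst (s n), snd (s n)) x * indicator D x)) \<in> L2 torus"
    by (intro L2_cmult L2_indicator character_L2 D_sets)
  then have "psi_tilde s n \<in> L2 torus" by (simp add: psi_tilde_def[abs_def] mult.assoc)
  then show ?thesis by (simp add: L2_on_def psi_tilde_def)
qed

lemma L2_ip_psi_tilde:
  assumes g: "g \<in> L2_on torus D"
  shows "L2_ip torus g (psi_tilde s n) = complex_of_real (sqrt 2) * L2_ip torus g (character (2 * fst (s n), snd (s n)))"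
proof -
  let ?c = "character (2 * fst (s n), snd (s n))"
  have "L2_ip torus g (psi_tilde s n) = (LINT x|torus. complex_of_real (sqrt 2) * (g x * cnj (?c x)))"
    unfolding L2_ip_def
  proof (rule integral_cong_AE)
    have "AE x in torus. x \<notin> D \<longrightarrow> g x = 0" using g by (simp add: L2_on_def)
    then show "AE x in torus. g x * cnj (psi_tilde s n x) = complex_of_real (sqrt 2) * (g x * cnj (?c x))"
      by eventually_elim (auto simp: psi_tilde_def indicator_def)
    show "(\<lambda>x. g x * cnj (psi_tilde s n x)) \<in> borel_measurable torus"
      by (intro borel_measurable_integrable L2_mult_cnj_integrable L2_on_L2[OF g] L2_on_L2[OF psi_tilde_L2_on])
    show "(\<lambda>x. complex_of_real (sqrt 2) * (g x * cnj (?c x))) \<in> borel_measurable torus"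
      by (intro borel_measurable_integrable integrable_mult_right L2_mult_cnj_integrable L2_on_L2[OF g] character_L2)
  qed
  then show ?thesis by (simp add: L2_ip_def)
qed

lemma psi_tilde_orthonormal:
  assumes s: "bij s" shows "orthonormal torus (psi_tilde s)"
  unfolding orthonormal_def
proof (intro conjI allI)
  show "psi_tilde s n \<in> L2 torus" for n by (rule L2_on_L2[OF psi_tilde_L2_on])
  fix m n
  let ?k = "(2 * fst (s m), snd (s m)) - (2 * fst (s n), snd (s n))"
  have k: "?k = (2 * (fst (s m) - fst (s n)), snd (s m) - snd (s n))" by simp
  have "L2_ip torus (psi_tilde s m) (psi_tilde s n) = 2 * (LINT x|torus. character ?k x * indicator D x)"
  proof -
    have "psi_tilde s m x * cnj (psi_tilde s n x) = 2 * (character ?k x * indicator D x)" for x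
    proof -
      have "psi_tilde s m x * cnj (psi_tilde s n x)
        = (complex_of_real (sqrt 2) * complex_of_real (sqrt 2)) * (character (2 * fst (s m), snd (s m)) x * cnj (character (2 * fst (s n), snd (s n)) x)) * indicator D x"
        by (simp add: psi_tilde_def indicator_def)
      also have "complex_of_real (sqrt 2) * complex_of_real (sqrt 2) = 2"
        by (simp flip: of_real_mult)
      finally show ?thesis unfolding cnj_character character_mult by simp
    qed
    then show ?thesis by (simp add: L2_ip_def)
  qed
  also have "\<dots> = (LINT x|torus. character ?k x)"
  proof (rule D_half)
    show "integrable torus (character ?k)" by (rule L2_torus_integrable[OF character_L2])
    show "character ?k (wrap (x + (1/2, 0))) = character ?k x" for x
      unfolding character_wrap character_add k character_half by simp
  qed
  also have "\<dots> = (if m = n then 1 else 0)"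
    using bij_is_inj[OF s] by (auto simp: integral_character prod_eq_iff inj_def zero_prod_def)
  finally show "L2_ip torus (psi_tilde s m) (psi_tilde s n) = (if m = n then 1 else 0)" .
qed

lemma L2_ip_half_translate_character:
  assumes g: "g \<in> L2 torus"
  shows "L2_ip torus (\<lambda>x. g (wrap (x + (1/2, 0)))) (character k) = character k (1/2, 0) * L2_ip torus g (character k)"
proof -
  let ?h = "\<lambda>x. wrap (x + (1/2, 0))"
  have hh: "?h (?h x) = x" if "x \<in> unit_cell" for x
  proof -
    have "?h (?h x) = wrap (x + lattice (1, 0))" by (simp add: wrap_wrap_add lattice_def add.assoc)
    then show ?thesis using that by (simp only: wrap_add_lattice wrap_ident)
  qed
  have c1: "character k (1/2, 0) * character k (1/2, 0) = 1"
    using character_add[of k "(1/2, 0)" "(1/2, 0)"] character_lattice[of k "(1, 0)"] by (simp add: lattice_def)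
  have c2: "cnj (character k (1/2, 0)) = character k (1/2, 0)"
  proof -
    have "cnj (character k (1/2, 0)) * character k (1/2, 0) = 1"
      unfolding cnj_character character_mult by simp
    then have "cnj (character k (1/2, 0)) * (character k (1/2, 0) * character k (1/2, 0)) = character k (1/2, 0)"
      by (simp only: mult.assoc[symmetric] mult_1_left)
    then show ?thesis by (simp only: c1 mult_1_right)
  qed
  have "L2_ip torus (\<lambda>x. g (?h x)) (character k) = (LINT x|torus. (\<lambda>y. g (?h y) * cnj (character k y)) (?h x))"
    unfolding L2_ip_def
    by (rule integral_wrap[symmetric])
       (intro borel_measurable_integrable L2_mult_cnj_integrable L2_wrap g character_L2)
  also have "\<dots> = (LINT x|torus. character k (1/2, 0) * (g x * cnj (character k x)))"
    by (intro Bochner_Integration.integral_cong) (simp_all add: hh space_torus character_wrap character_add c2)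
  finally show ?thesis by (simp add: L2_ip_def)
qed

text \<open>
  The periodic extension \<open>g + g \<circ> \<tau>\<close> with \<open>\<tau>\<close> the translation by (1/2, 0) has coefficients
  \<open>(1 + (-1)\<^sup>m) \<langle>g, \<chi>\<rangle>\<close> at the frequencies with first entry \<open>m\<close>. For even \<open>m\<close> they are
  multiples of the inner products with the functions \<open>psi_tilde s n\<close>, and for odd \<open>m\<close> they
  vanish. So the extension is 0, and on \<open>D\<close> it agrees with \<open>g\<close>.
\<close>

theorem psi_tilde_basis:
  assumes s: "bij s"
  shows "orthonormal_basis torus (L2_on torus D) (psi_tilde s)"
proof (rule orthonormal_basis_if_total)
  show "D \<inter> space torus \<in> sets torus" using D_sets by auto
  show "psi_tilde s n \<in> L2_on torus D" for n by (rule psi_tilde_L2_on)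
  show "orthonormal torus (psi_tilde s)" using s by (rule psi_tilde_orthonormal)
  fix g assume gD: "g \<in> L2_on torus D" and orth: "\<And>n. L2_ip torus g (psi_tilde s n) = 0"
  have g: "g \<in> L2 torus" using gD by (rule L2_on_L2)
  let ?h = "\<lambda>x. wrap (x + (1/2, 0))"
  have gh: "(\<lambda>x. g (?h x)) \<in> L2 torus" using g by (rule L2_wrap)
  have "AE x in torus. g x + g (?h x) = 0"
  proof (rule character_total)
    show "(\<lambda>x. g x + g (?h x)) \<in> L2 torus" using g gh by (rule L2_add)
    fix k :: "int \<times> int"
    have ip: "L2_ip torus (\<lambda>x. g x + g (?h x)) (character k) = (1 + character k (1/2, 0)) * L2_ip torus g (character k)"
      by (simp add: L2_ip_add_left g gh character_L2 L2_ip_half_translate_character distrib_right)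
    show "L2_ip torus (\<lambda>x. g x + g (?h x)) (character k) = 0"
    proof (cases "even (fst k)")
      case True
      then obtain m where m: "fst k = 2 * m" by blast
      obtain n where n: "s n = (m, snd k)" using bij_is_surj[OF s] by (metis surjD)
      have "(2 * fst (s n), snd (s n)) = k" using m n by (simp add: prod_eq_iff)
      then show ?thesis using orth[of n] unfolding ip L2_ip_psi_tilde[OF gD] by simp
    next
      case False
      then obtain m where m: "fst k = 2 * m + 1" by (elim oddE)
      have "character k (1/2, 0) = exp (complex_of_real ((2 * of_int m + 1) * pi) * \<i>)"
        by (simp add: character_def m algebra_simps)
      also have "\<dots> = -1" using exp_integer_2pi_plus1[of "of_int m"] by simp
      finally show ?thesis unfolding ip by simp
    qed
  qed
  moreover have off: "AE x in torus. x \<notin> D \<longrightarrow> g x = 0" using gD by (simp add: L2_on_def)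
  moreover have "AE x in torus. ?h x \<notin> D \<longrightarrow> g (?h x) = 0" using AE_wrap[OF off] .
  ultimately show "AE x in torus. g x = 0" using AE_generic
  proof eventually_elim
    case (elim z)
    obtain x y where z: "z = (x, y)" by (cases z)
    have "z \<in> D \<longleftrightarrow> ?h z \<notin> D" using elim unfolding z by (intro half_translate_D) auto
    then show ?case using elim by auto
  qed
qed

lemma psi_eq: "psi s n x = complex_of_real (sqrt 2) * character (2 * fst (s n), snd (s n)) x *
    (indicator D1 x + (-1) powi snd (s n) * indicator E23 x)"
  by (simp add: psi_def E23_def)

lemma psi_L2_on: "psi s n \<in> L2_on torus Omega2"
proof -
  let ?c = "character (2 * fst (s n), snd (s n))"
  have "(\<lambda>x. complex_of_real (sqrt 2) * (?c x * indicator D1 x) +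
         complex_of_real (sqrt 2) * (-1) powi snd (s n) * (?c x * indicator E23 x)) \<in> L2 torus"
    by (intro L2_add L2_cmult L2_indicator character_L2 D1_sets E23_sets)
  then have "psi s n \<in> L2 torus"
    by (rule L2_cong_on_space) (simp add: psi_eq algebra_simps)
  moreover have "AE x in torus. x \<notin> Omega2 \<longrightarrow> psi s n x = 0"
    using AE_Omega2_iff by eventually_elim (simp add: psi_def)
  ultimately show ?thesis by (simp add: L2_on_def)
qed

lemma S_psi: "AE x in torus. S (psi s n) x = psi_tilde s n x"
  using AE_generic AE_D_iff
proof eventually_elim
  case (elim x)
  then have x: "x \<in> unit_cell" by simp
  define k where "k = snd (s n)"
  have sq: "(-1) powi k * (-1) powi k = (1::complex)"
    by (simp add: power_int_mult_distrib[symmetric])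
  have ch: "character (2 * fst (s n), k) (half_shift x) = character (2 * fst (s n), k) x * (-1) powi k"
    unfolding half_shift_def character_wrap character_add character_half by simp
  have "psi s n (half_shift x) = psi_tilde s n x" if "half_shift x \<in> E23" "x \<in> D"
  proof -
    have "half_shift x \<notin> D1" using that D1_E23_disjoint by blast
    then show ?thesis
      using that sq unfolding psi_eq psi_tilde_def k_def[symmetric] ch by (simp add: mult.assoc)
  qed
  moreover have "psi s n x = psi_tilde s n x" if "x \<in> D1"
    using that D1_E23_disjoint D1_subset_D unfolding psi_eq psi_tilde_def by (auto simp: indicator_def)
  moreover have "psi_tilde s n x = 0" if "x \<notin> D" using that by (simp add: psi_tilde_def)
  ultimately show ?case
    using elim unfolding S_eq[OF x] P_image half_shift_image_E23 by auto
qed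

theorem S_inv_psi_tilde: "AE x in torus. S_inv (psi_tilde s n) x = psi s n x"
  unfolding S_inv_def
proof (rule L2_unitary_inj[OF S_unitary])
  note inv = L2_inverse_unitary[OF S_unitary psi_tilde_L2_on[of s n]]
  show "L2_inverse (L2_on torus Omega2) torus S (psi_tilde s n) \<in> L2_on torus Omega2" by (rule inv)
  show "psi s n \<in> L2_on torus Omega2" by (rule psi_L2_on)
  show "AE x in torus. S (L2_inverse (L2_on torus Omega2) torus S (psi_tilde s n)) x = S (psi s n) x"
    using inv(2) S_psi[of s n] by eventually_elim simp
qed

theorem psi_basis:
  assumes "bij s"
  shows "orthonormal_basis torus (L2_on torus Omega2) (psi s)"
proof (rule orthonormal_basis_AE_cong[OF L2_on_subset_L2])
  show "orthonormal_basis torus (L2_on torus Omega2) (\<lambda>n. S_inv (psi_tilde s n))"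
    unfolding S_inv_def by (rule orthonormal_basis_inverse_unitary[OF S_unitary psi_tilde_basis[OF assms]])
qed (rule psi_L2_on S_inv_psi_tilde)+

section \<open>The Carleson embedding for separated points\<close>

definition circ :: "real \<Rightarrow> complex" where
  "circ t = exp (2 * of_real pi * \<i> * of_real t)"

definition szego :: "complex \<Rightarrow> complex \<Rightarrow> complex" where
  "szego w z = 1 / (1 - cnj w * z)"

definition disc_algebra :: "(complex \<Rightarrow> complex) set" where
  "disc_algebra = {h. continuous_on (cball 0 1) h \<and> h holomorphic_on ball 0 1}"

lemma norm_circ [simp]: "cmod (circ t) = 1"
  by (simp add: circ_def norm_exp_eq_Re)

lemma circ_continuous: "continuous_on A circ"
  unfolding circ_def by (intro continuous_intros)

lemma circ_mult_cnj: "circ t * cnj (circ t) = 1"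
  using complex_norm_square[of "circ t"] by simp

lemma szego_nonzero: "cmod w < 1 \<Longrightarrow> cmod z \<le> 1 \<Longrightarrow> 1 - cnj w * z \<noteq> 0"
proof
  assume w: "cmod w < 1" "cmod z \<le> 1" and "1 - cnj w * z = 0"
  then have "cmod (cnj w * z) = 1" by simp
  moreover have "cmod (cnj w * z) \<le> cmod w * 1"
    unfolding norm_mult complex_mod_cnj using w by (intro mult_left_mono) auto
  ultimately show False using w by simp
qed

lemma szego_ne: "cmod w < 1 \<Longrightarrow> cmod z \<le> 1 \<Longrightarrow> cnj w * z \<noteq> 1"
  using szego_nonzero[of w z] by auto

lemma disc_algebra_const: "(\<lambda>z. c) \<in> disc_algebra"
  by (simp add: disc_algebra_def)

lemma disc_algebra_id: "(\<lambda>z. z) \<in> disc_algebra"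
  by (simp add: disc_algebra_def)

lemma disc_algebra_add: "f \<in> disc_algebra \<Longrightarrow> g \<in> disc_algebra \<Longrightarrow> (\<lambda>z. f z + g z) \<in> disc_algebra"
  unfolding disc_algebra_def by (auto intro!: continuous_intros holomorphic_intros)

lemma disc_algebra_diff: "f \<in> disc_algebra \<Longrightarrow> g \<in> disc_algebra \<Longrightarrow> (\<lambda>z. f z - g z) \<in> disc_algebra"
  unfolding disc_algebra_def by (auto intro!: continuous_intros holomorphic_intros)

lemma disc_algebra_mult: "f \<in> disc_algebra \<Longrightarrow> g \<in> disc_algebra \<Longrightarrow> (\<lambda>z. f z * g z) \<in> disc_algebra"
  unfolding disc_algebra_def by (auto intro!: continuous_intros holomorphic_intros)

lemma disc_algebra_exp: "f \<in> disc_algebra \<Longrightarrow> (\<lambda>z. exp (f z)) \<in> disc_algebra"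
  unfolding disc_algebra_def by (auto intro!: continuous_intros holomorphic_intros)

lemma disc_algebra_sum:
  assumes "\<And>i. i \<in> I \<Longrightarrow> f i \<in> disc_algebra"
  shows "(\<lambda>z. \<Sum>i\<in>I. f i z) \<in> disc_algebra"
  using assms by (induction I rule: infinite_finite_induct) (auto intro: disc_algebra_const disc_algebra_add)

lemma disc_algebra_prod:
  assumes "\<And>i. i \<in> I \<Longrightarrow> f i \<in> disc_algebra"
  shows "(\<lambda>z. \<Prod>i\<in>I. f i z) \<in> disc_algebra"
  using assms by (induction I rule: infinite_finite_induct) (auto intro: disc_algebra_const disc_algebra_mult)

lemma disc_algebra_szego: "cmod w < 1 \<Longrightarrow> szego w \<in> disc_algebra"
  unfolding disc_algebra_def szego_def[abs_def]
  by (auto intro!: continuous_intros holomorphic_intros simp: szego_ne less_imp_le)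

lemma cnj_szego_circ:
  assumes "cmod w < 1"
  shows "cnj (szego w (circ t)) = circ t / (circ t - w)"
proof -
  have "circ t \<noteq> w" using assms norm_circ[of t] by fastforce
  moreover have "1 - w * cnj (circ t) \<noteq> 0"
    using szego_nonzero[of w "circ t"] assms by (metis complex_cnj_cnj complex_cnj_diff complex_cnj_mult complex_cnj_one complex_cnj_zero_iff norm_circ order_refl)
  ultimately have "1 / (1 - w * cnj (circ t)) = circ t / (circ t - w)"
    using circ_mult_cnj[of t] by (simp add: field_simps)
  then show ?thesis by (simp add: szego_def)
qed

lemma norm_circ_diff:
  assumes "cmod w < 1"
  shows "cmod (circ t - w) = cmod (1 - cnj w * circ t)"
proof -
  have "cmod (1 - cnj w * circ t) = cmod (cnj (1 - cnj w * circ t))" by (simp only: complex_mod_cnj)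
  also have "\<dots> = cmod (circ t) * cmod (1 - w * cnj (circ t))" by simp
  also have "\<dots> = cmod (circ t * (1 - w * cnj (circ t)))" by (simp only: norm_mult)
  also have "circ t * (1 - w * cnj (circ t)) = circ t - w"
    using circ_mult_cnj[of t] by (simp add: right_diff_distrib mult.left_commute)
  finally show ?thesis by simp
qed

lemma disc_algebra_circ_continuous:
  assumes "h \<in> disc_algebra"
  shows "continuous_on A (\<lambda>t. h (circ t))"
  using assms unfolding disc_algebra_def
  by (auto intro!: continuous_on_compose2[of "cball 0 1" h A circ] circ_continuous)

text \<open>
  The Cauchy integral formula, read as the reproducing property of the kernel: on the unit circle
  \<open>cnj (szego w z) = z / (z - w)\<close>.
\<close>

theorem szego_reproducing:
  assumes h: "h \<in> disc_algebra" and w: "cmod w < 1"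
  shows "((\<lambda>t. h (circ t) * cnj (szego w (circ t))) has_integral h w) {0..1}"
proof -
  have "((\<lambda>u. h u / (u - w)) has_contour_integral (2 * of_real pi * \<i> * h w)) (circlepath 0 1)"
    using h w by (intro Cauchy_integral_circlepath) (auto simp: disc_algebra_def)
  then have "((\<lambda>t. h (circlepath 0 1 t) / (circlepath 0 1 t - w) * vector_derivative (circlepath 0 1) (at t within {0..1}))
      has_integral (2 * of_real pi * \<i> * h w)) {0..1}"
    by (simp add: has_contour_integral_def)
  moreover have cp: "circlepath 0 1 = circ"
    by (simp add: circlepath circ_def fun_eq_iff)
  moreover have "vector_derivative circ (at t within {0..1}) = 2 * of_real pi * \<i> * circ t"
    if "t \<in> {0..1}" for t
    using vector_derivative_circlepath01[of t 0 1] that unfolding cp by (simp add: circ_def)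
  ultimately have "((\<lambda>t. (2 * of_real pi * \<i>) * (h (circ t) * cnj (szego w (circ t)))) has_integral (2 * of_real pi * \<i> * h w)) {0..1}"
    by (elim has_integral_eq[rotated]) (simp add: cnj_szego_circ[OF w])
  from has_integral_mult_right[OF this, of "1 / (2 * of_real pi * \<i>)"] show ?thesis by simp
qed

text \<open>
  For distinct ranks the sum is a lower Riemann sum of \<open>exp (- t)\<close>. Removing an index with the smallest rank takes
  away the term whose tail is the whole sum; the others only gain.
\<close>

lemma sum_mult_exp_tail_le:
  fixes x r :: "'a \<Rightarrow> real"
  assumes "finite I" and "\<And>k. k \<in> I \<Longrightarrow> 0 \<le> x k"
  shows "(\<Sum>j\<in>I. x j * exp (- (\<Sum>k\<in>{k\<in>I. r j \<le> r k}. x k))) \<le> 1 - exp (- (\<Sum>k\<in>I. x k))"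
  using assms
proof (induction I rule: finite_ranking_induct[where f = "\<lambda>k. - r k"])
  case empty
  then show ?case by simp
next
  case (insert i I)
  show ?case
  proof (cases "i \<in> I")
    case True
    then show ?thesis using insert by (simp add: insert_absorb)
  next
    case False
    define X where "X = (\<Sum>k\<in>I. x k)"
    have nonneg: "0 \<le> x k" if "k \<in> insert i I" for k using insert.prems that by blast
    have "{k \<in> insert i I. r i \<le> r k} = insert i I" using insert.hyps(2) by auto
    then have i: "x i * exp (- (\<Sum>k\<in>{k\<in>insert i I. r i \<le> r k}. x k)) = x i * exp (- (x i + X))"
      using False insert.hyps(1) by (simp add: X_def)
    have "(\<Sum>j\<in>I. x j * exp (- (\<Sum>k\<in>{k\<in>insert i I. r j \<le> r k}. x k)))
        \<le> (\<Sum>j\<in>I. x j * exp (- (\<Sum>k\<in>{k\<in>I. r j \<le> r k}. x k)))"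
    proof (intro sum_mono mult_left_mono)
      fix j assume j: "j \<in> I"
      have "(\<Sum>k\<in>{k\<in>I. r j \<le> r k}. x k) \<le> (\<Sum>k\<in>{k\<in>insert i I. r j \<le> r k}. x k)"
        using insert.hyps(1) nonneg by (intro sum_mono2) auto
      then show "exp (- (\<Sum>k\<in>{k\<in>insert i I. r j \<le> r k}. x k)) \<le> exp (- (\<Sum>k\<in>{k\<in>I. r j \<le> r k}. x k))"
        by simp
    qed (use nonneg in auto)
    also have "\<dots> \<le> 1 - exp (- X)" unfolding X_def using insert.prems by (intro insert.IH) auto
    finally have I: "(\<Sum>j\<in>I. x j * exp (- (\<Sum>k\<in>{k\<in>insert i I. r j \<le> r k}. x k))) \<le> 1 - exp (- X)" .
    have "exp (- X) = exp (- (x i + X)) * exp (x i)" by (simp add: exp_add[symmetric])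
    moreover have "exp (- (x i + X)) * (1 + x i) \<le> exp (- (x i + X)) * exp (x i)"
      by (intro mult_left_mono exp_ge_add_one_self) simp
    ultimately have "x i * exp (- (x i + X)) + (1 - exp (- X)) \<le> 1 - exp (- (x i + X))"
      by (simp add: algebra_simps)
    moreover have "(\<Sum>j\<in>insert i I. x j * exp (- (\<Sum>k\<in>{k\<in>insert i I. r j \<le> r k}. x k)))
        = x i * exp (- (\<Sum>k\<in>{k\<in>insert i I. r i \<le> r k}. x k))
          + (\<Sum>j\<in>I. x j * exp (- (\<Sum>k\<in>{k\<in>insert i I. r j \<le> r k}. x k)))"
      by (rule sum.insert[OF insert.hyps(1) False])
    moreover have "(\<Sum>k\<in>insert i I. x k) = x i + X"
      using False insert.hyps(1) by (simp add: X_def)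
    ultimately show ?thesis using i I by (simp only:)
  qed
qed

definition mean_square :: "(complex \<Rightarrow> complex) \<Rightarrow> real" where
  "mean_square h = integral {0..1} (\<lambda>t. (cmod (h (circ t)))\<^sup>2)"

lemma Re_cayley: "u \<noteq> 1 \<Longrightarrow> Re ((1 + u) / (1 - u)) = (1 - (cmod u)\<^sup>2) / (cmod (1 - u))\<^sup>2"
  by (simp add: Re_divide cmod_power2) (simp add: power2_eq_square algebra_simps)

definition gap :: "complex \<Rightarrow> real" where
  "gap w = 1 - (cmod w)\<^sup>2"

text \<open>
  The exponent in P. Jones's interpolation formula. On the unit circle its real part is the sum of
  \<open>gap (l k)\<^sup>2 |szego (l k) z|\<^sup>2\<close> over the points \<open>l k\<close> at least as close to the circle
  as \<open>l j\<close>.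
\<close>

definition outer_exponent :: "'i set \<Rightarrow> ('i \<Rightarrow> complex) \<Rightarrow> 'i \<Rightarrow> complex \<Rightarrow> complex" where
  "outer_exponent I l j z =
    (\<Sum>k\<in>{k\<in>I. cmod (l j) \<le> cmod (l k)}. complex_of_real (gap (l k)) * ((1 + cnj (l k) * z) * szego (l k) z))"

lemma gap_pos: "cmod w < 1 \<Longrightarrow> 0 < gap w"
  by (simp add: gap_def power_less_one_iff abs_square_less_1)

lemma szego_self: "szego w w = 1 / complex_of_real (gap w)"
  by (simp add: szego_def gap_def complex_norm_square mult.commute flip: of_real_power)

context
  fixes I :: "'i set" and l :: "'i \<Rightarrow> complex"
  assumes I: "finite I" and l: "\<And>j. j \<in> I \<Longrightarrow> cmod (l j) < 1"
begin

lemma outer_exponent_disc_algebra: "outer_exponent I l j \<in> disc_algebra"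
  unfolding outer_exponent_def[abs_def]
  by (intro disc_algebra_sum disc_algebra_mult disc_algebra_const disc_algebra_add disc_algebra_id
        disc_algebra_szego l) auto

lemma Re_outer_term:
  assumes "k \<in> I" "cmod z \<le> 1"
  shows "Re (complex_of_real (gap (l k)) * ((1 + cnj (l k) * z) * szego (l k) z))
     = gap (l k) * (1 - (cmod (l k) * cmod z)\<^sup>2) * (cmod (szego (l k) z))\<^sup>2"
proof -
  have "cnj (l k) * z \<noteq> 1" using szego_nonzero[OF l[OF assms(1)] assms(2)] by auto
  from Re_cayley[OF this] have "Re ((1 + cnj (l k) * z) * szego (l k) z)
      = (1 - (cmod (l k) * cmod z)\<^sup>2) * (cmod (szego (l k) z))\<^sup>2"
    by (simp add: szego_def norm_divide norm_mult power_divide)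
  moreover have "Re (complex_of_real c * w) = c * Re w" for c w by simp
  ultimately show ?thesis by (simp only: mult.assoc)
qed

text \<open>
  With \<open>x\<^sub>j = gap (l j)\<^sup>2 |szego (l j)|\<^sup>2\<close>, the function
  \<open>gap (l j)\<^sup>2 h\<^sup>2 szego (l j) exp (outer_exponent j (l j) - outer_exponent j z)\<close> has the value
  \<open>gap (l j) h (l j)\<^sup>2\<close> at \<open>l j\<close>, and the reproducing property recovers this value. On the
  circle the integrand is at most
  \<open>|h|\<^sup>2 exp (2 K) x\<^sub>j exp (- \<Sum>\<^sub>k x\<^sub>k)\<close>, where \<open>k\<close> runs over the points at least as close to
  the circle as \<open>l j\<close>. By the preceding summation lemma the damped terms add up to at most
  \<open>|h|\<^sup>2 exp (2 K)\<close>, although the sum of the \<open>x\<^sub>j\<close> alone is not bounded in terms of \<open>K\<close>.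
\<close>

theorem carleson_embedding:
  assumes K: "\<And>j. j \<in> I \<Longrightarrow> (\<Sum>k\<in>I. gap (l j) * gap (l k) * (cmod (szego (l k) (l j)))\<^sup>2) \<le> K"
    and h: "h \<in> disc_algebra"
  shows "(\<Sum>j\<in>I. gap (l j) * (cmod (h (l j)))\<^sup>2) \<le> exp (2 * K) * mean_square h"
proof -
  \<comment> \<open>The phases align the values so that no cancellation occurs in the sum.\<close>
  define a where "a j = cnj (sgn ((h (l j))\<^sup>2))" for j
  have a: "a j * (h (l j))\<^sup>2 = complex_of_real ((cmod (h (l j)))\<^sup>2)" "cmod (a j) \<le> 1" for j
  proof -
    let ?w = "(h (l j))\<^sup>2"
    have "a j * ?w = (?w * cnj ?w) / complex_of_real (cmod ?w)" by (simp add: a_def sgn_eq)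
    also have "\<dots> = complex_of_real ((cmod ?w)\<^sup>2) / complex_of_real (cmod ?w)"
      by (simp only: complex_norm_square)
    also have "\<dots> = complex_of_real (cmod ?w)" by (simp add: power2_eq_square)
    finally show "a j * ?w = complex_of_real ((cmod (h (l j)))\<^sup>2)" by (simp only: norm_power)
    show "cmod (a j) \<le> 1" by (simp add: a_def norm_sgn)
  qed
  define E where "E j z = complex_of_real (gap (l j) * gap (l j)) * ((h z * h z) * szego (l j) z
      * exp (outer_exponent I l j (l j) - outer_exponent I l j z))" for j z
  have E: "E j \<in> disc_algebra" if "j \<in> I" for j
    unfolding E_def using that
    by (intro disc_algebra_mult disc_algebra_const disc_algebra_exp disc_algebra_diff h
        disc_algebra_szego l outer_exponent_disc_algebra)
  have El: "E j (l j) = complex_of_real (gap (l j)) * (h (l j))\<^sup>2" if "j \<in> I" for j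
    using gap_pos[OF l[OF that]] by (simp add: E_def szego_self power2_eq_square)
  have int: "((\<lambda>t. \<Sum>j\<in>I. a j * (E j (circ t) * cnj (szego (l j) (circ t)))) has_integral
      (\<Sum>j\<in>I. a j * E j (l j))) {0..1}"
    using I by (intro has_integral_sum has_integral_mult_right szego_reproducing E l) auto
  have bound: "cmod (\<Sum>j\<in>I. a j * (E j (circ t) * cnj (szego (l j) (circ t))))
      \<le> exp (2 * K) * (cmod (h (circ t)))\<^sup>2" for t
  proof -
    define x where "x j = (gap (l j))\<^sup>2 * (cmod (szego (l j) (circ t)))\<^sup>2" for j
    have outer: "Re (outer_exponent I l j (circ t)) = (\<Sum>k\<in>{k\<in>I. cmod (l j) \<le> cmod (l k)}. x k)" if "j \<in> I" for j
    proof -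
      have "Re (outer_exponent I l j (circ t)) = (\<Sum>k\<in>{k\<in>I. cmod (l j) \<le> cmod (l k)}.
          Re (complex_of_real (gap (l k)) * ((1 + cnj (l k) * circ t) * szego (l k) (circ t))))"
        unfolding outer_exponent_def by (rule Re_sum)
      also have "\<dots> = (\<Sum>k\<in>{k\<in>I. cmod (l j) \<le> cmod (l k)}. x k)"
        by (intro sum.cong refl) (subst Re_outer_term, auto simp: x_def gap_def power2_eq_square)
      finally show ?thesis .
    qed
    have inner: "Re (outer_exponent I l j (l j)) \<le> 2 * K" if j: "j \<in> I" for j
    proof -
      have "Re (outer_exponent I l j (l j)) = (\<Sum>k\<in>{k\<in>I. cmod (l j) \<le> cmod (l k)}.
          Re (complex_of_real (gap (l k)) * ((1 + cnj (l k) * l j) * szego (l k) (l j))))"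
        unfolding outer_exponent_def by (rule Re_sum)
      also have "\<dots> \<le> (\<Sum>k\<in>{k\<in>I. cmod (l j) \<le> cmod (l k)}. 2 * (gap (l j) * gap (l k) * (cmod (szego (l k) (l j)))\<^sup>2))"
      proof (rule sum_mono)
        fix k assume "k \<in> {k\<in>I. cmod (l j) \<le> cmod (l k)}"
        then have k: "k \<in> I" "cmod (l j) \<le> cmod (l k)" by auto
        let ?b = "(cmod (l j))\<^sup>2"
        have b: "0 \<le> ?b" "?b \<le> 1" "?b \<le> (cmod (l k))\<^sup>2"
          using l[OF j] k(2) by (auto intro: power_mono simp: power_le_one)
        have "1 - (cmod (l k) * cmod (l j))\<^sup>2 = 1 - (cmod (l k))\<^sup>2 * ?b" by (simp add: power_mult_distrib)
        also have "\<dots> \<le> 1 - ?b * ?b" using mult_right_mono[OF b(3) b(1)] by linarith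
        also have "\<dots> = (1 + ?b) * gap (l j)" by (simp add: gap_def algebra_simps)
        also have "\<dots> \<le> 2 * gap (l j)" using b gap_pos[OF l[OF j]] by (intro mult_right_mono) auto
        finally have "1 - (cmod (l k) * cmod (l j))\<^sup>2 \<le> 2 * gap (l j)" .
        then have "gap (l k) * (cmod (szego (l k) (l j)))\<^sup>2 * (1 - (cmod (l k) * cmod (l j))\<^sup>2)
            \<le> gap (l k) * (cmod (szego (l k) (l j)))\<^sup>2 * (2 * gap (l j))"
          using gap_pos[OF l[OF k(1)]] by (intro mult_left_mono) auto
        then show "Re (complex_of_real (gap (l k)) * ((1 + cnj (l k) * l j) * szego (l k) (l j)))
            \<le> 2 * (gap (l j) * gap (l k) * (cmod (szego (l k) (l j)))\<^sup>2)"
          unfolding Re_outer_term[OF k(1) less_imp_le[OF l[OF j]]] by (simp only: mult_ac)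
      qed
      also have "\<dots> \<le> (\<Sum>k\<in>I. 2 * (gap (l j) * gap (l k) * (cmod (szego (l k) (l j)))\<^sup>2))"
        using I gap_pos[OF l] j by (intro sum_mono2) (auto intro!: mult_nonneg_nonneg simp: less_imp_le)
      also have "\<dots> \<le> 2 * K" using K[OF j] by (simp add: sum_distrib_left[symmetric])
      finally show ?thesis .
    qed
    have "cmod (a j * (E j (circ t) * cnj (szego (l j) (circ t))))
        \<le> exp (2 * K) * (cmod (h (circ t)))\<^sup>2 * (x j * exp (- (\<Sum>k\<in>{k\<in>I. cmod (l j) \<le> cmod (l k)}. x k)))"
      if j: "j \<in> I" for j
    proof -
      have "cmod (a j * (E j (circ t) * cnj (szego (l j) (circ t)))) \<le> 1 * cmod (E j (circ t) * cnj (szego (l j) (circ t)))"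
        unfolding norm_mult[of "a j"] using a(2)[of j] by (intro mult_right_mono) auto
      also have "\<dots> = (cmod (h (circ t)))\<^sup>2 * x j * exp (Re (outer_exponent I l j (l j)) - Re (outer_exponent I l j (circ t)))"
        using gap_pos[OF l[OF j]] by (simp add: E_def norm_mult x_def power2_eq_square)
      also have "\<dots> \<le> (cmod (h (circ t)))\<^sup>2 * x j * exp (2 * K - (\<Sum>k\<in>{k\<in>I. cmod (l j) \<le> cmod (l k)}. x k))"
        using inner[OF j] outer[OF j] by (intro mult_left_mono) (auto simp: x_def)
      finally show ?thesis by (simp add: exp_diff exp_minus field_simps)
    qed
    then have "cmod (\<Sum>j\<in>I. a j * (E j (circ t) * cnj (szego (l j) (circ t))))
        \<le> (\<Sum>j\<in>I. exp (2 * K) * (cmod (h (circ t)))\<^sup>2 * (x j * exp (- (\<Sum>k\<in>{k\<in>I. cmod (l j) \<le> cmod (l k)}. x k))))"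
      by (rule sum_norm_le)
    also have "\<dots> = exp (2 * K) * (cmod (h (circ t)))\<^sup>2 * (\<Sum>j\<in>I. x j * exp (- (\<Sum>k\<in>{k\<in>I. cmod (l j) \<le> cmod (l k)}. x k)))"
      by (simp add: sum_distrib_left)
    also have "\<dots> \<le> exp (2 * K) * (cmod (h (circ t)))\<^sup>2 * 1"
    proof (intro mult_left_mono)
      have "(\<Sum>j\<in>I. x j * exp (- (\<Sum>k\<in>{k\<in>I. cmod (l j) \<le> cmod (l k)}. x k))) \<le> 1 - exp (- (\<Sum>k\<in>I. x k))"
        by (rule sum_mult_exp_tail_le[OF I]) (simp add: x_def)
      then show "(\<Sum>j\<in>I. x j * exp (- (\<Sum>k\<in>{k\<in>I. cmod (l j) \<le> cmod (l k)}. x k))) \<le> 1"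
        using exp_gt_zero[of "- (\<Sum>k\<in>I. x k)"] by linarith
    qed simp
    finally show ?thesis by simp
  qed
  have hint: "(\<lambda>t. (cmod (h (circ t)))\<^sup>2) integrable_on {0..1}"
    by (intro integrable_continuous_real continuous_intros disc_algebra_circ_continuous h)
  have "complex_of_real (gap (l j) * (cmod (h (l j)))\<^sup>2) = a j * E j (l j)" if "j \<in> I" for j
    unfolding El[OF that] mult.left_commute[of "a j"] a(1) by (simp only: of_real_mult)
  then have "complex_of_real (\<Sum>j\<in>I. gap (l j) * (cmod (h (l j)))\<^sup>2) = (\<Sum>j\<in>I. a j * E j (l j))"
    unfolding of_real_sum by (rule sum.cong[OF refl])
  also have "\<dots> = integral {0..1} (\<lambda>t. \<Sum>j\<in>I. a j * (E j (circ t) * cnj (szego (l j) (circ t))))"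
    using int by (rule integral_unique[symmetric])
  finally have eq: "complex_of_real (\<Sum>j\<in>I. gap (l j) * (cmod (h (l j)))\<^sup>2)
      = integral {0..1} (\<lambda>t. \<Sum>j\<in>I. a j * (E j (circ t) * cnj (szego (l j) (circ t))))" .
  have "(\<Sum>j\<in>I. gap (l j) * (cmod (h (l j)))\<^sup>2) \<le> cmod (complex_of_real (\<Sum>j\<in>I. gap (l j) * (cmod (h (l j)))\<^sup>2))"
    by (simp only: norm_of_real abs_ge_self)
  also have "\<dots> \<le> integral {0..1} (\<lambda>t. exp (2 * K) * (cmod (h (circ t)))\<^sup>2)"
    unfolding eq using hint
    by (intro integral_norm_bound_integral has_integral_integrable[OF int] bound integrable_on_mult_right)
  also have "\<dots> = exp (2 * K) * mean_square h" by (simp add: mean_square_def)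
  finally show ?thesis .
qed

end

section \<open>Szego kernels at separated points form a Riesz sequence\<close>

lemma mean_square_nonneg: "0 \<le> mean_square h"
proof (cases "(\<lambda>t. (cmod (h (circ t)))\<^sup>2) integrable_on {0..1}")
  case True
  then show ?thesis unfolding mean_square_def by (rule integral_nonneg) simp
qed (simp add: mean_square_def not_integrable_integral)

lemma mean_square_integrable:
  "h \<in> disc_algebra \<Longrightarrow> (\<lambda>t. (cmod (h (circ t)))\<^sup>2) integrable_on {0..1}"
  by (intro integrable_continuous_real continuous_intros disc_algebra_circ_continuous)

lemma double_mult_le:
  fixes a b c :: real
  assumes "0 < c"
  shows "2 * (a * b) \<le> c * a\<^sup>2 + b\<^sup>2 / c"
proof -
  have "0 \<le> (c * a - b)\<^sup>2 / c" using assms by simp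
  also have "\<dots> = c * a\<^sup>2 - 2 * (a * b) + b\<^sup>2 / c"
    using assms by (simp add: field_simps power2_eq_square)
  finally show ?thesis by simp
qed

definition kernel_sum :: "'i set \<Rightarrow> ('i \<Rightarrow> complex) \<Rightarrow> ('i \<Rightarrow> complex) \<Rightarrow> complex \<Rightarrow> complex" where
  "kernel_sum I l g = (\<lambda>z. \<Sum>k\<in>I. g k * complex_of_real (sqrt (gap (l k))) * szego (l k) z)"

text \<open>
  The finite Blaschke product without the factor of \<open>l j\<close>.
\<close>

definition blaschke :: "'i set \<Rightarrow> ('i \<Rightarrow> complex) \<Rightarrow> 'i \<Rightarrow> complex \<Rightarrow> complex" where
  "blaschke I l j = (\<lambda>z. \<Prod>k\<in>I - {j}. (z - l k) * szego (l k) z)"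

context
  fixes I :: "'i set" and l :: "'i \<Rightarrow> complex" and K :: real
  assumes I: "finite I" and l: "\<And>j. j \<in> I \<Longrightarrow> cmod (l j) < 1"
    and K: "\<And>j. j \<in> I \<Longrightarrow> (\<Sum>k\<in>I. gap (l j) * gap (l k) * (cmod (szego (l k) (l j)))\<^sup>2) \<le> K"
begin

lemma kernel_sum_disc_algebra: "kernel_sum I l g \<in> disc_algebra"
  unfolding kernel_sum_def
  by (intro disc_algebra_sum disc_algebra_mult disc_algebra_const disc_algebra_szego l)

lemma kernel_sum_pairing:
  assumes h: "h \<in> disc_algebra"
  shows "((\<lambda>t. h (circ t) * cnj (kernel_sum I l g (circ t))) has_integral
      (\<Sum>j\<in>I. cnj (g j) * complex_of_real (sqrt (gap (l j))) * h (l j))) {0..1}"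
proof -
  have "((\<lambda>t. \<Sum>j\<in>I. (cnj (g j) * complex_of_real (sqrt (gap (l j)))) * (h (circ t) * cnj (szego (l j) (circ t))))
      has_integral (\<Sum>j\<in>I. cnj (g j) * complex_of_real (sqrt (gap (l j))) * h (l j))) {0..1}"
    by (intro has_integral_sum I has_integral_mult_right szego_reproducing h l)
  moreover have "h (circ t) * cnj (kernel_sum I l g (circ t))
      = (\<Sum>j\<in>I. (cnj (g j) * complex_of_real (sqrt (gap (l j)))) * (h (circ t) * cnj (szego (l j) (circ t))))" for t
    by (simp add: kernel_sum_def sum_distrib_left mult_ac)
  ultimately show ?thesis by simp
qed

lemma mean_square_kernel_sum:
  "complex_of_real (mean_square (kernel_sum I l g))
    = (\<Sum>j\<in>I. cnj (g j) * complex_of_real (sqrt (gap (l j))) * kernel_sum I l g (l j))"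
proof -
  have "((\<lambda>t. complex_of_real ((cmod (kernel_sum I l g (circ t)))\<^sup>2)) has_integral
      complex_of_real (mean_square (kernel_sum I l g))) {0..1}"
    unfolding mean_square_def
    using has_integral_linear[OF integrable_integral[OF mean_square_integrable[OF kernel_sum_disc_algebra]] bounded_linear_of_real]
    by (simp add: o_def)
  then have "((\<lambda>t. kernel_sum I l g (circ t) * cnj (kernel_sum I l g (circ t))) has_integral
      complex_of_real (mean_square (kernel_sum I l g))) {0..1}"
    by (simp only: complex_norm_square)
  then show ?thesis
    using kernel_sum_pairing[OF kernel_sum_disc_algebra] by (rule has_integral_unique)
qed

text \<open>
  Duality: the square norm of the kernel sum pairs its coefficients with its own values at the points,
  and these values are controlled by the Carleson embedding.
\<close>

lemma mean_square_kernel_sum_le: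
  "mean_square (kernel_sum I l g) \<le> exp (2 * K) * (\<Sum>j\<in>I. (cmod (g j))\<^sup>2)"
proof -
  let ?f = "kernel_sum I l g" and ?M = "exp (2 * K)"
  have "2 * mean_square ?f = 2 * cmod (\<Sum>j\<in>I. cnj (g j) * complex_of_real (sqrt (gap (l j))) * ?f (l j))"
    unfolding mean_square_kernel_sum[symmetric] by (simp add: mean_square_nonneg)
  also have "\<dots> \<le> 2 * (\<Sum>j\<in>I. cmod (g j) * (sqrt (gap (l j)) * cmod (?f (l j))))"
    using gap_pos[OF l] by (intro mult_left_mono sum_norm_le) (auto simp: norm_mult mult.assoc less_imp_le abs_of_pos)
  also have "\<dots> = (\<Sum>j\<in>I. 2 * (cmod (g j) * (sqrt (gap (l j)) * cmod (?f (l j)))))"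
    by (simp add: sum_distrib_left)
  also have "\<dots> \<le> (\<Sum>j\<in>I. ?M * (cmod (g j))\<^sup>2 + (sqrt (gap (l j)) * cmod (?f (l j)))\<^sup>2 / ?M)"
    by (intro sum_mono double_mult_le) simp
  also have "\<dots> = ?M * (\<Sum>j\<in>I. (cmod (g j))\<^sup>2) + (\<Sum>j\<in>I. gap (l j) * (cmod (?f (l j)))\<^sup>2) / ?M"
    using gap_pos[OF l]
    by (simp add: sum.distrib sum_distrib_left sum_divide_distrib power_mult_distrib less_imp_le cong: sum.cong)
  also have "\<dots> \<le> ?M * (\<Sum>j\<in>I. (cmod (g j))\<^sup>2) + (?M * mean_square ?f) / ?M"
    by (intro add_left_mono divide_right_mono carleson_embedding[OF I l K] kernel_sum_disc_algebra) auto
  finally show ?thesis by simp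
qed

lemma blaschke_disc_algebra: "blaschke I l j \<in> disc_algebra"
  unfolding blaschke_def
  by (intro disc_algebra_prod disc_algebra_mult disc_algebra_diff disc_algebra_id disc_algebra_const
      disc_algebra_szego l) auto

lemma blaschke_eq_0: "i \<in> I \<Longrightarrow> i \<noteq> j \<Longrightarrow> blaschke I l j (l i) = 0"
  unfolding blaschke_def using I by (intro prod_zero) auto

lemma blaschke_szego_circ:
  assumes j: "j \<in> I"
  shows "blaschke I l j (circ t) * szego (l j) (circ t)
    = (\<Prod>k\<in>I. (circ t - l k) * szego (l k) (circ t)) * cnj (circ t) * cnj (szego (l j) (circ t))"
proof -
  have "circ t \<noteq> l j" using l[OF j] norm_circ[of t] by fastforce
  then have "cnj (circ t) * (circ t - l j) * cnj (szego (l j) (circ t)) = cnj (circ t) * circ t"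
    using l[OF j] by (simp add: cnj_szego_circ)
  then have "cnj (circ t) * (circ t - l j) * cnj (szego (l j) (circ t)) = 1"
    using circ_mult_cnj[of t] by (simp add: mult.commute)
  moreover have "(\<Prod>k\<in>I. (circ t - l k) * szego (l k) (circ t))
      = (circ t - l j) * szego (l j) (circ t) * blaschke I l j (circ t)"
    unfolding blaschke_def using I j by (rule prod.remove)
  ultimately show ?thesis by (simp add: mult_ac)
qed

lemma cmod_blaschke_product_circ: "cmod (\<Prod>k\<in>I. (circ t - l k) * szego (l k) (circ t)) = 1"
proof -
  have "cmod ((circ t - l k) * szego (l k) (circ t)) = 1" if "k \<in> I" for k
    using norm_circ_diff[OF l[OF that], of t] szego_nonzero[OF l[OF that], of "circ t"]
    by (simp add: norm_mult szego_def norm_divide)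
  then show ?thesis by (simp add: prod_norm[symmetric])
qed

text \<open>
  The function \<open>h\<close> in the proof takes the prescribed values at the points, so its pairing with the
  kernel sum is \<open>\<Sum> |g j|\<^sup>2\<close>. On the circle the full Blaschke product has modulus 1, which gives
  \<open>h\<close> the modulus of another kernel sum, and the upper bound applies to that one.
\<close>

lemma mean_square_kernel_sum_ge:
  assumes \<delta>: "0 < \<delta>" "\<And>j. j \<in> I \<Longrightarrow> \<delta> \<le> cmod (blaschke I l j (l j))"
  shows "\<delta>\<^sup>2 / exp (2 * K) * (\<Sum>j\<in>I. (cmod (g j))\<^sup>2) \<le> mean_square (kernel_sum I l g)"
proof -
  let ?f = "kernel_sum I l g" and ?M = "exp (2 * K)" and ?A = "\<Sum>j\<in>I. (cmod (g j))\<^sup>2"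
  define c where "c j = g j / blaschke I l j (l j)" for j
  define h where "h z = (\<Sum>j\<in>I. c j * complex_of_real (sqrt (gap (l j))) * (blaschke I l j z * szego (l j) z))" for z
  have h: "h \<in> disc_algebra"
    unfolding h_def[abs_def]
    by (intro disc_algebra_sum disc_algebra_mult disc_algebra_const disc_algebra_szego l blaschke_disc_algebra)
  have hl: "complex_of_real (sqrt (gap (l i))) * h (l i) = g i" if i: "i \<in> I" for i
  proof -
    have nz: "blaschke I l i (l i) \<noteq> 0" using \<delta>(1) \<delta>(2)[OF i] by auto
    have g0: "0 < gap (l i)" by (rule gap_pos[OF l[OF i]])
    have "h (l i) = (\<Sum>j\<in>I. if j = i then c i * complex_of_real (sqrt (gap (l i))) * (blaschke I l i (l i) * szego (l i) (l i)) else 0)"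
      unfolding h_def using i by (intro sum.cong) (auto simp: blaschke_eq_0)
    also have "\<dots> = c i * complex_of_real (sqrt (gap (l i))) * (blaschke I l i (l i) * szego (l i) (l i))"
      using I i by simp
    also have "\<dots> = g i * complex_of_real (sqrt (gap (l i))) / complex_of_real (gap (l i))"
      unfolding szego_self using nz by (simp add: c_def)
    finally have hi: "h (l i) = g i * complex_of_real (sqrt (gap (l i))) / complex_of_real (gap (l i))" .
    have "complex_of_real (sqrt (gap (l i))) * complex_of_real (sqrt (gap (l i))) = complex_of_real (gap (l i))"
      using g0 by (simp flip: of_real_mult)
    then have "complex_of_real (sqrt (gap (l i))) * h (l i) = g i * complex_of_real (gap (l i)) / complex_of_real (gap (l i))"
      unfolding hi by (simp add: mult.left_commute)
    then show ?thesis using g0 by simp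
  qed
  have "cmod (h (circ t)) = cmod (kernel_sum I l (\<lambda>j. cnj (c j)) (circ t))" for t
  proof -
    have "h (circ t) = (\<Prod>k\<in>I. (circ t - l k) * szego (l k) (circ t)) * cnj (circ t)
        * cnj (kernel_sum I l (\<lambda>j. cnj (c j)) (circ t))"
    proof -
      have "h (circ t) = (\<Sum>j\<in>I. c j * complex_of_real (sqrt (gap (l j))) *
          ((\<Prod>k\<in>I. (circ t - l k) * szego (l k) (circ t)) * cnj (circ t) * cnj (szego (l j) (circ t))))"
        unfolding h_def by (rule sum.cong[OF refl]) (simp only: blaschke_szego_circ)
      then show ?thesis by (simp add: kernel_sum_def sum_distrib_left mult_ac)
    qed
    then show ?thesis by (simp only: norm_mult cmod_blaschke_product_circ complex_mod_cnj norm_circ mult_1_left)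
  qed
  then have "mean_square h = mean_square (kernel_sum I l (\<lambda>j. cnj (c j)))"
    by (simp add: mean_square_def)
  also have "\<dots> \<le> ?M * (\<Sum>j\<in>I. (cmod (c j))\<^sup>2)"
    using mean_square_kernel_sum_le[of "\<lambda>j. cnj (c j)"] by simp
  also have "\<dots> \<le> ?M * (\<Sum>j\<in>I. (cmod (g j))\<^sup>2 / \<delta>\<^sup>2)"
  proof (intro mult_left_mono sum_mono)
    fix j assume j: "j \<in> I"
    have "cmod (c j) \<le> cmod (g j) / \<delta>"
      unfolding c_def norm_divide using \<delta>(1) \<delta>(2)[OF j]
      by (intro divide_left_mono mult_pos_pos) auto
    then have "(cmod (c j))\<^sup>2 \<le> (cmod (g j) / \<delta>)\<^sup>2" by (intro power_mono) auto
    then show "(cmod (c j))\<^sup>2 \<le> (cmod (g j))\<^sup>2 / \<delta>\<^sup>2" by (simp add: power_divide)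
  qed simp
  finally have hA: "mean_square h \<le> ?M / \<delta>\<^sup>2 * ?A" by (simp add: sum_divide_distrib[symmetric])
  \<comment> \<open>With this weight the term of \<open>h\<close> in the pairing inequality is absorbed by the left hand side.\<close>
  define C where "C = \<delta>\<^sup>2 / ?M"
  have C: "0 < C" using \<delta>(1) by (simp add: C_def)
  have "((\<lambda>t. h (circ t) * cnj (?f (circ t))) has_integral complex_of_real ?A) {0..1}"
  proof -
    have "(\<Sum>j\<in>I. cnj (g j) * complex_of_real (sqrt (gap (l j))) * h (l j)) = complex_of_real ?A"
      unfolding of_real_sum
    proof (rule sum.cong[OF refl])
      fix j assume j: "j \<in> I"
      show "cnj (g j) * complex_of_real (sqrt (gap (l j))) * h (l j) = complex_of_real ((cmod (g j))\<^sup>2)"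
        unfolding mult.assoc hl[OF j] complex_norm_square by (rule mult.commute)
    qed
    then show ?thesis using kernel_sum_pairing[OF h, of g] by simp
  qed
  then have pair: "integral {0..1} (\<lambda>t. 2 * (h (circ t) * cnj (?f (circ t)))) = complex_of_real (2 * ?A)"
      "(\<lambda>t. 2 * (h (circ t) * cnj (?f (circ t)))) integrable_on {0..1}"
    using has_integral_mult_right[of _ _ _ "2::complex"] by (auto simp: has_integral_iff)
  have mono: "cmod (integral {0..1} (\<lambda>t. 2 * (h (circ t) * cnj (?f (circ t)))))
      \<le> integral {0..1} (\<lambda>t. C * (cmod (h (circ t)))\<^sup>2 + (cmod (?f (circ t)))\<^sup>2 / C)"
  proof (rule integral_norm_bound_integral[OF pair(2)])
    show "(\<lambda>t. C * (cmod (h (circ t)))\<^sup>2 + (cmod (?f (circ t)))\<^sup>2 / C) integrable_on {0..1}"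
      by (intro integrable_continuous_real continuous_intros disc_algebra_circ_continuous h kernel_sum_disc_algebra)
         (use C in auto)
    show "cmod (2 * (h (circ t) * cnj (?f (circ t)))) \<le> C * (cmod (h (circ t)))\<^sup>2 + (cmod (?f (circ t)))\<^sup>2 / C" for t
      using double_mult_le[OF C, of "cmod (h (circ t))" "cmod (?f (circ t))"] by (simp add: norm_mult)
  qed
  have "integral {0..1} (\<lambda>t. C * (cmod (h (circ t)))\<^sup>2 + (cmod (?f (circ t)))\<^sup>2 / C)
      = C * mean_square h + mean_square ?f / C"
  proof -
    have "((\<lambda>t. C * (cmod (h (circ t)))\<^sup>2 + (cmod (?f (circ t)))\<^sup>2 / C) has_integral
        C * mean_square h + mean_square ?f / C) {0..1}"
      unfolding mean_square_def
      by (intro has_integral_add has_integral_mult_right has_integral_divide integrable_integral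
          mean_square_integrable h kernel_sum_disc_algebra)
    then show ?thesis by (rule integral_unique)
  qed
  moreover have "0 \<le> ?A" by (simp add: sum_nonneg)
  ultimately have "2 * ?A \<le> C * mean_square h + mean_square ?f / C"
    using mono unfolding pair norm_of_real by linarith
  moreover have "C * mean_square h \<le> ?A"
  proof -
    have "C * mean_square h \<le> C * (?M / \<delta>\<^sup>2 * ?A)" using C hA by (intro mult_left_mono) auto
    also have "\<dots> = ?A" using \<delta>(1) by (simp add: C_def)
    finally show ?thesis .
  qed
  ultimately have "?A \<le> mean_square ?f / C" by linarith
  then show ?thesis using C unfolding C_def[symmetric] by (simp add: field_simps)
qed

text \<open>
  Both sides are the value of the Gram form of the normalized kernels: on the left its entries
  \<open>1 / (1 - cnj (l k) * l j)\<close> are expanded in geometric series.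
\<close>

lemma moments_sums_mean_square:
  "(\<lambda>n. (cmod (\<Sum>j\<in>I. g j * complex_of_real (sqrt (gap (l j))) * cnj (l j) ^ n))\<^sup>2) sums mean_square (kernel_sum I l g)"
proof -
  let ?a = "\<lambda>j. g j * complex_of_real (sqrt (gap (l j)))"
  have "(\<lambda>n. \<Sum>j\<in>I. \<Sum>k\<in>I. cnj (?a j) * ?a k * (cnj (l k) * l j) ^ n) sums
      (\<Sum>j\<in>I. \<Sum>k\<in>I. cnj (?a j) * ?a k * (1 / (1 - cnj (l k) * l j)))"
  proof (intro sums_sum sums_mult geometric_sums)
    fix j k assume jk: "j \<in> I" "k \<in> I"
    have "cmod (l k) * cmod (l j) < 1 * 1"
      using l[OF jk(1)] l[OF jk(2)] by (intro mult_strict_mono') auto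
    then show "norm (cnj (l k) * l j) < 1" by (simp add: norm_mult)
  qed
  also have "(\<Sum>j\<in>I. \<Sum>k\<in>I. cnj (?a j) * ?a k * (1 / (1 - cnj (l k) * l j))) = complex_of_real (mean_square (kernel_sum I l g))"
    unfolding mean_square_kernel_sum by (simp add: kernel_sum_def szego_def sum_distrib_left mult_ac)
  finally have "(\<lambda>n. \<Sum>j\<in>I. \<Sum>k\<in>I. cnj (?a j) * ?a k * (cnj (l k) * l j) ^ n) sums complex_of_real (mean_square (kernel_sum I l g))" .
  moreover have "(\<Sum>j\<in>I. \<Sum>k\<in>I. cnj (?a j) * ?a k * (cnj (l k) * l j) ^ n)
      = complex_of_real ((cmod (\<Sum>j\<in>I. ?a j * cnj (l j) ^ n))\<^sup>2)" for n
  proof -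
    have "complex_of_real ((cmod (\<Sum>j\<in>I. ?a j * cnj (l j) ^ n))\<^sup>2)
      = cnj (\<Sum>j\<in>I. ?a j * cnj (l j) ^ n) * (\<Sum>k\<in>I. ?a k * cnj (l k) ^ n)"
      by (simp only: complex_norm_square mult.commute)
    also have "\<dots> = (\<Sum>j\<in>I. \<Sum>k\<in>I. cnj (?a j * cnj (l j) ^ n) * (?a k * cnj (l k) ^ n))"
      by (simp only: cnj_sum sum_product)
    also have "\<dots> = (\<Sum>j\<in>I. \<Sum>k\<in>I. cnj (?a j) * ?a k * (cnj (l k) * l j) ^ n)"
      by (intro sum.cong refl) (simp add: power_mult_distrib mult_ac)
    finally show ?thesis by simp
  qed
  ultimately show ?thesis by (simp only: sums_of_real_iff)
qed

end

lemma gap_mult_szego: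
  assumes "cmod w < 1" "cmod z < 1"
  shows "(1 - (cmod w)\<^sup>2) * (1 - (cmod z)\<^sup>2) * (cmod (szego w z))\<^sup>2 = 1 - (cmod ((z - w) * szego w z))\<^sup>2"
proof -
  have nz: "1 - cnj w * z \<noteq> 0" using assms by (intro szego_nonzero) auto
  have "(cmod (1 - cnj w * z))\<^sup>2 - (cmod (z - w))\<^sup>2 = (1 - (cmod w)\<^sup>2) * (1 - (cmod z)\<^sup>2)"
    by (simp add: cmod_power2) (simp add: power2_eq_square algebra_simps)
  then show ?thesis using nz by (simp add: szego_def norm_mult norm_divide power_divide power_mult_distrib field_simps)
qed

text \<open>
  The off-diagonal terms are \<open>1 - \<rho>\<^sup>2\<close> for the pseudohyperbolic distances \<open>\<rho>\<close>. The estimate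
  \<open>1 - \<rho>\<^sup>2 \<le> - ln (\<rho>\<^sup>2)\<close> turns the lower bound for the product of the distances into an upper
  bound for the sum.
\<close>

lemma sum_gap_szego_le:
  assumes I: "finite I" and l: "\<And>j. j \<in> I \<Longrightarrow> cmod (l j) < 1" and \<delta>: "0 < \<delta>"
    and j: "j \<in> I" and sep: "\<delta> \<le> cmod (blaschke I l j (l j))"
  shows "(\<Sum>k\<in>I. gap (l j) * gap (l k) * (cmod (szego (l k) (l j)))\<^sup>2) \<le> 1 - 2 * ln \<delta>"
proof -
  let ?\<rho> = "\<lambda>k. (cmod ((l j - l k) * szego (l k) (l j)))\<^sup>2"
  have eq: "gap (l j) * gap (l k) * (cmod (szego (l k) (l j)))\<^sup>2 = 1 - ?\<rho> k" if "k \<in> I" for k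
    using gap_mult_szego[OF l[OF that] l[OF j]] by (simp add: gap_def mult_ac)
  have "\<delta>\<^sup>2 \<le> (cmod (blaschke I l j (l j)))\<^sup>2" using \<delta> sep by (intro power_mono) auto
  also have "\<dots> = (\<Prod>k\<in>I - {j}. ?\<rho> k)"
    unfolding blaschke_def prod_norm[symmetric] by (rule prod_power_distrib)
  also have "\<dots> \<le> (\<Prod>k\<in>I - {j}. exp (?\<rho> k - 1))"
  proof (rule prod_mono)
    show "0 \<le> ?\<rho> k \<and> ?\<rho> k \<le> exp (?\<rho> k - 1)" for k
      using exp_ge_add_one_self[of "?\<rho> k - 1"] by simp
  qed
  also have "\<dots> = exp (\<Sum>k\<in>I - {j}. ?\<rho> k - 1)" using I by (simp add: exp_sum)
  finally have "ln (\<delta>\<^sup>2) \<le> (\<Sum>k\<in>I - {j}. ?\<rho> k - 1)"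
    using \<delta> ln_le_cancel_iff[of "\<delta>\<^sup>2" "exp (\<Sum>k\<in>I - {j}. ?\<rho> k - 1)"] by (simp only: ln_exp exp_gt_zero zero_less_power)
  then have "(\<Sum>k\<in>I - {j}. 1 - ?\<rho> k) \<le> - 2 * ln \<delta>"
    using \<delta> by (simp add: ln_realpow sum_subtractf)
  moreover have "(\<Sum>k\<in>I. gap (l j) * gap (l k) * (cmod (szego (l k) (l j)))\<^sup>2) = (\<Sum>k\<in>I. 1 - ?\<rho> k)"
    using eq by (intro sum.cong) auto
  moreover have "(\<Sum>k\<in>I. 1 - ?\<rho> k) = (1 - ?\<rho> j) + (\<Sum>k\<in>I - {j}. 1 - ?\<rho> k)"
    using I j by (rule sum.remove)
  ultimately show ?thesis by simp
qed

section \<open>Uniformly separated sequences\<close>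

text \<open>
  The finite products decrease to the infinite one, so the separation constant bounds all of them.
\<close>

lemma uniformly_separatedD:
  assumes "uniformly_separated l"
  obtains \<delta> where "0 < \<delta>" "\<And>N j. \<delta> \<le> cmod (blaschke {..<N} l j (l j))"
proof -
  have l: "cmod (l j) < 1" for j using assms by (simp add: uniformly_separated_def)
  define a where "a j N = (\<Prod>k\<in>{..<N} - {j}. cmod ((l j - l k) / (1 - cnj (l k) * l j)))" for j N
  have a: "a j N = cmod (blaschke {..<N} l j (l j))" for j N
    by (simp add: a_def blaschke_def szego_def prod_norm)
  have factor: "cmod ((l j - l k) / (1 - cnj (l k) * l j)) \<le> 1" for j k
  proof -
    have "0 \<le> (1 - (cmod (l k))\<^sup>2) * (1 - (cmod (l j))\<^sup>2) * (cmod (szego (l k) (l j)))\<^sup>2"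
      using gap_pos[OF l, of k] gap_pos[OF l, of j] by (simp add: gap_def)
    also have "\<dots> = 1 - (cmod ((l j - l k) * szego (l k) (l j)))\<^sup>2" by (rule gap_mult_szego[OF l l])
    finally have "(cmod ((l j - l k) * szego (l k) (l j)))\<^sup>2 \<le> 1\<^sup>2" by simp
    then have "cmod ((l j - l k) * szego (l k) (l j)) \<le> 1" by (rule power2_le_imp_le) simp
    then show ?thesis by (simp add: szego_def)
  qed
  have nonneg: "0 \<le> a j N" for j N by (simp add: a)
  have dec: "decseq (a j)" for j
  proof (rule decseq_SucI)
    fix N
    show "a j (Suc N) \<le> a j N"
    proof (cases "N = j")
      case True
      then have "{..<Suc N} - {j} = {..<N} - {j}" by auto
      then show ?thesis by (simp add: a_def)
    next
      case False
      then have "{..<Suc N} - {j} = insert N ({..<N} - {j})" by auto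
      then have "a j (Suc N) = cmod ((l j - l N) / (1 - cnj (l N) * l j)) * a j N"
        by (simp add: a_def)
      also have "\<dots> \<le> 1 * a j N" using factor nonneg by (intro mult_right_mono)
      finally show ?thesis by simp
    qed
  qed
  have lim: "a j \<longlonglongrightarrow> lim (a j)" for j
  proof -
    obtain L where "a j \<longlonglongrightarrow> L"
      by (rule decseq_convergent[OF dec[of j], of 0]) (use nonneg in auto)
    then have "convergent (a j)" by (rule convergentI)
    then show ?thesis by (simp add: convergent_LIMSEQ_iff)
  qed
  have lim0: "0 \<le> lim (a j)" for j using lim by (rule LIMSEQ_le_const) (use nonneg in auto)
  define \<delta> where "\<delta> = (INF j. lim (a j))"
  have "0 < \<delta>" using assms unfolding uniformly_separated_def \<delta>_def a_def[abs_def] by simp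
  moreover have "\<delta> \<le> cmod (blaschke {..<N} l j (l j))" for N j
  proof -
    have "\<delta> \<le> lim (a j)" unfolding \<delta>_def
      by (rule cINF_lower[OF bdd_belowI2[of UNIV 0]]) (use lim0 in auto)
    also have "\<dots> \<le> a j N" using dec lim by (rule decseq_ge)
    finally show ?thesis by (simp add: a)
  qed
  ultimately show ?thesis by (rule that)
qed

lemma finite_riesz_bounds:
  fixes l :: "nat \<Rightarrow> complex"
  assumes l: "\<And>j. cmod (l j) < 1"
    and \<delta>: "0 < \<delta>" "\<And>N j. \<delta> \<le> cmod (blaschke {..<N} l j (l j))"
  defines "M \<equiv> exp (2 * (1 - 2 * ln \<delta>))"
  shows "\<exists>Q. (\<lambda>n. (cmod (\<Sum>j<N. g j * complex_of_real (sqrt (gap (l j))) * cnj (l j) ^ n))\<^sup>2) sums Q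
      \<and> \<delta>\<^sup>2 / M * (\<Sum>j<N. (cmod (g j))\<^sup>2) \<le> Q \<and> Q \<le> M * (\<Sum>j<N. (cmod (g j))\<^sup>2)"
proof (intro exI conjI)
  let ?I = "{..<N} :: nat set"
  have K: "(\<Sum>k\<in>?I. gap (l j) * gap (l k) * (cmod (szego (l k) (l j)))\<^sup>2) \<le> 1 - 2 * ln \<delta>" if "j \<in> ?I" for j
    by (rule sum_gap_szego_le) (use l \<delta> that in auto)
  show "(\<lambda>n. (cmod (\<Sum>j<N. g j * complex_of_real (sqrt (gap (l j))) * cnj (l j) ^ n))\<^sup>2) sums mean_square (kernel_sum ?I l g)"
    by (rule moments_sums_mean_square[where K = "1 - 2 * ln \<delta>"]) (use l K in auto)
  show "\<delta>\<^sup>2 / M * (\<Sum>j<N. (cmod (g j))\<^sup>2) \<le> mean_square (kernel_sum ?I l g)"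
    unfolding M_def by (rule mean_square_kernel_sum_ge) (use l K \<delta> in auto)
  show "mean_square (kernel_sum ?I l g) \<le> M * (\<Sum>j<N. (cmod (g j))\<^sup>2)"
    unfolding M_def by (rule mean_square_kernel_sum_le) (use l K in auto)
qed

text \<open>
  The upper bound passes to the limit termwise. It then also bounds the contribution of the tail of
  \<open>x\<close>, so that the lower bound for the truncations loses at most a factor 2 in the limit.
\<close>

lemma riesz_bounds_limit:
  fixes v :: "nat \<Rightarrow> nat \<Rightarrow> complex"
  assumes B: "0 \<le> B"
    and fin: "\<And>x N. \<exists>Q. (\<lambda>n. (cmod (\<Sum>j<N. x j * v j n))\<^sup>2) sums Q
        \<and> A * (\<Sum>j<N. (cmod (x j))\<^sup>2) \<le> Q \<and> Q \<le> B * (\<Sum>j<N. (cmod (x j))\<^sup>2)"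
    and x: "summable (\<lambda>j. (cmod (x j))\<^sup>2)" and F: "\<And>n. (\<lambda>j. x j * v j n) sums F n"
  shows "summable (\<lambda>n. (cmod (F n))\<^sup>2)"
    and "A / 2 * (\<Sum>j. (cmod (x j))\<^sup>2) \<le> (\<Sum>n. (cmod (F n))\<^sup>2)"
    and "(\<Sum>n. (cmod (F n))\<^sup>2) \<le> B * (\<Sum>j. (cmod (x j))\<^sup>2)"
proof -
  have upper: "summable (\<lambda>n. (cmod (G n))\<^sup>2) \<and> (\<Sum>n. (cmod (G n))\<^sup>2) \<le> B * (\<Sum>j. (cmod (y j))\<^sup>2)"
    if y: "summable (\<lambda>j. (cmod (y j))\<^sup>2)" and G: "\<And>n. (\<lambda>j. y j * v j n) sums G n" for y G
  proof -
    have part: "(\<Sum>n<m. (cmod (G n))\<^sup>2) \<le> B * (\<Sum>j. (cmod (y j))\<^sup>2)" for m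
    proof (rule LIMSEQ_le_const2)
      show "(\<lambda>N. \<Sum>n<m. (cmod (\<Sum>j<N. y j * v j n))\<^sup>2) \<longlonglongrightarrow> (\<Sum>n<m. (cmod (G n))\<^sup>2)"
        using G unfolding sums_def by (intro tendsto_intros)
      show "\<exists>N0. \<forall>N\<ge>N0. (\<Sum>n<m. (cmod (\<Sum>j<N. y j * v j n))\<^sup>2) \<le> B * (\<Sum>j. (cmod (y j))\<^sup>2)"
      proof (intro exI allI impI)
        fix N :: nat
        obtain Q where Q: "(\<lambda>n. (cmod (\<Sum>j<N. y j * v j n))\<^sup>2) sums Q" "Q \<le> B * (\<Sum>j<N. (cmod (y j))\<^sup>2)"
          using fin[where x = y and N = N] by blast
        have "(\<Sum>n<m. (cmod (\<Sum>j<N. y j * v j n))\<^sup>2) \<le> (\<Sum>n. (cmod (\<Sum>j<N. y j * v j n))\<^sup>2)"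
          using Q(1) by (intro sum_le_suminf) (auto simp: sums_iff)
        also have "\<dots> = Q" using Q(1) by (simp add: sums_iff)
        also have "\<dots> \<le> B * (\<Sum>j<N. (cmod (y j))\<^sup>2)" by (rule Q)
        also have "\<dots> \<le> B * (\<Sum>j. (cmod (y j))\<^sup>2)"
          using B y by (intro mult_left_mono sum_le_suminf) auto
        finally show "(\<Sum>n<m. (cmod (\<Sum>j<N. y j * v j n))\<^sup>2) \<le> B * (\<Sum>j. (cmod (y j))\<^sup>2)" .
      qed
    qed
    have "summable (\<lambda>n. (cmod (G n))\<^sup>2)"
    proof (rule summableI_nonneg_bounded)
      show "(\<Sum>n<m. (cmod (G n))\<^sup>2) \<le> B * (\<Sum>j. (cmod (y j))\<^sup>2)" for m by (rule part)
    qed simp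
    then show ?thesis using part by (auto intro: suminf_le_const)
  qed
  show sF: "summable (\<lambda>n. (cmod (F n))\<^sup>2)" and "(\<Sum>n. (cmod (F n))\<^sup>2) \<le> B * (\<Sum>j. (cmod (x j))\<^sup>2)"
    using upper[OF x F] by auto
  let ?X = "\<Sum>j. (cmod (x j))\<^sup>2" and ?S = "\<Sum>n. (cmod (F n))\<^sup>2"
  have lower: "A * (\<Sum>j<N. (cmod (x j))\<^sup>2) \<le> 2 * ?S + 2 * (B * (?X - (\<Sum>j<N. (cmod (x j))\<^sup>2)))" for N
  proof -
    define y where "y j = (if j < N then 0 else x j)" for j
    define FN where "FN n = (\<Sum>j<N. x j * v j n)" for n
    obtain Q where Q: "(\<lambda>n. (cmod (FN n))\<^sup>2) sums Q" "A * (\<Sum>j<N. (cmod (x j))\<^sup>2) \<le> Q"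
      using fin[where x = x and N = N] unfolding FN_def by blast
    have "(\<lambda>j. if j < N then (cmod (x j))\<^sup>2 else 0) sums (\<Sum>j<N. (cmod (x j))\<^sup>2)"
      using sums_If_finite_set[of "{..<N}" "\<lambda>j. (cmod (x j))\<^sup>2"] by simp
    from sums_diff[OF summable_sums[OF x] this]
    have y: "(\<lambda>j. (cmod (y j))\<^sup>2) sums (?X - (\<Sum>j<N. (cmod (x j))\<^sup>2))"
      by (rule sums_cong[THEN iffD1, rotated]) (simp add: y_def)
    have G: "(\<lambda>j. y j * v j n) sums (F n - FN n)" for n
    proof -
      have "(\<lambda>j. if j < N then x j * v j n else 0) sums FN n"
        using sums_If_finite_set[of "{..<N}" "\<lambda>j. x j * v j n"] by (simp add: FN_def)
      from sums_diff[OF F this] show ?thesis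
        by (rule sums_cong[THEN iffD1, rotated]) (simp add: y_def)
    qed
    have GG: "summable (\<lambda>n. (cmod (F n - FN n))\<^sup>2)"
      "(\<Sum>n. (cmod (F n - FN n))\<^sup>2) \<le> B * (?X - (\<Sum>j<N. (cmod (x j))\<^sup>2))"
      using upper[OF sums_summable[OF y] G] y by (auto simp: sums_iff)
    have "Q = (\<Sum>n. (cmod (FN n))\<^sup>2)" using Q(1) by (simp add: sums_iff)
    also have "\<dots> \<le> (\<Sum>n. 2 * (cmod (F n))\<^sup>2 + 2 * (cmod (F n - FN n))\<^sup>2)"
    proof (rule suminf_le)
      fix n
      have "(cmod (FN n))\<^sup>2 \<le> (cmod (F n) + cmod (F n - FN n))\<^sup>2"
        using norm_triangle_ineq4[of "F n" "F n - FN n"] by (intro power_mono) auto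
      then show "(cmod (FN n))\<^sup>2 \<le> 2 * (cmod (F n))\<^sup>2 + 2 * (cmod (F n - FN n))\<^sup>2"
        using sum_squares_bound[of "cmod (F n)" "cmod (F n - FN n)"] by (simp add: power2_sum)
    qed (use Q(1) sF GG(1) in \<open>auto simp: sums_iff intro!: summable_add summable_mult\<close>)
    also have "\<dots> = 2 * ?S + 2 * (\<Sum>n. (cmod (F n - FN n))\<^sup>2)"
      using sF GG(1) by (subst suminf_add[symmetric]) (auto simp: suminf_mult intro: summable_mult)
    finally show ?thesis using Q(2) GG(2) by linarith
  qed
  have lim: "(\<lambda>N. \<Sum>j<N. (cmod (x j))\<^sup>2) \<longlonglongrightarrow> ?X" using x by (rule summable_LIMSEQ)
  have "A * ?X \<le> 2 * ?S + 2 * (B * (?X - ?X))"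
  proof (rule LIMSEQ_le)
    show "(\<lambda>N. A * (\<Sum>j<N. (cmod (x j))\<^sup>2)) \<longlonglongrightarrow> A * ?X" by (intro tendsto_intros lim)
    show "(\<lambda>N. 2 * ?S + 2 * (B * (?X - (\<Sum>j<N. (cmod (x j))\<^sup>2)))) \<longlonglongrightarrow> 2 * ?S + 2 * (B * (?X - ?X))"
      by (intro tendsto_intros lim)
  qed (use lower in blast)
  then show "A / 2 * ?X \<le> ?S" by simp
qed

text \<open>
  Dividing \<open>cnj (c j)\<close> by the square root of \<open>gap (l j)\<close> leaves factors that are bounded above and
  below, which reduces the claim to normalized kernels.
\<close>

theorem uniformly_separated_frame_bounds:
  assumes sep: "uniformly_separated l"
    and comp: "comparable (\<lambda>n. (cmod (c n))\<^sup>2) (\<lambda>n. 1 - (cmod (l n))\<^sup>2)"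
  obtains A B where "0 < A" "0 < B"
    "\<forall>x F. summable (\<lambda>j. (cmod (x j))\<^sup>2) \<longrightarrow> (\<forall>n. (\<lambda>j. x j * cnj (l j ^ n * c j)) sums F n) \<longrightarrow>
       summable (\<lambda>n. (cmod (F n))\<^sup>2) \<and> A * (\<Sum>j. (cmod (x j))\<^sup>2) \<le> (\<Sum>n. (cmod (F n))\<^sup>2) \<and>
       (\<Sum>n. (cmod (F n))\<^sup>2) \<le> B * (\<Sum>j. (cmod (x j))\<^sup>2)"
proof -
  have l: "cmod (l j) < 1" for j using sep by (simp add: uniformly_separated_def)
  obtain \<delta> where \<delta>: "0 < \<delta>" "\<And>N j. \<delta> \<le> cmod (blaschke {..<N} l j (l j))"
    using uniformly_separatedD[OF sep] by blast
  obtain a b where ab: "0 < a" "0 < b" "\<And>j. a * (cmod (c j))\<^sup>2 \<le> gap (l j)" "\<And>j. gap (l j) \<le> b * (cmod (c j))\<^sup>2"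
    using comp by (auto simp: comparable_def gap_def)
  define M where "M = exp (2 * (1 - 2 * ln \<delta>))"
  have M: "0 < M" by (simp add: M_def)
  define A where "A = \<delta>\<^sup>2 / M / b"
  define B where "B = M / a"
  have A: "0 < A" and B: "0 < B" using \<delta>(1) M ab by (simp_all add: A_def B_def)
  have fin: "\<exists>Q. (\<lambda>n. (cmod (\<Sum>j<N. x j * cnj (l j ^ n * c j)))\<^sup>2) sums Q
        \<and> A * (\<Sum>j<N. (cmod (x j))\<^sup>2) \<le> Q \<and> Q \<le> B * (\<Sum>j<N. (cmod (x j))\<^sup>2)" for x N
  proof -
    define g where "g j = x j * cnj (c j) / complex_of_real (sqrt (gap (l j)))" for j
    have gp: "0 < gap (l j)" for j using l by (rule gap_pos)
    have eq: "g j * complex_of_real (sqrt (gap (l j))) * cnj (l j) ^ n = x j * cnj (l j ^ n * c j)" for j n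
      using gp[of j] by (simp add: g_def mult_ac)
    obtain Q where Q: "(\<lambda>n. (cmod (\<Sum>j<N. x j * cnj (l j ^ n * c j)))\<^sup>2) sums Q"
      "\<delta>\<^sup>2 / M * (\<Sum>j<N. (cmod (g j))\<^sup>2) \<le> Q" "Q \<le> M * (\<Sum>j<N. (cmod (g j))\<^sup>2)"
      using finite_riesz_bounds[OF l \<delta>, where g = g and N = N]
      unfolding M_def[symmetric] eq by blast
    have g2: "(cmod (g j))\<^sup>2 = (cmod (x j))\<^sup>2 * ((cmod (c j))\<^sup>2 / gap (l j))" for j
      using gp[of j] by (simp add: g_def norm_mult norm_divide power_mult_distrib power_divide)
    have up: "(cmod (g j))\<^sup>2 \<le> (cmod (x j))\<^sup>2 * (1 / a)" for j
      unfolding g2 using ab(1) ab(3)[of j] gp[of j] by (intro mult_left_mono) (auto simp: field_simps)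
    have lo: "(cmod (x j))\<^sup>2 * (1 / b) \<le> (cmod (g j))\<^sup>2" for j
      unfolding g2 using ab(2) ab(4)[of j] gp[of j] by (intro mult_left_mono) (auto simp: field_simps)
    have "M * (\<Sum>j<N. (cmod (g j))\<^sup>2) \<le> M * (\<Sum>j<N. (cmod (x j))\<^sup>2 * (1 / a))"
      using M up by (intro mult_left_mono sum_mono) auto
    also have "\<dots> = B * (\<Sum>j<N. (cmod (x j))\<^sup>2)" by (simp add: B_def sum_divide_distrib[symmetric])
    finally have 1: "Q \<le> B * (\<Sum>j<N. (cmod (x j))\<^sup>2)" using Q(3) by linarith
    have "A * (\<Sum>j<N. (cmod (x j))\<^sup>2) = \<delta>\<^sup>2 / M * (\<Sum>j<N. (cmod (x j))\<^sup>2 * (1 / b))"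
      by (simp add: A_def sum_divide_distrib[symmetric])
    also have "\<dots> \<le> \<delta>\<^sup>2 / M * (\<Sum>j<N. (cmod (g j))\<^sup>2)"
      using M lo by (intro mult_left_mono sum_mono) auto
    finally have "A * (\<Sum>j<N. (cmod (x j))\<^sup>2) \<le> Q" using Q(2) by linarith
    then show ?thesis using Q(1) 1 by blast
  qed
  show ?thesis
  proof (rule that[of "A / 2" B])
    show "0 < A / 2" "0 < B" using A B by auto
    show "\<forall>x F. summable (\<lambda>j. (cmod (x j))\<^sup>2) \<longrightarrow> (\<forall>n. (\<lambda>j. x j * cnj (l j ^ n * c j)) sums F n) \<longrightarrow>
       summable (\<lambda>n. (cmod (F n))\<^sup>2) \<and> A / 2 * (\<Sum>j. (cmod (x j))\<^sup>2) \<le> (\<Sum>n. (cmod (F n))\<^sup>2) \<and>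
       (\<Sum>n. (cmod (F n))\<^sup>2) \<le> B * (\<Sum>j. (cmod (x j))\<^sup>2)"
    proof (intro allI impI)
      fix x F
      assume *: "summable (\<lambda>j. (cmod (x j))\<^sup>2)" "\<forall>n. (\<lambda>j. x j * cnj (l j ^ n * c j)) sums F n"
      note bounds = riesz_bounds_limit[where v = "\<lambda>j n. cnj (l j ^ n * c j)",
          OF less_imp_le[OF B] fin *(1) *(2)[rule_format]]
      show "summable (\<lambda>n. (cmod (F n))\<^sup>2) \<and> A / 2 * (\<Sum>j. (cmod (x j))\<^sup>2) \<le> (\<Sum>n. (cmod (F n))\<^sup>2) \<and>
       (\<Sum>n. (cmod (F n))\<^sup>2) \<le> B * (\<Sum>j. (cmod (x j))\<^sup>2)"
        by (rule conjI[OF bounds(1) conjI[OF bounds(2,3)]])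
    qed
  qed
qed

section \<open>The operator R and its orbit\<close>

lemma T_L2_on_coeff:
  assumes s: "bij s" and l: "\<And>n. cmod (l n) < 1" and h: "h \<in> L2_on torus D"
  shows "T s l h \<in> L2_on torus D"
    and "L2_ip torus (T s l h) (psi_tilde s n) = l n * L2_ip torus h (psi_tilde s n)"
proof -
  let ?c = "\<lambda>n. L2_ip torus h (psi_tilde s n)"
  let ?u = "\<lambda>N \<tau>. \<Sum>n<N. l n * ?c n * psi_tilde s n \<tau>"
  have on: "orthonormal torus (psi_tilde s)" using s by (rule psi_tilde_orthonormal)
  have "summable (\<lambda>n. (cmod (?c n))\<^sup>2)" by (rule orthonormal_bessel_summable[OF on L2_on_L2[OF h]])
  then have sm: "summable (\<lambda>n. (cmod (l n * ?c n))\<^sup>2)"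
  proof (rule summable_comparison_test'[where N = 0])
    fix n
    have "cmod (l n * ?c n) \<le> 1 * cmod (?c n)"
      unfolding norm_mult using l[of n] by (intro mult_right_mono) auto
    then have "(cmod (l n * ?c n))\<^sup>2 \<le> (cmod (?c n))\<^sup>2" by (intro power_mono) auto
    then show "norm ((cmod (l n * ?c n))\<^sup>2) \<le> (cmod (?c n))\<^sup>2" by simp
  qed
  obtain g where g: "L2_lim torus sequentially ?u g" "\<And>n. L2_ip torus g (psi_tilde s n) = l n * ?c n"
    by (rule riesz_fischer[OF on sm]) (rule that)
  have T: "L2_lim torus sequentially ?u (T s l h)"
    unfolding T_def using g(1) by (rule someI[of "L2_lim torus sequentially ?u"])
  show TD: "T s l h \<in> L2_on torus D"
  proof (rule L2_on_closed[OF T])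
    have "?u N \<in> L2_on torus D" for N
      by (rule L2_on_lincomb[OF finite_lessThan psi_tilde_L2_on])
    then show "\<forall>\<^sub>F N in sequentially. ?u N \<in> L2_on torus D" by (intro always_eventually allI)
    show "D \<inter> space torus \<in> sets torus" using D_sets by (rule sets.Int) (rule sets.top)
  qed simp
  have "AE x in torus. T s l h x = g x" using L2_lim_unique[OF T g(1)] by simp
  then have "L2_ip torus (T s l h) (psi_tilde s n) = L2_ip torus g (psi_tilde s n)"
    using g(1) L2_on_L2[OF TD] L2_on_L2[OF psi_tilde_L2_on]
    by (intro L2_ip_AE_cong) (auto simp: L2_lim_def)
  then show "L2_ip torus (T s l h) (psi_tilde s n) = l n * ?c n" by (simp add: g(2))
qed

lemma GPW1_subset: "GPW1 \<subseteq> L2 ell2"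
  by (auto simp: GPW1_def)

lemma fourier_inv_GPW1:
  assumes g: "g \<in> L2_on torus Omega2"
  shows "fourier_inv g \<in> GPW1"
proof -
  have gL: "g \<in> L2 torus" using g by (rule L2_on_L2)
  note inv = L2_inverse_unitary[OF fourier_unitary gL, folded fourier_inv_def]
  have "AE x in torus. x \<notin> Omega2 \<longrightarrow> g x = 0" using g by (simp add: L2_on_def)
  then have "AE x in torus. x \<notin> Omega2 \<longrightarrow> fourier (fourier_inv g) x = 0"
    using inv(2) by eventually_elim auto
  then show ?thesis using inv(1) by (simp add: GPW1_def L2_on_def fourier_L2)
qed

lemma S_fourier_L2_on: "f \<in> GPW1 \<Longrightarrow> S (fourier f) \<in> L2_on torus D"
  by (rule S_in_L2_on_D[OF fourier_L2[OF subsetD[OF GPW1_subset]]])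

lemma S_inv_L2_on: "h \<in> L2_on torus D \<Longrightarrow> S_inv h \<in> L2_on torus Omega2"
  unfolding S_inv_def by (rule L2_inverse_unitary(1)[OF S_unitary])

lemma ip_fourier_inv_psi:
  assumes f: "f \<in> GPW1"
  shows "L2_ip ell2 f (fourier_inv (psi s n)) = L2_ip torus (fourier f) (psi s n)"
    and "L2_ip ell2 f (fourier_inv (psi s n)) = L2_ip torus (S (fourier f)) (psi_tilde s n)"
proof -
  have fo: "fourier f \<in> L2_on torus Omega2" using f by (simp add: GPW1_def)
  show *: "L2_ip ell2 f (fourier_inv (psi s n)) = L2_ip torus (fourier f) (psi s n)"
    unfolding fourier_inv_def using f GPW1_subset
    by (intro L2_ip_inverse_unitary(1)[OF fourier_unitary] L2_on_L2[OF psi_L2_on]) auto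
  also have "\<dots> = L2_ip torus (S (fourier f)) (S (psi s n))"
    by (rule S_inner[OF fo psi_L2_on, symmetric])
  also have "\<dots> = L2_ip torus (S (fourier f)) (psi_tilde s n)"
    using L2_on_L2[OF S_fourier_L2_on[OF f]] S_L2[OF L2_on_L2[OF psi_L2_on]] L2_on_L2[OF psi_tilde_L2_on] S_psi
    by (intro L2_ip_AE_cong) auto
  finally show "L2_ip ell2 f (fourier_inv (psi s n)) = L2_ip torus (S (fourier f)) (psi_tilde s n)" .
qed

lemma ip_pullback:
  assumes h: "h \<in> L2_on torus D"
  shows "L2_ip ell2 (fourier_inv (S_inv h)) (fourier_inv (psi s n)) = L2_ip torus h (psi_tilde s n)"
proof -
  have "L2_ip ell2 (fourier_inv (S_inv h)) (fourier_inv (psi s n)) = L2_ip torus (S_inv h) (psi s n)"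
    unfolding fourier_inv_def
    by (rule L2_ip_inverse_inverse_unitary[OF fourier_unitary L2_on_L2[OF S_inv_L2_on[OF h]] L2_on_L2[OF psi_L2_on]])
  also have "\<dots> = L2_ip torus h (S (psi s n))"
    unfolding S_inv_def by (rule L2_ip_inverse_unitary(2)[OF S_unitary psi_L2_on h])
  also have "\<dots> = L2_ip torus h (psi_tilde s n)"
    using L2_on_L2[OF h] S_L2[OF L2_on_L2[OF psi_L2_on]] L2_on_L2[OF psi_tilde_L2_on] S_psi
    by (intro L2_ip_AE_cong) auto
  finally show ?thesis .
qed

theorem fourier_inv_psi_basis:
  assumes s: "bij s"
  shows "orthonormal_basis ell2 GPW1 (\<lambda>n. fourier_inv (psi s n))"
proof -
  note psi = psi_basis[OF s, unfolded orthonormal_basis_iff_parseval[OF L2_on_subset_L2]]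
  have mem: "fourier_inv (psi s n) \<in> GPW1" for n by (rule fourier_inv_GPW1[OF psi_L2_on])
  have on: "orthonormal ell2 (\<lambda>n. fourier_inv (psi s n))"
    unfolding orthonormal_def
  proof (intro conjI allI)
    show "fourier_inv (psi s n) \<in> L2 ell2" for n by (rule subsetD[OF GPW1_subset mem])
    have "orthonormal torus (psi s)" using psi by (rule conjunct2[THEN conjunct1])
    then show "L2_ip ell2 (fourier_inv (psi s m)) (fourier_inv (psi s n)) = (if m = n then 1 else 0)" for m n
      unfolding fourier_inv_def L2_ip_inverse_inverse_unitary[OF fourier_unitary L2_on_L2[OF psi_L2_on] L2_on_L2[OF psi_L2_on]]
      by (simp add: orthonormal_def)
  qed
  have parseval: "(\<lambda>n. (cmod (L2_ip ell2 f (fourier_inv (psi s n))))\<^sup>2) sums (L2_norm ell2 f)\<^sup>2" if f: "f \<in> GPW1" for f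
  proof -
    have f': "f \<in> L2 ell2" "fourier f \<in> L2_on torus Omega2" using f by (auto simp: GPW1_def)
    from psi have "\<forall>g\<in>L2_on torus Omega2. (\<lambda>n. (cmod (L2_ip torus g (psi s n)))\<^sup>2) sums (L2_norm torus g)\<^sup>2"
      by (rule conjunct2[THEN conjunct2])
    from bspec[OF this f'(2)] show ?thesis
      unfolding ip_fourier_inv_psi(1)[OF f] L2_unitary_norm[OF fourier_unitary f'(1)] .
  qed
  show ?thesis
    unfolding orthonormal_basis_iff_parseval[OF GPW1_subset]
    by (rule conjI[OF allI[OF mem] conjI[OF on ballI[OF parseval]]])
qed

context
  fixes s :: "nat \<Rightarrow> int \<times> int" and l :: "nat \<Rightarrow> complex"
  assumes s: "bij s" and l: "\<And>n. cmod (l n) < 1"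
begin

lemma R_GPW1: "f \<in> GPW1 \<Longrightarrow> R s l f \<in> GPW1"
  unfolding R_def
  by (rule fourier_inv_GPW1[OF S_inv_L2_on[OF T_L2_on_coeff(1)[where l = l, OF s l S_fourier_L2_on]]])

lemma R_coeff:
  assumes f: "f \<in> GPW1"
  shows "L2_ip ell2 (R s l f) (fourier_inv (psi s n)) = l n * L2_ip ell2 f (fourier_inv (psi s n))"
proof -
  note T = T_L2_on_coeff[where l = l, OF s l S_fourier_L2_on[OF f]]
  show ?thesis unfolding R_def ip_pullback[OF T(1)] T(2) ip_fourier_inv_psi(2)[OF f] ..
qed

lemma R_expansion:
  assumes f: "f \<in> GPW1"
  shows "L2_lim ell2 sequentially
    (\<lambda>N k. \<Sum>n<N. l n * L2_ip ell2 f (fourier_inv (psi s n)) * fourier_inv (psi s n) k) (R s l f)"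
proof -
  note basis = fourier_inv_psi_basis[OF s, unfolded orthonormal_basis_def, THEN conjunct2, THEN conjunct2]
  from bspec[OF basis R_GPW1[OF f]] show ?thesis unfolding R_coeff[OF f] .
qed

lemma R_iterate:
  assumes f: "f \<in> GPW1"
  shows "(R s l ^^ n) f \<in> GPW1"
    and "L2_ip ell2 ((R s l ^^ n) f) (fourier_inv (psi s j)) = l j ^ n * L2_ip ell2 f (fourier_inv (psi s j))"
proof -
  have mem: "(R s l ^^ n) f \<in> GPW1" for n
  proof (induction n)
    case (Suc n)
    show ?case unfolding funpow.simps o_apply using Suc.IH by (rule R_GPW1)
  qed (simp only: funpow_0 f)
  then show "(R s l ^^ n) f \<in> GPW1" .
  show "L2_ip ell2 ((R s l ^^ n) f) (fourier_inv (psi s j)) = l j ^ n * L2_ip ell2 f (fourier_inv (psi s j))"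
  proof (induction n)
    case (Suc n)
    show ?case unfolding funpow.simps o_apply R_coeff[OF mem] Suc.IH power_Suc mult.assoc ..
  qed (simp only: funpow_0 power_0 mult_1_left)
qed

end

text \<open>
  In the transported basis the orbit has the coefficients \<open>l j ^ n * c j\<close> with
  \<open>c j = \<langle>h0, psi_tilde s j\<rangle>\<close>, so the frame inequality is the estimate for uniformly separated
  sequences.
\<close>

lemma R_orbit_frame:
  assumes s: "bij s" and sep: "uniformly_separated l" and h0: "h0 \<in> L2_on torus D"
    and comp: "comparable (\<lambda>n. (cmod (L2_ip torus h0 (psi_tilde s n)))\<^sup>2) (\<lambda>n. 1 - (cmod (l n))\<^sup>2)"
  shows "is_frame ell2 GPW1 (\<lambda>n. (R s l ^^ n) (fourier_inv (S_inv h0)))"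
proof -
  have l: "cmod (l n) < 1" for n using sep by (simp add: uniformly_separated_def)
  let ?f = "fourier_inv (S_inv h0)" and ?\<phi> = "\<lambda>n. fourier_inv (psi s n)"
  have f0: "?f \<in> GPW1" by (intro fourier_inv_GPW1 S_inv_L2_on h0)
  note it = R_iterate[where l = l, OF s l f0]
  have basis: "orthonormal_basis ell2 GPW1 ?\<phi>" using s by (rule fourier_inv_psi_basis)
  obtain A B where AB: "0 < A" "0 < B" and bounds:
    "\<forall>x F. summable (\<lambda>j. (cmod (x j))\<^sup>2) \<longrightarrow>
       (\<forall>n. (\<lambda>j. x j * cnj (l j ^ n * L2_ip torus h0 (psi_tilde s j))) sums F n) \<longrightarrow>
       summable (\<lambda>n. (cmod (F n))\<^sup>2) \<and> A * (\<Sum>j. (cmod (x j))\<^sup>2) \<le> (\<Sum>n. (cmod (F n))\<^sup>2) \<and>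
       (\<Sum>n. (cmod (F n))\<^sup>2) \<le> B * (\<Sum>j. (cmod (x j))\<^sup>2)"
    by (rule uniformly_separated_frame_bounds[OF sep comp]) (rule that)
  have "summable (\<lambda>n. (cmod (L2_ip ell2 g ((R s l ^^ n) ?f)))\<^sup>2) \<and>
      A * (L2_norm ell2 g)\<^sup>2 \<le> (\<Sum>n. (cmod (L2_ip ell2 g ((R s l ^^ n) ?f)))\<^sup>2) \<and>
      (\<Sum>n. (cmod (L2_ip ell2 g ((R s l ^^ n) ?f)))\<^sup>2) \<le> B * (L2_norm ell2 g)\<^sup>2" if g: "g \<in> GPW1" for g
  proof -
    have parseval: "(\<lambda>j. (cmod (L2_ip ell2 g (?\<phi> j)))\<^sup>2) sums (L2_norm ell2 g)\<^sup>2"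
      using basis[unfolded orthonormal_basis_iff_parseval[OF GPW1_subset], THEN conjunct2, THEN conjunct2] g
      by (rule bspec)
    have "(\<lambda>j. L2_ip ell2 g (?\<phi> j) * cnj (l j ^ n * L2_ip torus h0 (psi_tilde s j))) sums L2_ip ell2 g ((R s l ^^ n) ?f)" for n
      using orthonormal_basis_sums_ip[OF GPW1_subset basis g subsetD[OF GPW1_subset it(1)], of n]
      unfolding it(2) ip_pullback[OF h0] .
    from bounds[rule_format, OF sums_summable[OF parseval] this] show ?thesis
      unfolding sums_unique[OF parseval, symmetric] .
  qed
  then show ?thesis unfolding is_frame_def using it(1) AB by blast
qed

theorem mainTheorem6:
  fixes s :: "nat \<Rightarrow> int \<times> int"
  assumes "bij s"
  shows "Omega2 = {\<xi> \<in> space torus. \<bar>fst \<xi>\<bar> + \<bar>snd \<xi>\<bar> \<le> 1/2} \<and>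
    sym_diff Omega2 (D1 \<union> D2 \<union> D3) \<in> null_sets torus \<and>
    inj_on P (D1 \<union> D2 \<union> D3) \<and>
    sym_diff (P ` (D1 \<union> D2 \<union> D3)) D \<in> null_sets torus \<and>
    orthonormal_basis torus (L2_on torus D) (psi_tilde s) \<and>
    (\<forall>n. AE \<xi> in torus. S_inv (psi_tilde s n) \<xi> = psi s n \<xi>) \<and>
    orthonormal_basis torus (L2_on torus Omega2) (psi s) \<and>
    (\<forall>(l :: nat \<Rightarrow> complex) (h0 :: real \<times> real \<Rightarrow> complex).
       uniformly_separated l \<and> h0 \<in> L2_on torus D \<and>
       comparable (\<lambda>n. (cmod (L2_ip torus h0 (psi_tilde s n)))\<^sup>2) (\<lambda>n. 1 - (cmod (l n))\<^sup>2) \<longrightarrow>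
         is_frame ell2 GPW1 (\<lambda>n. (R s l ^^ n) (fourier_inv (S_inv h0))) \<and>
         (\<forall>f\<in>GPW1. L2_lim ell2 sequentially
            (\<lambda>N k. \<Sum>n<N. l n * L2_ip ell2 f (fourier_inv (psi s n)) * fourier_inv (psi s n) k)
            (R s l f)))"
proof (intro conjI)
  show "Omega2 = {\<xi> \<in> space torus. \<bar>fst \<xi>\<bar> + \<bar>snd \<xi>\<bar> \<le> 1/2}" by (rule Omega2_eq)
  show "sym_diff Omega2 (D1 \<union> D2 \<union> D3) \<in> null_sets torus" by (rule sym_diff_Omega2)
  show "inj_on P (D1 \<union> D2 \<union> D3)" by (rule P_inj)
  show "sym_diff (P ` (D1 \<union> D2 \<union> D3)) D \<in> null_sets torus" by (rule sym_diff_D)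
  show "orthonormal_basis torus (L2_on torus D) (psi_tilde s)" using assms by (rule psi_tilde_basis)
  show "\<forall>n. AE \<xi> in torus. S_inv (psi_tilde s n) \<xi> = psi s n \<xi>" by (rule allI) (rule S_inv_psi_tilde)
  show "orthonormal_basis torus (L2_on torus Omega2) (psi s)" using assms by (rule psi_basis)
  have "is_frame ell2 GPW1 (\<lambda>n. (R s l ^^ n) (fourier_inv (S_inv h0))) \<and>
      (\<forall>f\<in>GPW1. L2_lim ell2 sequentially
         (\<lambda>N k. \<Sum>n<N. l n * L2_ip ell2 f (fourier_inv (psi s n)) * fourier_inv (psi s n) k) (R s l f))"
    if "uniformly_separated l" "h0 \<in> L2_on torus D"
      "comparable (\<lambda>n. (cmod (L2_ip torus h0 (psi_tilde s n)))\<^sup>2) (\<lambda>n. 1 - (cmod (l n))\<^sup>2)" for l h0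
  proof (rule conjI[OF R_orbit_frame[OF assms that]], rule ballI)
    have "cmod (l n) < 1" for n using that(1) by (simp add: uniformly_separated_def)
    then show "L2_lim ell2 sequentially
        (\<lambda>N k. \<Sum>n<N. l n * L2_ip ell2 f (fourier_inv (psi s n)) * fourier_inv (psi s n) k) (R s l f)"
      if "f \<in> GPW1" for f
      using that by (rule R_expansion[OF assms])
  qed
  then show "\<forall>(l :: nat \<Rightarrow> complex) (h0 :: real \<times> real \<Rightarrow> complex).
       uniformly_separated l \<and> h0 \<in> L2_on torus D \<and>
       comparable (\<lambda>n. (cmod (L2_ip torus h0 (psi_tilde s n)))\<^sup>2) (\<lambda>n. 1 - (cmod (l n))\<^sup>2) \<longrightarrow>
         is_frame ell2 GPW1 (\<lambda>n. (R s l ^^ n) (fourier_inv (S_inv h0))) \<and>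
         (\<forall>f\<in>GPW1. L2_lim ell2 sequentially
            (\<lambda>N k. \<Sum>n<N. l n * L2_ip ell2 f (fourier_inv (psi s n)) * fourier_inv (psi s n) k)
            (R s l f))"
    by blast
qed

end
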